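(* The limit of the probability that a subgroup of $\mathrm{Sz}(q)$ is a $2$-group equals $1$; that is, with $q=2^{2n+1}$, $$\lim_{n\to+\infty}\frac{\left|\{H\le \mathrm{Sz}(2^{2n+1}) : H \text{ is a } 2\text{-group}\}\right|}{\left|\mathfrak{s}(\mathrm{Sz}(2^{2n+1}))\right|}=1.$$
   Context: For a finite group $G$, $\mathfrak{s}(G)$ is the set of all subgroups of $G$. Suzuki groups: let $n\ge 1$, $q=2^{2n+1}$, $\theta=2^{n+1}$, and let $\mathbb{F}_q$ be the field with $q$ elements. For $a,b\in\mathbb{F}_q$ and $\lambda\in\mathbb{F}_q^\times$ put $$S(a,b)=\begin{pmatrix} 1 & 0 & 0 & 0 \\ a & 1 & 0 & 0 \\ b & a^\theta & 1 & 0 \\ a^{2+\theta}+ab+b^\theta & a^{1+\theta}+b & a & 1 \end{pmatrix},\quad C(\lambda)=\mathrm{diag}\left(\lambda^{1+\frac{\theta}{2}},\lambda^{\frac{\theta}{2}},\lambda^{-\frac{\theta}{2}},\lambda^{-1-\frac{\theta}{2}}\right),\quad T=\begin{pmatrix} 0 & 0 & 0 & 1 \\ 0 & 0 & 1 & 0 \\ 0 & 1 & 0 & 0 \\ 1 & 0 & 0 & 0 \end{pmatrix}.$$ Then $\mathrm{Sz}(q)$ is the subgroup of $\mathrm{GL}_4(q)$ generated by all $S(a,b)$, all $C(\lambda)$ and $T$. *)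

theory Defs
  imports
    Complex_Main
    "HOL-Library.Z2"
    "HOL-Algebra.Generated_Groups"
    "HOL-Algebra.Algebraic_Closure_Type"
    "Jordan_Normal_Form.Determinant"
begin

section \<open>Subgroups and p-groups\<close>

text \<open>The trivial group counts as a p-group.\<close>

definition all_subgroups :: "('a, 'b) monoid_scheme \<Rightarrow> 'a set set" where
  "all_subgroups G = {H. subgroup H G}"

definition finite_p_group :: "nat \<Rightarrow> ('a, 'b) monoid_scheme \<Rightarrow> bool" where
  "finite_p_group p G \<longleftrightarrow> group G \<and> (\<exists>k. Coset.order G = p ^ k)"


section \<open>The field with q elements, q a power of 2\<close>

text \<open>
  For a power q of 2, the field with q elements is realised as the subfield of order q of
  an algebraic closure of the prime field \<^typ>\<open>bit\<close>; the lemmas below verify that this set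
  is a subfield with exactly q elements, and the only one.
\<close>

definition GF :: "nat \<Rightarrow> bit alg_closure set" where
  "GF q = {x. x ^ q = x}"

lemma of_nat_eq_0_iff_bit: "of_nat n = (0 :: bit) \<longleftrightarrow> even n"
  by (induction n) auto

lemma CHAR_bit [simp]: "CHAR(bit) = 2"
  by (rule CHAR_eqI) (simp_all add: of_nat_eq_0_iff_bit)

lemma two_eq_0_ac: "(2 :: bit alg_closure) = 0"
  using of_nat_CHAR[where 'a = "bit alg_closure"] by simp

lemma add_self_ac: "x + x = (0 :: bit alg_closure)"
  by (metis mult_2 mult_zero_left two_eq_0_ac)

lemma uminus_ac: "- x = (x :: bit alg_closure)"
  using add_self_ac[of x] by (simp add: eq_neg_iff_add_eq_0 minus_unique)

lemma add_power_2_ac: "(x + y) ^ (2 ^ k) = x ^ (2 ^ k) + y ^ (2 ^ k :: nat)"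
  for x y :: "bit alg_closure"
proof (induction k)
  case (Suc k)
  have "(x + y) ^ 2 ^ Suc k = ((x + y) ^ 2 ^ k) ^ 2"
    by (metis power_Suc2 power_mult)
  also have "\<dots> = (x ^ 2 ^ k) ^ 2 + (y ^ 2 ^ k) ^ 2"
    by (simp add: Suc.IH power2_sum two_eq_0_ac)
  finally show ?case
    by (metis power_Suc2 power_mult)
qed simp

lemma GF_0: "q > 0 \<Longrightarrow> 0 \<in> GF q"
  and GF_1: "1 \<in> GF q"
  and GF_mult: "x \<in> GF q \<Longrightarrow> y \<in> GF q \<Longrightarrow> x * y \<in> GF q"
  and GF_inverse: "x \<in> GF q \<Longrightarrow> inverse x \<in> GF q"
  by (simp_all add: GF_def power_mult_distrib power_inverse)

lemma GF_power: "x \<in> GF q \<Longrightarrow> x ^ k \<in> GF q"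
  by (induction k) (auto intro: GF_1 GF_mult)

lemma GF_add: "x \<in> GF (2 ^ k) \<Longrightarrow> y \<in> GF (2 ^ k) \<Longrightarrow> x + y \<in> GF (2 ^ k)"
  by (simp add: GF_def add_power_2_ac)

lemma GF_uminus: "x \<in> GF q \<Longrightarrow> - x \<in> GF q"
  by (simp add: uminus_ac)

lemma GF_sum: "(\<And>i. i \<in> I \<Longrightarrow> f i \<in> GF (2 ^ k)) \<Longrightarrow> sum f I \<in> GF (2 ^ k)"
  by (induction I rule: infinite_finite_induct) (auto intro: GF_0 GF_add)

lemma card_GF:
  assumes "k > 0"
  shows "card (GF (2 ^ k)) = 2 ^ k"
proof -
  define q :: nat where "q = 2 ^ k"
  have q: "q \<ge> 2"
    using assms by (cases k) (auto simp: q_def)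
  define p :: "bit alg_closure poly" where "p = monom 1 q - [:0, 1:]"
  have deg: "degree p = q"
    unfolding p_def diff_conv_add_uminus
    using q by (subst degree_add_eq_left) (auto simp: degree_monom_eq)
  hence "p \<noteq> 0"
    using q by auto
  have roots: "{x. poly p x = 0} = GF q"
    by (auto simp: p_def GF_def poly_monom)
  have "of_nat q = (0 :: bit alg_closure)"
    using assms by (simp add: q_def two_eq_0_ac)
  hence pderiv: "pderiv p = -1"
    by (simp add: p_def pderiv_diff pderiv_monom pderiv_pCons one_pCons)
  obtain A where A: "size A = degree p" "p = smult (lead_coeff p) (\<Prod>x\<in>#A. [:-x, 1:])"
    using alg_closed_imp_factorization[OF \<open>p \<noteq> 0\<close>] by blast
  have set_A: "set_mset A = GF q"
    using \<open>p \<noteq> 0\<close> by (subst roots [symmetric], subst A(2)) (auto simp: poly_prod_mset image_iff)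
  have "count A x = 1" if mem: "x \<in># A" for x
  proof (rule ccontr)
    assume "count A x \<noteq> 1"
    obtain B where B: "A = add_mset x B"
      using multi_member_split[OF mem] by blast
    with \<open>count A x \<noteq> 1\<close> have "x \<in># B"
      by (simp add: count_eq_zero_iff)
    from multi_member_split[OF this] obtain C where "B = add_mset x C"
      by blast
    define r where "r = smult (lead_coeff p) (\<Prod>y\<in>#C. [:-y, 1:])"
    have r: "p = [:-x, 1:] * ([:-x, 1:] * r)"
      by (subst A(2)) (simp add: B \<open>B = add_mset x C\<close> r_def mult_smult_right
            del: mult_pCons_left mult_pCons_right)
    have "poly (pderiv p) x = 0"
      unfolding r pderiv_mult by simp
    thus False
      by (simp add: pderiv)
  qed
  hence "size A = card (set_mset A)"
    by (simp add: size_multiset_overloaded_eq)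
  thus ?thesis
    using set_A A(1) deg by (simp add: q_def)
qed

lemma GF_unique:
  assumes "card F = 2 ^ k" and "k > 0"
    and "\<And>x y. x \<in> F \<Longrightarrow> y \<in> F \<Longrightarrow> x * y \<in> F" and "0 \<in> F"
  shows "F = GF (2 ^ k)"
proof -
  have fin: "finite F"
    using assms(1) card.infinite by fastforce
  have "x ^ (2 ^ k) = x" if x: "x \<in> F" "x \<noteq> 0" for x
  proof -
    have inj: "inj_on ((*) x) (F - {0})"
      using x by (auto simp: inj_on_def)
    have "(*) x ` (F - {0}) = F - {0}"
      using x assms(3) fin by (intro endo_inj_surj inj) auto
    hence "(\<Prod>y\<in>F - {0}. y) = (\<Prod>y\<in>F - {0}. x * y)"
      using prod.reindex[OF inj, of "\<lambda>y. y"] by simp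
    also have "\<dots> = x ^ card (F - {0}) * (\<Prod>y\<in>F - {0}. y)"
      by (simp add: prod.distrib)
    finally have "x ^ card (F - {0}) = 1"
      using fin by (simp add: prod_zero_iff)
    moreover have "2 ^ k = Suc (card (F - {0}))"
      using fin assms by (metis card_Suc_Diff1)
    ultimately show ?thesis
      by simp
  qed
  moreover have "(0 :: bit alg_closure) ^ (2 ^ k) = 0"
    by simp
  ultimately have "F \<subseteq> GF (2 ^ k)"
    unfolding GF_def by blast
  moreover have "finite (GF (2 ^ k))"
    using card_GF[OF assms(2)] card.infinite by fastforce
  ultimately show ?thesis
    using card_GF[OF assms(2)] assms(1) by (simp add: card_subset_eq)
qed


section \<open>The general linear group of degree 4\<close>

definition mat_monoid :: "nat \<Rightarrow> bit alg_closure set \<Rightarrow> bit alg_closure mat monoid" where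
  "mat_monoid m F =
     \<lparr>carrier = {A \<in> carrier_mat m m. elements_mat A \<subseteq> F}, monoid.mult = (*), one = 1\<^sub>m m\<rparr>"

definition GL4 :: "nat \<Rightarrow> bit alg_closure mat monoid" where
  "GL4 q = units_of (mat_monoid 4 (GF q))"


lemma elements_mat_subset_iff:
  "A \<in> carrier_mat m m \<Longrightarrow> elements_mat A \<subseteq> F \<longleftrightarrow> (\<forall>i<m. \<forall>j<m. A $$ (i, j) \<in> F)"
  by (force simp: elements_mat_def)

lemma monoid_mat_monoid: "monoid (mat_monoid m (GF (2 ^ k)))"
proof (rule monoidI, unfold mat_monoid_def monoid.simps partial_object.simps mem_Collect_eq)
  fix A B :: "bit alg_closure mat"
  assume "A \<in> carrier_mat m m \<and> elements_mat A \<subseteq> GF (2 ^ k)"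
    and "B \<in> carrier_mat m m \<and> elements_mat B \<subseteq> GF (2 ^ k)"
  hence A: "A \<in> carrier_mat m m" "\<And>i j. i < m \<Longrightarrow> j < m \<Longrightarrow> A $$ (i, j) \<in> GF (2 ^ k)"
    and B: "B \<in> carrier_mat m m" "\<And>i j. i < m \<Longrightarrow> j < m \<Longrightarrow> B $$ (i, j) \<in> GF (2 ^ k)"
    by (auto simp: elements_mat_subset_iff)
  have AB: "A * B \<in> carrier_mat m m"
    using A(1) B(1) by (rule mult_carrier_mat)
  have "(A * B) $$ (i, j) \<in> GF (2 ^ k)" if "i < m" "j < m" for i j
  proof -
    have "(A * B) $$ (i, j) = (\<Sum>l\<in>{0..<m}. A $$ (i, l) * B $$ (l, j))"
      using A(1) B(1) that by (simp add: scalar_prod_def)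
    also have "\<dots> \<in> GF (2 ^ k)"
      using that by (intro GF_sum GF_mult A(2) B(2)) auto
    finally show ?thesis .
  qed
  with AB show "A * B \<in> carrier_mat m m \<and> elements_mat (A * B) \<subseteq> GF (2 ^ k)"
    by (simp add: elements_mat_subset_iff)
next
  have "1\<^sub>m m $$ (i, j) \<in> GF (2 ^ k)" if "i < m" "j < m" for i j
    using that GF_0[of "2 ^ k"] GF_1[of "2 ^ k"] by simp
  thus "1\<^sub>m m \<in> carrier_mat m m \<and> elements_mat (1\<^sub>m m) \<subseteq> GF (2 ^ k)"
    by (intro conjI one_carrier_mat elements_mat_subset_iff[OF one_carrier_mat, THEN iffD2] allI impI)
next
  fix A B C :: "bit alg_closure mat"
  assume "A \<in> carrier_mat m m \<and> elements_mat A \<subseteq> GF (2 ^ k)"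
    and "B \<in> carrier_mat m m \<and> elements_mat B \<subseteq> GF (2 ^ k)"
    and "C \<in> carrier_mat m m \<and> elements_mat C \<subseteq> GF (2 ^ k)"
  thus "A * B * C = A * (B * C)"
    by (elim conjE) (rule assoc_mult_mat)
next
  fix A :: "bit alg_closure mat"
  assume "A \<in> carrier_mat m m \<and> elements_mat A \<subseteq> GF (2 ^ k)"
  thus "1\<^sub>m m * A = A" and "A * 1\<^sub>m m = A"
    by (auto intro: left_mult_one_mat right_mult_one_mat)
qed

lemma finite_mat_monoid:
  assumes "k > 0"
  shows "finite (carrier (mat_monoid m (GF (2 ^ k))))"
proof -
  have fin: "finite (GF (2 ^ k))"
    using card_GF[OF assms] card.infinite by fastforce
  have "carrier (mat_monoid m (GF (2 ^ k))) \<subseteq>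
          (\<lambda>f. mat m m f) ` (({0..<m} \<times> {0..<m}) \<rightarrow>\<^sub>E GF (2 ^ k))"
  proof
    fix A
    assume "A \<in> carrier (mat_monoid m (GF (2 ^ k)))"
    hence A: "A \<in> carrier_mat m m" "elements_mat A \<subseteq> GF (2 ^ k)"
      by (auto simp: mat_monoid_def)
    have "A = mat m m (restrict (\<lambda>ij. A $$ ij) ({0..<m} \<times> {0..<m}))"
      using A by (intro eq_matI) auto
    moreover have "restrict (\<lambda>ij. A $$ ij) ({0..<m} \<times> {0..<m}) \<in> ({0..<m} \<times> {0..<m}) \<rightarrow>\<^sub>E GF (2 ^ k)"
      using A by (auto simp: subset_iff elements_matI)
    ultimately show "A \<in> (\<lambda>f. mat m m f) ` (({0..<m} \<times> {0..<m}) \<rightarrow>\<^sub>E GF (2 ^ k))"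
      by (rule image_eqI)
  qed
  thus ?thesis
    by (rule finite_subset) (intro finite_imageI finite_PiE fin; simp)
qed

lemma carrier_GL4:
  assumes "k > 0"
  shows "carrier (GL4 (2 ^ k)) =
    {A \<in> carrier_mat 4 4. elements_mat A \<subseteq> GF (2 ^ k) \<and> det A \<noteq> 0}"
proof -
  let ?M = "mat_monoid 4 (GF (2 ^ k))"
  interpret monoid ?M by (rule monoid_mat_monoid)
  have M: "carrier ?M = {A \<in> carrier_mat 4 4. elements_mat A \<subseteq> GF (2 ^ k)}"
    "monoid.mult ?M = (*)" "monoid.one ?M = 1\<^sub>m 4"
    by (simp_all add: mat_monoid_def)
  have "A \<in> Units ?M" if A: "A \<in> carrier ?M" and det: "det A \<noteq> 0" for A
  proof -
    have A': "A \<in> carrier_mat 4 4"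
      using A M by auto
    obtain C where C: "C \<in> carrier_mat 4 4" "C * A = 1\<^sub>m 4"
      using det_non_zero_imp_unit[OF A' det, of undefined]
      by (auto simp: Units_def ring_mat_def)
    have "inj_on ((*) A) (carrier ?M)"
    proof (rule inj_onI)
      fix P Q
      assume PQ: "P \<in> carrier ?M" "Q \<in> carrier ?M" "A * P = A * Q"
      hence PQ': "P \<in> carrier_mat 4 4" "Q \<in> carrier_mat 4 4"
        using M by auto
      have "C * A * P = C * A * Q"
        using assoc_mult_mat[OF C(1) A' PQ'(1)] assoc_mult_mat[OF C(1) A' PQ'(2)] PQ(3) by simp
      thus "P = Q"
        using C PQ' by simp
    qed
    moreover have "(*) A ` carrier ?M \<subseteq> carrier ?M"
      using m_closed[OF A] M(2) by auto
    ultimately have "(*) A ` carrier ?M = carrier ?M"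
      using finite_mat_monoid[OF assms] by (intro endo_inj_surj)
    then obtain B where B: "B \<in> carrier ?M" "A * B = 1\<^sub>m 4"
      using one_closed M(3) by (metis imageE)
    have "B \<in> carrier_mat 4 4"
      using B M by auto
    from mat_mult_left_right_inverse[OF A' this B(2)] show ?thesis
      using A B M by (auto simp: Units_def)
  qed
  moreover have "det A \<noteq> 0" if "A \<in> Units ?M" for A
  proof -
    from that obtain B where "A \<in> carrier_mat 4 4" "B \<in> carrier_mat 4 4" "A * B = 1\<^sub>m 4"
      using M by (auto simp: Units_def)
    thus ?thesis
      using det_mult[of A 4 B] by auto
  qed
  ultimately have "Units ?M = {A \<in> carrier ?M. det A \<noteq> 0}"
    by (intro equalityI subsetI) (simp_all add: Units_closed)
  thus ?thesis
    by (simp add: GL4_def units_of_carrier M(1) conj_assoc)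
qed


section \<open>Suzuki groups\<close>

text \<open>
  \<open>Sz n\<close> is the group Sz(q) for q = \<open>suz_q n\<close>; it is the Suzuki group for n > 0.
  As \<open>suz_theta n\<close> is even, \<open>suz_theta n div 2\<close> is an exact division.
\<close>

definition suz_q :: "nat \<Rightarrow> nat" where
  "suz_q n = 2 ^ (2 * n + 1)"

definition suz_theta :: "nat \<Rightarrow> nat" where
  "suz_theta n = 2 ^ (n + 1)"

definition suz_S :: "nat \<Rightarrow> bit alg_closure \<Rightarrow> bit alg_closure \<Rightarrow> bit alg_closure mat" where
  "suz_S n a b = (let t = suz_theta n in mat_of_rows_list 4
     [[1,                           0,               0, 0],
      [a,                           1,               0, 0],
      [b,                           a ^ t,           1, 0],
      [a ^ (2 + t) + a * b + b ^ t, a ^ (1 + t) + b, a, 1]])"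

definition suz_C :: "nat \<Rightarrow> bit alg_closure \<Rightarrow> bit alg_closure mat" where
  "suz_C n l = (let h = suz_theta n div 2 in mat_of_rows_list 4
     [[l ^ (1 + h), 0,     0,             0],
      [0,           l ^ h, 0,             0],
      [0,           0,     inverse l ^ h, 0],
      [0,           0,     0,             inverse l ^ (1 + h)]])"

definition suz_T :: "bit alg_closure mat" where
  "suz_T = mat_of_rows_list 4
     [[0, 0, 0, 1],
      [0, 0, 1, 0],
      [0, 1, 0, 0],
      [1, 0, 0, 0]]"

definition suz_generators :: "nat \<Rightarrow> bit alg_closure mat set" where
  "suz_generators n =
     {suz_S n a b | a b. a \<in> GF (suz_q n) \<and> b \<in> GF (suz_q n)}
     \<union> {suz_C n l | l. l \<in> GF (suz_q n) - {0}} \<union> {suz_T}"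

definition Sz :: "nat \<Rightarrow> bit alg_closure mat monoid" where
  "Sz n = (GL4 (suz_q n))\<lparr>carrier := generate (GL4 (suz_q n)) (suz_generators n)\<rparr>"


lemma carrier_GL4_suz_q:
  "carrier (GL4 (suz_q n)) =
    {A \<in> carrier_mat 4 4. elements_mat A \<subseteq> GF (suz_q n) \<and> det A \<noteq> 0}"
  unfolding suz_q_def by (rule carrier_GL4) simp

lemma all_less_4: "(\<forall>i<4::nat. P i) \<longleftrightarrow> P 0 \<and> P 1 \<and> P 2 \<and> P 3"
proof -
  have "{..<4::nat} = {0, 1, 2, 3}"
    by auto
  thus ?thesis
    by (metis (no_types, lifting) insert_iff lessThan_iff empty_iff)
qed

lemma upt_4: "[0..<4] = [0, 1, 2, 3::nat]"
  by (simp add: upt_rec)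

lemma det_lower_triangular_4:
  assumes "A \<in> carrier_mat 4 4"
    and "A $$ (0, 1) = 0" "A $$ (0, 2) = 0" "A $$ (0, 3) = 0"
        "A $$ (1, 2) = 0" "A $$ (1, 3) = 0" "A $$ (2, 3) = 0"
  shows "det A = A $$ (0, 0) * A $$ (1, 1) * A $$ (2, 2) * A $$ (3, 3)"
proof -
  have "\<forall>j<4. \<forall>i<4. i < j \<longrightarrow> A $$ (i, j) = 0"
    using assms(2-) by (simp add: all_less_4)
  hence "det A = prod_list (diag_mat A)"
    by (intro det_lower_triangular[OF _ assms(1)]) auto
  also have "diag_mat A = [A $$ (0, 0), A $$ (1, 1), A $$ (2, 2), A $$ (3, 3)]"
    using assms(1) by (simp add: diag_mat_def upt_4 del: upt_Suc)
  finally show ?thesis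
    by (simp add: mult.assoc)
qed

lemma mat_of_rows_list_4:
  "mat_of_rows_list 4 [r0, r1, r2, r3] \<in> carrier_mat 4 4"
  "i < 4 \<Longrightarrow> j < 4 \<Longrightarrow> mat_of_rows_list 4 [r0, r1, r2, r3] $$ (i, j) = [r0, r1, r2, r3] ! i ! j"
  by (rule carrier_matI) (simp_all add: mat_of_rows_list_def)

lemma mat_of_rows_list_in_GL4:
  assumes "A = mat_of_rows_list 4 [[a00, a01, a02, a03], [a10, a11, a12, a13],
      [a20, a21, a22, a23], [a30, a31, a32, a33]]"
    and "{a00, a01, a02, a03, a10, a11, a12, a13,
      a20, a21, a22, a23, a30, a31, a32, a33} \<subseteq> GF (suz_q n)"
    and "det A \<noteq> 0"
  shows "A \<in> carrier (GL4 (suz_q n))"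
proof -
  have A: "A \<in> carrier_mat 4 4"
    unfolding assms(1) by (rule mat_of_rows_list_4)
  moreover have "elements_mat A \<subseteq> GF (suz_q n)"
    unfolding elements_mat_subset_iff[OF A] all_less_4
    using assms(2) by (simp add: assms(1) mat_of_rows_list_4)
  ultimately show ?thesis
    using assms(3) by (simp only: carrier_GL4_suz_q mem_Collect_eq simp_thms)
qed

lemma GF_suz_q_closed:
  "0 \<in> GF (suz_q n)" "x \<in> GF (suz_q n) \<Longrightarrow> y \<in> GF (suz_q n) \<Longrightarrow> x + y \<in> GF (suz_q n)"
  unfolding suz_q_def by (rule GF_0, simp) (rule GF_add)

lemma suz_S_in_GL4:
  assumes "a \<in> GF (suz_q n)" "b \<in> GF (suz_q n)"
  shows "suz_S n a b \<in> carrier (GL4 (suz_q n))"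
proof (rule mat_of_rows_list_in_GL4)
  show "suz_S n a b = mat_of_rows_list 4
     [[1, 0, 0, 0],
      [a, 1, 0, 0],
      [b, a ^ suz_theta n, 1, 0],
      [a ^ (2 + suz_theta n) + a * b + b ^ suz_theta n, a ^ (1 + suz_theta n) + b, a, 1]]"
    by (simp only: suz_S_def Let_def)
  show "det (suz_S n a b) \<noteq> 0"
    by (subst det_lower_triangular_4) (simp_all add: suz_S_def Let_def mat_of_rows_list_4)
qed (use assms in \<open>intro insert_subsetI empty_subsetI GF_suz_q_closed GF_mult GF_power GF_1\<close>)

lemma suz_C_in_GL4:
  assumes "l \<in> GF (suz_q n)" "l \<noteq> 0"
  shows "suz_C n l \<in> carrier (GL4 (suz_q n))"
proof (rule mat_of_rows_list_in_GL4)
  show "suz_C n l = mat_of_rows_list 4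
     [[l ^ (1 + suz_theta n div 2), 0, 0, 0],
      [0, l ^ (suz_theta n div 2), 0, 0],
      [0, 0, inverse l ^ (suz_theta n div 2), 0],
      [0, 0, 0, inverse l ^ (1 + suz_theta n div 2)]]"
    by (simp only: suz_C_def Let_def)
  show "det (suz_C n l) \<noteq> 0"
    using assms(2)
    by (subst det_lower_triangular_4) (simp_all add: suz_C_def Let_def mat_of_rows_list_4)
qed (use assms in \<open>intro insert_subsetI empty_subsetI GF_suz_q_closed GF_power GF_inverse GF_1\<close>)

lemma suz_T_in_GL4: "suz_T \<in> carrier (GL4 (suz_q n))"
proof (rule mat_of_rows_list_in_GL4[OF suz_T_def])
  have A: "suz_T \<in> carrier_mat 4 4"
    unfolding suz_T_def by (rule mat_of_rows_list_4)
  have "\<forall>i<4. \<forall>j<4. (suz_T * suz_T) $$ (i, j) = (1\<^sub>m 4 :: bit alg_closure mat) $$ (i, j)"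
    unfolding all_less_4
    by (simp add: suz_T_def mat_of_rows_list_def scalar_prod_def numeral_eq_Suc)
  hence "suz_T * suz_T = 1\<^sub>m 4"
    using A by (intro eq_matI) auto
  thus "det suz_T \<noteq> 0"
    using det_mult[OF A A] by auto
qed (intro insert_subsetI empty_subsetI GF_suz_q_closed GF_1)

lemma suz_generators_in_GL4: "suz_generators n \<subseteq> carrier (GL4 (suz_q n))"
  by (auto simp: suz_generators_def suz_S_in_GL4 suz_C_in_GL4 suz_T_in_GL4)

lemma Sz_subgroup: "subgroup (carrier (Sz n)) (GL4 (suz_q n))"
proof -
  interpret monoid "mat_monoid 4 (GF (suz_q n))"
    unfolding suz_q_def by (rule monoid_mat_monoid)
  interpret G: group "GL4 (suz_q n)"
    unfolding GL4_def by (rule units_group)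
  show ?thesis
    using G.generate_is_subgroup[OF suz_generators_in_GL4] by (simp add: Sz_def)
qed

end

theory Submission
  imports Defs "HOL-Analysis.Cartesian_Space" "HOL-Algebra.Sylow" "HOL-Algebra.Group_Action"
    "HOL-Number_Theory.Cong"
begin

text \<open>
  Write \<open>m = 2 n + 1\<close> and \<open>q = 2^m\<close>. A Sylow 2-subgroup \<open>P\<close> of \<open>Sz(q)\<close> has an elementary abelian
  centre of order \<open>q\<close>, which alone has about \<open>2^(m^2/4)\<close> subgroups (\<open>card_two_subgroups\<close>). The
  subgroups that are not 2-groups number at most \<open>2^(c m^2)\<close> for all large \<open>m\<close>, with a constant
  \<open>c < 1/4\<close>, so their proportion tends to 0.

  For this upper bound, let \<open>H\<close> be any subgroup. Its Sylow subgroups for odd primes are cyclic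
  (\<open>odd_prime_sylow_cyclic\<close>), so \<open>H\<close> is generated by a Sylow 2-subgroup \<open>Q\<close> and one element for
  each odd prime divisor of its order. As \<open>Sz(q)\<close> has order at most \<open>2^(16 m)\<close>, the number of these
  primes is \<open>o(m)\<close> (\<open>card_prime_factors_bound\<close>), and given \<open>Q\<close> there are only \<open>2^(o(m^2))\<close>
  possibilities for \<open>H\<close>. It remains to count the possible \<open>Q\<close>. If \<open>H\<close> is not a 2-group, then \<open>Q\<close> is
  cyclic, or it is conjugate to a subgroup of \<open>P\<close> normalized by an element of odd prime order \<open>r\<close>
  in a two-point stabilizer (\<open>restricted_sylow\<close>).

  Subgroups of the second kind are rare, because an element of order \<open>r\<close> centralizing no nontrivial
  element of \<open>P\<close> enforces large indices. Since \<open>r\<close> divides \<open>2^m - 1\<close> with \<open>m\<close> odd, the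
  index of one normalized subgroup in a larger one is at least 32, except for \<open>r = 7\<close>, where it is at least 8
  (\<open>stable_jump\<close>). A count of generating lists (\<open>card_closed_family_le\<close>) turns index at least
  \<open>2^d\<close> in a group of order \<open>2^M\<close> into a bound of order \<open>2^(M^2/(4 d))\<close> on the number of subgroups. For
  \<open>d = 5\<close> and \<open>M = 2 m\<close> this is \<open>2^(m^2/5)\<close>. For \<open>r = 7\<close> the centre of \<open>P\<close> and the quotient by it
  are disjoint modules for the element of order 7, so that a pair of submodules determines the
  subgroup, and \<open>d = 3\<close>, \<open>M = m\<close> yields \<open>2^(2 m^2/12)\<close> (\<open>card_stable_pairs_7\<close>).

  All facts about the group come from its action on the \<open>q^2 + 1\<close> points of the Suzuki ovoid and
  from an invariant symplectic form, which are checked on the generators. The equation of the ovoid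
  determines the stabilizers of two points (\<open>two_point_stabilizer\<close>), and \<open>P\<close> is the kernel of a
  linear character of the stabilizer of one point (\<open>P_eq\<close>).
\<close>

section \<open>Counting the members of a closure system\<close>

lemma Inter_mem_of_closed:
  assumes "finite \<A>" "\<A> \<noteq> {}" "\<A> \<subseteq> \<K>" and "\<And>A B. A \<in> \<K> \<Longrightarrow> B \<in> \<K> \<Longrightarrow> A \<inter> B \<in> \<K>"
  shows "\<Inter>\<A> \<in> \<K>"
  using assms(1-3)
proof (induction \<A> rule: finite_ne_induct)
  case (insert A \<A>)
  then show ?case using assms(4) by simp
qed auto

text \<open>
  Each proper inclusion in the family multiplies the cardinality by at least \<open>2 ^ d\<close>. Hence at
  least half of \<open>Q\<close> lies outside any smaller member, and \<open>l\<close> successive choices outside the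
  closure of the previous ones already exhaust \<open>Q\<close>.
\<close>

lemma many_generating_lists:
  fixes \<K> :: "'a set set"
  assumes U: "finite U" "\<K> \<subseteq> Pow U"
    and inter: "\<And>A B. A \<in> \<K> \<Longrightarrow> B \<in> \<K> \<Longrightarrow> A \<inter> B \<in> \<K>"
    and jump: "\<And>A B. A \<in> \<K> \<Longrightarrow> B \<in> \<K> \<Longrightarrow> A \<subset> B \<Longrightarrow> 2 ^ d * card A \<le> card B"
    and d: "d > 0" and Q: "Q \<in> \<K>"
  shows "A \<in> \<K> \<Longrightarrow> A \<subseteq> Q \<Longrightarrow> card Q \<le> 2 ^ (d * l) * card A \<Longrightarrow>
    card Q ^ l \<le> 2 ^ l * card {xs. length xs = l \<and> set xs \<subseteq> Q \<and> (\<forall>B\<in>\<K>. A \<union> set xs \<subseteq> B \<longrightarrow> Q \<subseteq> B)}"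
proof (induction l arbitrary: A)
  case 0
  have "finite Q" using U Q by (meson PowD finite_subset subsetD)
  hence "A = Q" using 0 card_seteq by (metis mult_0_right power_0 mult_1)
  hence "{xs :: 'a list. length xs = 0 \<and> set xs \<subseteq> Q \<and> (\<forall>B\<in>\<K>. A \<union> set xs \<subseteq> B \<longrightarrow> Q \<subseteq> B)} = {[]}"
    by auto
  then show ?case by simp
next
  case (Suc l)
  define S where "S l A = {xs :: 'a list. length xs = l \<and> set xs \<subseteq> Q \<and> (\<forall>B\<in>\<K>. A \<union> set xs \<subseteq> B \<longrightarrow> Q \<subseteq> B)}" for l A
  have finQ: "finite Q" using U Q by (meson PowD finite_subset subsetD)
  have finS: "finite (S l A)" for l A
    by (rule finite_subset[OF _ finite_lists_length_eq[OF finQ, of l]]) (auto simp: S_def)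
  show ?case
  proof (cases "A = Q")
    case True
    hence "S (Suc l) A = {xs. set xs \<subseteq> Q \<and> length xs = Suc l}" by (auto simp: S_def)
    hence "card (S (Suc l) A) = card Q ^ Suc l" using card_lists_length_eq[OF finQ] by metis
    then show ?thesis unfolding S_def[symmetric] by simp
  next
    case False
    hence AQ: "A \<subset> Q" using Suc.prems by auto
    have "2 * card A \<le> 2 ^ d * card A" using d by (cases d) auto
    also have "\<dots> \<le> card Q" by (rule jump[OF Suc.prems(1) Q AQ])
    finally have half: "card Q \<le> 2 * card (Q - A)"
      using card_Diff_subset[of A Q] AQ finQ finite_subset[of A Q] by auto
    \<comment> \<open>the closure of \<open>insert x A\<close>\<close>
    define A' where "A' x = \<Inter>{B\<in>\<K>. insert x A \<subseteq> B}" for x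
    have A': "A' x \<in> \<K>" "A \<subset> A' x" "A' x \<subseteq> Q" "x \<in> A' x"
      "\<And>B. B \<in> \<K> \<Longrightarrow> insert x A \<subseteq> B \<Longrightarrow> A' x \<subseteq> B" if x: "x \<in> Q - A" for x
    proof -
      have "finite \<K>" using U finite_subset by auto
      moreover have "Q \<in> {B\<in>\<K>. insert x A \<subseteq> B}" using x Q AQ by auto
      ultimately show "A' x \<in> \<K>" unfolding A'_def
        by (intro Inter_mem_of_closed inter) auto
      show "x \<in> A' x" unfolding A'_def by auto
      have "A \<subseteq> A' x" unfolding A'_def by auto
      thus "A \<subset> A' x" using \<open>x \<in> A' x\<close> x by auto
      show "A' x \<subseteq> Q" using \<open>Q \<in> {B\<in>\<K>. insert x A \<subseteq> B}\<close> unfolding A'_def by blast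
      show "A' x \<subseteq> B" if "B \<in> \<K>" "insert x A \<subseteq> B" for B using that unfolding A'_def by blast
    qed
    have IH: "card Q ^ l \<le> 2 ^ l * card (S l (A' x))" if x: "x \<in> Q - A" for x
      unfolding S_def
    proof (rule Suc.IH)
      have "card Q \<le> 2 ^ (d * Suc l) * card A" by (rule Suc.prems)
      also have "\<dots> = 2 ^ (d * l) * (2 ^ d * card A)" by (simp add: power_add)
      also have "\<dots> \<le> 2 ^ (d * l) * card (A' x)"
        using jump[OF Suc.prems(1) A'(1,2)[OF x]] by (intro mult_left_mono) auto
      finally show "card Q \<le> 2 ^ (d * l) * card (A' x)" .
    qed (use A' x in auto)
    have sub: "(\<Union>x\<in>Q - A. (#) x ` S l (A' x)) \<subseteq> S (Suc l) A"
    proof safe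
      fix x xs assume x: "x \<in> Q" "x \<notin> A" and xs: "xs \<in> S l (A' x)"
      have "Q \<subseteq> B" if "B \<in> \<K>" "A \<union> set (x # xs) \<subseteq> B" for B
      proof -
        have "A' x \<subseteq> B" using A'(5)[of x B] x that by auto
        thus ?thesis using xs that unfolding S_def by auto
      qed
      thus "x # xs \<in> S (Suc l) A" using xs x unfolding S_def by auto
    qed
    have "card Q ^ Suc l \<le> (2 * card (Q - A)) * card Q ^ l"
      using half by simp
    also have "\<dots> = 2 * (\<Sum>x\<in>Q - A. card Q ^ l)" by simp
    also have "\<dots> \<le> 2 * (\<Sum>x\<in>Q - A. 2 ^ l * card (S l (A' x)))"
      by (intro mult_left_mono sum_mono IH) auto
    also have "\<dots> = 2 ^ Suc l * (\<Sum>x\<in>Q - A. card ((#) x ` S l (A' x)))"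
      by (simp add: sum_distrib_left card_image mult.assoc)
    also have "\<dots> = 2 ^ Suc l * card (\<Union>x\<in>Q - A. (#) x ` S l (A' x))"
      by (subst card_UN_disjoint) (auto simp: finQ finS)
    also have "\<dots> \<le> 2 ^ Suc l * card (S (Suc l) A)"
      by (intro mult_left_mono card_mono sub finS) auto
    finally show ?thesis unfolding S_def .
  qed
qed

text \<open>
  A member \<open>Q\<close> with \<open>2 ^ (d * (l - 1)) \<le> card Q \<le> 2 ^ (d * l)\<close> is the closure of at least
  \<open>(card Q / 2) ^ l\<close> of the lists of length \<open>l\<close> over \<open>U\<close>, and a list has only one closure. The
  exponent \<open>l (M + 1 + d) - d l^2\<close> that results is at most \<open>(M + 1 + d)^2 / (4 d)\<close>. For \<open>d = 1\<close>
  this is the familiar growth \<open>2 ^ (M^2 / 4)\<close> of the number of subspaces of a vector space of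
  dimension \<open>M\<close> over the field with two elements.
\<close>

lemma card_closed_family_le:
  fixes \<K> :: "'a set set"
  assumes U: "finite U" "card U \<le> 2 ^ M" "\<K> \<subseteq> Pow U" "{} \<notin> \<K>"
    and inter: "\<And>A B. A \<in> \<K> \<Longrightarrow> B \<in> \<K> \<Longrightarrow> A \<inter> B \<in> \<K>"
    and jump: "\<And>A B. A \<in> \<K> \<Longrightarrow> B \<in> \<K> \<Longrightarrow> A \<subset> B \<Longrightarrow> 2 ^ d * card A \<le> card B"
    and d: "d > 0" and E: "(M + 1 + d)\<^sup>2 \<le> 4 * d * E"
  shows "card \<K> \<le> (M + 1) * 2 ^ E"
proof (cases "\<K> = {}")
  case False
  have finK: "finite \<K>" using U finite_subset by auto
  define A0 where "A0 = \<Inter>\<K>"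
  have A0: "A0 \<in> \<K>" unfolding A0_def using False finK by (intro Inter_mem_of_closed inter) auto
  have finA: "finite A" if "A \<in> \<K>" for A using that U by (meson PowD finite_subset subsetD)
  have A0_pos: "card A0 \<ge> 1" using A0 U finA[OF A0] by (metis One_nat_def Suc_leI card_gt_0_iff)
  define S where "S l Q = {xs :: 'a list. length xs = l \<and> set xs \<subseteq> Q \<and> (\<forall>B\<in>\<K>. A0 \<union> set xs \<subseteq> B \<longrightarrow> Q \<subseteq> B)}" for l Q
  define F where "F l = {Q\<in>\<K>. card Q \<le> 2 ^ (d * l) \<and> 2 ^ (d * (l - 1)) \<le> card Q}" for l
  have S_sub: "S l Q \<subseteq> {xs. set xs \<subseteq> U \<and> length xs = l}" if "Q \<in> \<K>" for l Q
    using that U unfolding S_def by auto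
  have fin_lists: "finite {xs. set xs \<subseteq> U \<and> length xs = l}" for l by (rule finite_lists_length_eq[OF U(1)])
  have F_le: "card (F l) \<le> 2 ^ E" for l
  proof -
    have "card (F l) * 2 ^ (d * (l - 1) * l) = (\<Sum>Q\<in>F l. (2 ^ (d * (l - 1))) ^ l)"
      by (simp add: power_mult)
    also have "\<dots> \<le> (\<Sum>Q\<in>F l. card Q ^ l)"
      by (intro sum_mono power_mono) (auto simp: F_def)
    also have "\<dots> \<le> (\<Sum>Q\<in>F l. 2 ^ l * card (S l Q))"
    proof (rule sum_mono)
      fix Q assume Q: "Q \<in> F l"
      have "card Q \<le> 2 ^ (d * l) * card A0"
        using Q mult_le_mono[OF order_refl[of "2 ^ (d * l)"] A0_pos] unfolding F_def
        by (auto intro: order_trans)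
      then show "card Q ^ l \<le> 2 ^ l * card (S l Q)"
        unfolding S_def using Q A0
        by (intro many_generating_lists[OF U(1,3) inter jump d]) (auto simp: F_def A0_def)
    qed
    also have "\<dots> = 2 ^ l * card (\<Union>Q\<in>F l. S l Q)"
      unfolding sum_distrib_left[symmetric]
    proof (subst card_UN_disjoint)
      show "finite (F l)" using finK by (auto simp: F_def)
      show "\<forall>i\<in>F l. finite (S l i)" using S_sub fin_lists finite_subset unfolding F_def by blast
      show "\<forall>i\<in>F l. \<forall>j\<in>F l. i \<noteq> j \<longrightarrow> S l i \<inter> S l j = {}"
      proof (intro ballI impI, rule ccontr)
        fix P Q assume PQ: "P \<in> F l" "Q \<in> F l" "P \<noteq> Q" "S l P \<inter> S l Q \<noteq> {}"
        have sub: "A0 \<subseteq> P" "A0 \<subseteq> Q" using PQ by (auto simp: A0_def F_def)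
        from PQ(4) obtain xs where xs: "xs \<in> S l P" "xs \<in> S l Q" by auto
        have K: "P \<in> \<K>" "Q \<in> \<K>" using PQ by (auto simp: F_def)
        have "set xs \<subseteq> P" "set xs \<subseteq> Q" using xs by (auto simp: S_def)
        hence "P \<subseteq> Q" using xs(1) K(2) sub unfolding S_def by simp
        moreover have "Q \<subseteq> P" using xs(2) K(1) sub \<open>set xs \<subseteq> P\<close> unfolding S_def by simp
        ultimately show False using PQ(3) by simp
      qed
    qed simp
    also have "\<dots> \<le> 2 ^ l * card {xs. set xs \<subseteq> U \<and> length xs = l}"
      using S_sub fin_lists by (intro mult_left_mono card_mono) (auto simp: F_def)
    also have "\<dots> = 2 ^ l * card U ^ l" by (simp add: card_lists_length_eq[OF U(1)])
    also have "\<dots> \<le> 2 ^ l * (2 ^ M) ^ l" using U by (intro mult_left_mono power_mono) auto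
    also have "\<dots> = 2 ^ (l * (M + 1))"
      by (simp flip: power_mult power_add add: algebra_simps)
    also have "\<dots> \<le> 2 ^ (E + d * (l - 1) * l)"
    proof (intro power_increasing)
      \<comment> \<open>completing the square in \<open>l\<close>\<close>
      have "0 \<le> (2 * int d * int l - (int M + 1 + int d))\<^sup>2" by simp
      hence "4 * int d * (int l * (int M + 1 + int d) - int d * int l * int l) \<le> (int M + 1 + int d)\<^sup>2"
        by (simp add: power2_eq_square algebra_simps)
      also have "(int M + 1 + int d)\<^sup>2 = int ((M + 1 + d)\<^sup>2)" by simp
      also have "\<dots> \<le> int (4 * d * E)" using E by (rule of_nat_mono)
      also have "\<dots> = 4 * int d * int E" by simp
      finally have *: "int l * (int M + 1 + int d) - int d * int l * int l \<le> int E"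
        using d by simp
      show "l * (M + 1) \<le> E + d * (l - 1) * l"
      proof (cases l)
        case (Suc k)
        have "int (l * (M + 1)) \<le> int (E + d * k * l)"
          using * unfolding Suc by (simp add: algebra_simps)
        hence "l * (M + 1) \<le> E + d * k * l" by (simp only: of_nat_le_iff)
        then show ?thesis by (simp only: Suc diff_Suc_1)
      qed simp
    qed simp
    finally show ?thesis by (simp add: power_add)
  qed
  have "\<K> \<subseteq> (\<Union>l\<le>M. F l)"
  proof
    fix Q assume Q: "Q \<in> \<K>"
    define l where "l = (LEAST l. card Q \<le> 2 ^ (d * l))"
    have "card Q \<le> 2 ^ M" using Q U by (meson PowD card_mono order_trans subsetD)
    also have "(2::nat) ^ M \<le> 2 ^ (d * M)" using d by (intro power_increasing) auto
    finally have M: "card Q \<le> 2 ^ (d * M)" .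
    have l: "card Q \<le> 2 ^ (d * l)" "l \<le> M" using M unfolding l_def by (auto intro: LeastI Least_le)
    have "2 ^ (d * (l - 1)) \<le> card Q"
    proof (cases "l = 0")
      case True
      have "Q \<noteq> {}" using Q U by auto
      then show ?thesis using True finA[OF Q] by (simp add: Suc_leI card_gt_0_iff)
    next
      case False
      hence "\<not> card Q \<le> 2 ^ (d * (l - 1))" unfolding l_def by (intro not_less_Least) simp
      then show ?thesis by simp
    qed
    thus "Q \<in> (\<Union>l\<le>M. F l)" using l Q by (auto simp: F_def)
  qed
  hence "card \<K> \<le> card (\<Union>l\<le>M. F l)"
    using finK by (intro card_mono) (auto simp: F_def)
  also have "\<dots> \<le> (\<Sum>l\<le>M. card (F l))" by (rule card_UN_le) simp
  also have "\<dots> \<le> (\<Sum>l\<le>M. 2 ^ E)" by (intro sum_mono F_le)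
  finally show ?thesis by simp
qed simp

section \<open>The number of prime divisors\<close>

text \<open>
  At most \<open>2 ^ L\<close> primes are smaller than \<open>2 ^ L\<close>, and each of the others contributes a factor of at
  least \<open>2 ^ L\<close> to \<open>N\<close>. A large constant \<open>L\<close> thus makes the number of prime divisors an
  arbitrarily small fraction of the logarithm of \<open>N\<close>.
\<close>

lemma card_prime_factors_bound:
  fixes N :: nat
  assumes "N > 0" "N \<le> 2 ^ T"
  shows "L * card (prime_factors N) \<le> L * 2 ^ L + (T :: nat)"
proof -
  define B where "B = {p \<in> prime_factors N. 2 ^ L \<le> p}"
  have "2 ^ (L * card B) = (\<Prod>p\<in>B. 2 ^ L :: nat)" by (simp add: power_mult)
  also have "\<dots> \<le> (\<Prod>p\<in>B. p)" by (rule prod_mono) (auto simp: B_def)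
  also have "\<dots> \<le> (\<Prod>p\<in>prime_factors N. p)"
    by (rule dvd_imp_le[OF prod_dvd_prod_subset]) (auto simp: B_def prod_pos prime_gt_0_nat in_prime_factors_imp_prime intro!: prod_pos)
  also have "\<dots> \<le> (\<Prod>p\<in>prime_factors N. p ^ multiplicity p N)"
  proof (rule prod_mono, safe)
    fix p assume p: "p \<in> prime_factors N"
    hence "multiplicity p N \<ge> 1" using prime_factors_multiplicity[of N] by auto
    thus "p \<le> p ^ multiplicity p N" using p
      by (metis One_nat_def in_prime_factors_imp_prime power_increasing power_one_right prime_ge_1_nat)
  qed
  also have "\<dots> = N" using assms(1) by (simp add: prod_prime_factors)
  finally have "(2::nat) ^ (L * card B) \<le> 2 ^ T" using assms(2) by (rule order_trans)
  hence B: "L * card B \<le> T" by (rule power_le_imp_le_exp[rotated]) simp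
  have "prime_factors N \<subseteq> B \<union> {..<2 ^ L}" by (auto simp: B_def)
  hence "card (prime_factors N) \<le> card (B \<union> {..<2 ^ L})"
    by (intro card_mono) (auto simp: B_def)
  also have "\<dots> \<le> card B + 2 ^ L" using card_Un_le[of B "{..<2 ^ L}"] by simp
  finally have "L * card (prime_factors N) \<le> L * (card B + 2 ^ L)" by (rule mult_left_mono) simp
  thus ?thesis using B by (simp add: algebra_simps)
qed

section \<open>Actions of subgroups on finite sets\<close>

text \<open>
  In contrast to the locale \<^locale>\<open>group_action\<close>, the function may take any values outside the set
  that is acted upon, so that the same \<open>act\<close> serves for all subgroups and all invariant sets.
\<close>

definition acts_on :: "('g, 'z) monoid_scheme \<Rightarrow> 'g set \<Rightarrow> ('g \<Rightarrow> 'x \<Rightarrow> 'x) \<Rightarrow> 'x set \<Rightarrow> bool" where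
  "acts_on G H act U \<longleftrightarrow> group G \<and> subgroup H G \<and> (\<forall>h\<in>H. \<forall>x\<in>U. act h x \<in> U) \<and> (\<forall>x\<in>U. act \<one>\<^bsub>G\<^esub> x = x) \<and>
     (\<forall>h\<in>H. \<forall>h'\<in>H. \<forall>x\<in>U. act (h \<otimes>\<^bsub>G\<^esub> h') x = act h (act h' x))"

lemma acts_onD:
  assumes "acts_on G H act U"
  shows "group G" "subgroup H G" "h \<in> H \<Longrightarrow> x \<in> U \<Longrightarrow> act h x \<in> U" "x \<in> U \<Longrightarrow> act \<one>\<^bsub>G\<^esub> x = x"
    "h \<in> H \<Longrightarrow> h' \<in> H \<Longrightarrow> x \<in> U \<Longrightarrow> act (h \<otimes>\<^bsub>G\<^esub> h') x = act h (act h' x)"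
  using assms unfolding acts_on_def by auto

lemma acts_on_inv:
  assumes "acts_on G H act U" "h \<in> H" "x \<in> U"
  shows "act (inv\<^bsub>G\<^esub> h) (act h x) = x" "act h (act (inv\<^bsub>G\<^esub> h) x) = x" "inv\<^bsub>G\<^esub> h \<in> H"
proof -
  interpret group G using assms(1) by (rule acts_onD)
  interpret H: subgroup H G using assms(1) by (rule acts_onD)
  show inv: "inv\<^bsub>G\<^esub> h \<in> H" using assms by simp
  show "act (inv\<^bsub>G\<^esub> h) (act h x) = x" "act h (act (inv\<^bsub>G\<^esub> h) x) = x"
    using acts_onD(5)[OF assms(1) inv assms(2,3)] acts_onD(5)[OF assms(1) assms(2) inv assms(3)]
      acts_onD(4)[OF assms(1,3)] assms(2) by auto
qed

lemma acts_on_group_action: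
  assumes "acts_on G H act U"
  shows "group_action (G\<lparr>carrier := H\<rparr>) U (\<lambda>h. restrict (act h) U)"
proof -
  note A = acts_onD[OF assms]
  interpret group G by (rule A)
  interpret H: subgroup H G by (rule A)
  have bij: "restrict (act h) U \<in> Bij U" if "h \<in> H" for h
  proof -
    have "bij_betw (act h) U U"
      by (rule bij_betwI[of _ _ _ "act (inv\<^bsub>G\<^esub> h)"]) (use A that acts_on_inv[OF assms that] in auto)
    thus ?thesis unfolding Bij_def by (simp add: bij_betw_restrict_eq)
  qed
  show ?thesis unfolding group_action_def group_hom_def group_hom_axioms_def
  proof (intro conjI homI)
    show "group (G\<lparr>carrier := H\<rparr>)" by (rule H.subgroup_is_group) (rule A)
    show "group (BijGroup U)" by (rule group_BijGroup)
    fix x y assume xy: "x \<in> carrier (G\<lparr>carrier := H\<rparr>)" "y \<in> carrier (G\<lparr>carrier := H\<rparr>)"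
    show "restrict (act x) U \<in> carrier (BijGroup U)"
      using bij xy by (simp add: BijGroup_def)
    show "restrict (act (x \<otimes>\<^bsub>G\<lparr>carrier := H\<rparr>\<^esub> y)) U = restrict (act x) U \<otimes>\<^bsub>BijGroup U\<^esub> restrict (act y) U"
      using bij xy A by (auto simp: BijGroup_def compose_def fun_eq_iff restrict_def)
  qed
qed

lemma card_orbit_stabilizer:
  assumes "acts_on G H act U" "x \<in> U"
  shows "card ((\<lambda>h. act h x) ` H) * card {h \<in> H. act h x = x} = card H"
proof -
  interpret group_action "G\<lparr>carrier := H\<rparr>" U "\<lambda>h. restrict (act h) U"
    by (rule acts_on_group_action[OF assms(1)])
  have "orbit (G\<lparr>carrier := H\<rparr>) (\<lambda>h. restrict (act h) U) x = (\<lambda>h. act h x) ` H"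
    "stabilizer (G\<lparr>carrier := H\<rparr>) (\<lambda>h. restrict (act h) U) x = {h \<in> H. act h x = x}"
    using assms(2) by (auto simp: orbit_def stabilizer_def)
  thus ?thesis using orbit_stabilizer_theorem[OF assms(2)] by (simp add: Coset.order_def)
qed

lemma dvd_card_of_orbits:
  assumes act: "acts_on G H act U" and fin: "finite U"
    and dvd: "\<And>x. x \<in> U \<Longrightarrow> n dvd card ((\<lambda>h. act h x) ` H)"
  shows "n dvd card U"
proof -
  interpret group_action "G\<lparr>carrier := H\<rparr>" U "\<lambda>h. restrict (act h) U"
    by (rule acts_on_group_action[OF act])
  let ?O = "orbits (G\<lparr>carrier := H\<rparr>) U (\<lambda>h. restrict (act h) U)"
  have O: "?O = (\<lambda>x. (\<lambda>h. act h x) ` H) ` U"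
    by (auto simp: orbits_def orbit_def image_def)
  have "card U = (\<Sum>A\<in>?O. \<Sum>x\<in>A. 1)"
    using partition.disjoint_sum[OF orbit_partition fin, of "\<lambda>_. 1::nat"] by simp
  also have "n dvd \<dots>" by (rule dvd_sum) (auto simp: O dvd)
  finally show ?thesis .
qed

lemma p_group_fixed_point:
  assumes act: "acts_on G H act U" and fin: "finite U" and p: "prime p" "card H = p ^ k"
    and nd: "\<not> p dvd card U"
  shows "\<exists>x\<in>U. \<forall>h\<in>H. act h x = x"
proof (rule ccontr)
  assume no: "\<not> ?thesis"
  have "p dvd card U"
  proof (rule dvd_card_of_orbits[OF act fin])
    fix x assume x: "x \<in> U"
    let ?o = "(\<lambda>h. act h x) ` H"
    have "card ?o dvd p ^ k" using card_orbit_stabilizer[OF act x] p(2) by (metis dvd_triv_left)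
    then obtain i where i: "card ?o = p ^ i" using p(1) divides_primepow_nat by blast
    have "i \<noteq> 0"
    proof
      assume "i = 0"
      then obtain y where y: "?o = {y}" using i card_1_singletonE by auto
      have "\<one>\<^bsub>G\<^esub> \<in> H" using act acts_onD(2) subgroup.one_closed by fast
      hence "x \<in> ?o" using acts_onD(4)[OF act x] by (metis imageI)
      thus False using y no x by auto
    qed
    thus "p dvd card ?o" using i by simp
  qed
  thus False using nd by simp
qed

lemma free_action_card_dvd:
  assumes act: "acts_on G H act U" and fin: "finite U"
    and free: "\<And>h x. h \<in> H \<Longrightarrow> x \<in> U \<Longrightarrow> act h x = x \<Longrightarrow> h = \<one>\<^bsub>G\<^esub>"
  shows "card H dvd card U"
proof (rule dvd_card_of_orbits[OF act fin])
  fix x assume x: "x \<in> U"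
  have "\<one>\<^bsub>G\<^esub> \<in> H" using act acts_onD(2) subgroup.one_closed by fast
  hence "{h \<in> H. act h x = x} = {\<one>\<^bsub>G\<^esub>}" using free x acts_onD(4)[OF act x] by blast
  hence "card {h \<in> H. act h x = x} = 1" by simp
  thus "card H dvd card ((\<lambda>h. act h x) ` H)" using card_orbit_stabilizer[OF act x] by simp
qed

text \<open>
  The iterates of \<open>f\<close> are an action of the cyclic group of order \<open>r\<close>.
\<close>

lemma prime_dvd_card_of_free:
  assumes fin: "finite U" and r: "prime r" and f: "\<And>x. x \<in> U \<Longrightarrow> f x \<in> U" "\<And>x. x \<in> U \<Longrightarrow> (f ^^ r) x = x"
    "\<And>x. x \<in> U \<Longrightarrow> f x \<noteq> x"
  shows "r dvd card U"
proof (rule ccontr)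
  assume nd: "\<not> r dvd card U"
  let ?Z = "integer_mod_group r"
  have r0: "r > 1" using r prime_gt_1_nat by auto
  have car: "carrier ?Z = {0..<int r}" "\<one>\<^bsub>?Z\<^esub> = 0" "x \<otimes>\<^bsub>?Z\<^esub> y = (x + y) mod int r" for x y
    using r0 by (auto simp: integer_mod_group_def)
  have fk: "(f ^^ k) x \<in> U" if "x \<in> U" for k x using that by (induction k) (auto intro: f)
  have "acts_on ?Z (carrier ?Z) (\<lambda>i. f ^^ nat i) U"
    unfolding acts_on_def
  proof (intro conjI ballI)
    show "group ?Z" by simp
    thus "subgroup (carrier ?Z) ?Z" by (rule group.subgroup_self)
    fix i j x assume ij: "i \<in> carrier ?Z" "j \<in> carrier ?Z" and x: "x \<in> U"
    have "(f ^^ nat ((i + j) mod int r)) x = (f ^^ (nat (i + j) mod r)) x"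
      using ij r0 car(1) by (simp add: nat_mod_distrib)
    also have "\<dots> = (f ^^ nat (i + j)) x" by (rule funpow_mod_eq[OF f(2)[OF x]])
    also have "\<dots> = (f ^^ nat i) ((f ^^ nat j) x)"
      using ij car(1) by (simp add: nat_add_distrib funpow_add)
    finally show "(f ^^ nat (i \<otimes>\<^bsub>?Z\<^esub> j)) x = (f ^^ nat i) ((f ^^ nat j) x)" by (simp add: car)
  qed (auto simp: car fk)
  from p_group_fixed_point[OF this fin r _ nd, of 1] obtain x where x: "x \<in> U" "\<forall>h\<in>carrier ?Z. (f ^^ nat h) x = x"
    using car(1) by auto
  hence "(f ^^ nat 1) x = x" using r0 car(1) by (intro bspec[OF x(2)]) auto
  thus False using f(3)[OF x(1)] by simp
qed

text \<open>
  The stabilizers of distinct points intersect trivially, so counting their union leaves exactly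
  \<open>card U - 1\<close> elements without fixed point. If \<open>v\<close> is an involution fixing a point other than
  \<open>a\<close>, then \<open>t v\<close> has no fixed point: both \<open>t\<close> and \<open>v\<close> invert \<open>t v\<close> and would have to fix
  its only fixed point. As every point has as many involutions as \<open>a\<close>, two involutions at \<open>a\<close>
  would yield \<open>2 (card U - 1)\<close> such products. This is the first step in the theory of Frobenius
  groups with a complement of even order.
\<close>

lemma frobenius_unique_involution:
  assumes act: "acts_on G H act U" and fin: "finite U" "finite H"
    and a: "a \<in> U" and trans: "\<And>x. x \<in> U \<Longrightarrow> \<exists>h\<in>H. act h a = x" and U1: "card U > 1"
    and unique: "\<And>h x y. h \<in> H \<Longrightarrow> h \<noteq> \<one>\<^bsub>G\<^esub> \<Longrightarrow> x \<in> U \<Longrightarrow> y \<in> U \<Longrightarrow> act h x = x \<Longrightarrow> act h y = y \<Longrightarrow> x = y"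
    and t: "t \<in> H" "act t a = a" "t \<noteq> \<one>\<^bsub>G\<^esub>" "t \<otimes>\<^bsub>G\<^esub> t = \<one>\<^bsub>G\<^esub>"
    and u: "u \<in> H" "act u a = a" "u \<noteq> \<one>\<^bsub>G\<^esub>" "u \<otimes>\<^bsub>G\<^esub> u = \<one>\<^bsub>G\<^esub>"
  shows "t = u"
proof (rule ccontr)
  assume tu: "t \<noteq> u"
  interpret group G using act by (rule acts_onD)
  interpret H: subgroup H G using act by (rule acts_onD)
  note A = acts_onD[OF act]
  define St where "St x = {h \<in> H. act h x = x}" for x
  define Fp where "Fp = {h \<in> H. \<forall>x\<in>U. act h x \<noteq> x}"
  have orb: "(\<lambda>h. act h x) ` H = U" if x: "x \<in> U" for x
  proof
    show "(\<lambda>h. act h x) ` H \<subseteq> U" using A(3) x by auto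
    show "U \<subseteq> (\<lambda>h. act h x) ` H"
    proof
      fix y assume y: "y \<in> U"
      obtain h k where hk: "h \<in> H" "act h a = x" "k \<in> H" "act k a = y" using trans x y by metis
      have "act (k \<otimes>\<^bsub>G\<^esub> inv\<^bsub>G\<^esub> h) x = y"
        using A(5)[OF hk(3) acts_on_inv(3)[OF act hk(1) x] x] acts_on_inv(1)[OF act hk(1) a] hk by simp
      moreover have "k \<otimes>\<^bsub>G\<^esub> inv\<^bsub>G\<^esub> h \<in> H" using hk by simp
      ultimately show "y \<in> (\<lambda>h. act h x) ` H" by blast
    qed
  qed
  define s where "s = card (St a)"
  have St_card: "card U * card (St x) = card H" if "x \<in> U" for x
    using card_orbit_stabilizer[OF act that] orb[OF that] unfolding St_def by simp
  hence s: "card (St x) = s" if "x \<in> U" for x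
    using that a U1 unfolding s_def by (metis mult_cancel1 not_less_zero)
  have one: "\<one>\<^bsub>G\<^esub> \<in> St x" if "x \<in> U" for x using that A(4) by (auto simp: St_def)
  have finSt: "finite (St x)" for x using fin by (auto simp: St_def)
  have "H = insert \<one>\<^bsub>G\<^esub> (Fp \<union> (\<Union>x\<in>U. St x - {\<one>\<^bsub>G\<^esub>}))"
    by (auto simp: Fp_def St_def)
  moreover have "\<one>\<^bsub>G\<^esub> \<notin> Fp \<union> (\<Union>x\<in>U. St x - {\<one>\<^bsub>G\<^esub>})" using a A(4) by (auto simp: Fp_def)
  moreover have "finite (Fp \<union> (\<Union>x\<in>U. St x - {\<one>\<^bsub>G\<^esub>}))" using fin finSt by (auto simp: Fp_def)
  ultimately have "card H = Suc (card (Fp \<union> (\<Union>x\<in>U. St x - {\<one>\<^bsub>G\<^esub>})))"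
    by (metis card_insert_disjoint)
  also have "card (Fp \<union> (\<Union>x\<in>U. St x - {\<one>\<^bsub>G\<^esub>})) = card Fp + card (\<Union>x\<in>U. St x - {\<one>\<^bsub>G\<^esub>})"
    using fin finSt by (intro card_Un_disjoint) (auto simp: Fp_def St_def)
  also have "card (\<Union>x\<in>U. St x - {\<one>\<^bsub>G\<^esub>}) = (\<Sum>x\<in>U. card (St x - {\<one>\<^bsub>G\<^esub>}))"
    using fin finSt unique by (intro card_UN_disjoint) (auto simp: St_def)
  also have "\<dots> = (\<Sum>x\<in>U. s - 1)" using one s finSt by (intro sum.cong) auto
  finally have "card H = Suc (card Fp + card U * (s - 1))" by simp
  moreover have "card H = card U * s" using St_card[OF a] s[OF a] by simp
  moreover have "s > 0" using one[OF a] finSt unfolding s_def by (metis card_gt_0_iff empty_iff)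
  ultimately have Fp_card: "card Fp = card U - 1" by (cases s) auto
  obtain g where g: "\<And>x. x \<in> U \<Longrightarrow> g x \<in> H" "\<And>x. x \<in> U \<Longrightarrow> act (g x) a = x"
    using trans by metis
  define c where "c x i = g x \<otimes>\<^bsub>G\<^esub> i \<otimes>\<^bsub>G\<^esub> inv\<^bsub>G\<^esub> (g x)" for x i
  have c: "c x i \<in> H" "act (c x i) x = x" "c x i \<noteq> \<one>\<^bsub>G\<^esub>" "c x i \<otimes>\<^bsub>G\<^esub> c x i = \<one>\<^bsub>G\<^esub>"
    if x: "x \<in> U" and i: "i \<in> {t, u}" for x i
  proof -
    have i': "i \<in> H" "act i a = a" "i \<noteq> \<one>\<^bsub>G\<^esub>" "i \<otimes>\<^bsub>G\<^esub> i = \<one>\<^bsub>G\<^esub>" using i t u by auto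
    note gx = g(1)[OF x]
    show "c x i \<in> H" using i' gx by (simp add: c_def)
    have "act (c x i) x = act (g x) (act i (act (inv\<^bsub>G\<^esub> (g x)) x))"
      using i' gx x A(3,5) by (simp add: c_def)
    thus "act (c x i) x = x" using acts_on_inv(1)[OF act gx a] g(2)[OF x] i' by simp
    show "c x i \<noteq> \<one>\<^bsub>G\<^esub>"
    proof
      assume "c x i = \<one>\<^bsub>G\<^esub>"
      hence "g x \<otimes>\<^bsub>G\<^esub> i = g x" unfolding c_def using gx i'
        by (metis H.mem_carrier inv_equality inv_inv m_closed inv_closed)
      thus False using i' gx by simp
    qed
    have "inv\<^bsub>G\<^esub> (g x) \<otimes>\<^bsub>G\<^esub> (g x \<otimes>\<^bsub>G\<^esub> y) = y" "i \<otimes>\<^bsub>G\<^esub> (i \<otimes>\<^bsub>G\<^esub> y) = y" if "y \<in> carrier G" for y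
      using gx i' that by (simp_all add: m_assoc[symmetric])
    thus "c x i \<otimes>\<^bsub>G\<^esub> c x i = \<one>\<^bsub>G\<^esub>" unfolding c_def using gx i' by (simp add: m_assoc)
  qed
  define f where "f = (\<lambda>(x, i). t \<otimes>\<^bsub>G\<^esub> c x i)"
  have "f ` ((U - {a}) \<times> {t, u}) \<subseteq> Fp"
  proof (rule image_subsetI)
    fix z assume "z \<in> (U - {a}) \<times> {t, u}"
    then obtain x i where z: "z = (x, i)" and x: "x \<in> U" "x \<noteq> a" and i: "i \<in> {t, u}" by auto
    let ?v = "c x i"
    note v = c[OF x(1) i]
    have tv: "t \<otimes>\<^bsub>G\<^esub> ?v \<noteq> \<one>\<^bsub>G\<^esub>"
    proof
      assume "t \<otimes>\<^bsub>G\<^esub> ?v = \<one>\<^bsub>G\<^esub>"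
      hence "t \<otimes>\<^bsub>G\<^esub> ?v = t \<otimes>\<^bsub>G\<^esub> t" using t by simp
      hence "?v = t" using t(1) v(1) by simp
      thus False using unique[OF t(1,3) x(1) a] v(2) t(2) x(2) by simp
    qed
    have "act (t \<otimes>\<^bsub>G\<^esub> ?v) y \<noteq> y" if y: "y \<in> U" for y
    proof
      assume e: "act (t \<otimes>\<^bsub>G\<^esub> ?v) y = y"
      have tt: "act t (act t z) = z" if "z \<in> U" for z using A(5)[OF t(1) t(1) that] A(4)[OF that] t by simp
      have vv: "act ?v (act ?v z) = z" if "z \<in> U" for z using A(5)[OF v(1) v(1) that] A(4)[OF that] v by simp
      have ty: "act t y \<in> U" using A(3) t y by simp
      have "act t (act ?v y) = y" using e A(5) t v y by simp
      hence vy: "act ?v y = act t y" using tt[of "act ?v y"] A(3) v y by simp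
      have "act (t \<otimes>\<^bsub>G\<^esub> ?v) (act t y) = act t y"
        using A(5)[OF t(1) v(1) ty] vv[OF y] vy by simp
      hence "act t y = y" using unique[OF _ tv ty y] e t v by simp
      hence "y = a" using unique[OF t(1,3) y a] t by simp
      hence "act ?v a = a" using vy t by simp
      thus False using unique[OF v(1,3) x(1) a] v x by simp
    qed
    thus "f z \<in> Fp" unfolding z using t v by (auto simp: f_def Fp_def)
  qed
  moreover have "inj_on f ((U - {a}) \<times> {t, u})"
  proof (rule inj_onI)
    fix z z' assume z: "z \<in> (U - {a}) \<times> {t, u}" "z' \<in> (U - {a}) \<times> {t, u}" "f z = f z'"
    obtain x i y j where zz: "z = (x, i)" "z' = (y, j)" by fastforce
    have x: "x \<in> U" "y \<in> U" and i: "i \<in> {t, u}" "j \<in> {t, u}" and e: "f (x, i) = f (y, j)"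
      using z zz by auto
    have "c x i = c y j" using e t c[OF x(1) i(1)] c[OF x(2) i(2)] by (simp add: f_def)
    moreover have xy: "x = y" using unique[of "c x i" x y] c[OF x(1) i(1)] c[OF x(2) i(2)] calculation x by simp
    moreover have "i \<in> H" "j \<in> H" using i t u by auto
    ultimately have "i = j" using g(1)[OF x(1)] unfolding c_def by simp
    thus "z = z'" using xy zz by auto
  qed
  ultimately have "card ((U - {a}) \<times> {t, u}) \<le> card Fp"
    using fin by (metis (no_types, lifting) Fp_def card_image card_mono finite_Collect_conjI finite_subset mem_Collect_eq subsetI)
  thus False using Fp_card fin a U1 tu by (simp add: card_cartesian_product)
qed

section \<open>Generating a subgroup from Sylow subgroups\<close>

lemma subgroup_eq_if_multiplicities:
  assumes "group G" "finite (carrier G)" "subgroup H G" "subgroup K G" "K \<subseteq> H"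
    and dvd: "\<And>p. prime p \<Longrightarrow> p dvd card H \<Longrightarrow> p ^ multiplicity p (card H) dvd card K"
  shows "K = H"
proof -
  have fin: "finite H" using assms(2,3) by (meson finite_subset subgroup.subset)
  have pos: "card H > 0" "card K > 0"
    using assms fin by (meson finite_subset subgroup.finite_imp_card_positive)+
  have "card H dvd card K"
  proof (rule multiplicity_le_imp_dvd)
    fix p :: nat assume p: "prime p"
    show "multiplicity p (card H) \<le> multiplicity p (card K)"
    proof (cases "p dvd card H")
      case True
      thus ?thesis using dvd[OF p True] p pos by (intro multiplicity_geI) auto
    qed (simp add: not_dvd_imp_multiplicity_0)
  qed (use pos in auto)
  hence "card H \<le> card K" using pos by (intro dvd_imp_le) auto
  thus ?thesis using assms(5) fin by (intro card_seteq)
qed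

lemma card_dvd_of_subgroup_le:
  assumes "group G" "subgroup H G" "subgroup K G" "K \<subseteq> H"
  shows "card K dvd card H"
proof -
  interpret group G by fact
  have "subgroup K (G\<lparr>carrier := H\<rparr>)" by (rule subgroup_incl[OF assms(3,2,4)])
  moreover have "group (G\<lparr>carrier := H\<rparr>)" using assms(2) by (rule subgroup_imp_group)
  ultimately have "card (rcosets\<^bsub>G\<lparr>carrier := H\<rparr>\<^esub> K) * card K = Coset.order (G\<lparr>carrier := H\<rparr>)"
    by (intro group.lagrange)
  hence "card H = card (rcosets\<^bsub>G\<lparr>carrier := H\<rparr>\<^esub> K) * card K" by (simp add: Coset.order_def)
  thus ?thesis by (rule dvdI[OF trans[OF _ mult.commute]])
qed

lemma ord_dvd_card_subgroup:
  assumes "group G" "subgroup R G" "x \<in> R"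
  shows "group.ord G x dvd card R"
proof -
  interpret group G by fact
  have xG: "x \<in> carrier G" using assms(2,3) by (rule subgroup.mem_carrier)
  have "generate G {x} \<subseteq> R" using assms by (intro generate_subgroup_incl) auto
  moreover have "subgroup (generate G {x}) G" using xG by (intro generate_is_subgroup) auto
  ultimately show ?thesis using card_dvd_of_subgroup_le[OF assms(1,2)] generate_pow_card[OF xG] by simp
qed

lemma exists_sylow_subgroup_of_subgroup:
  assumes "group G" "finite (carrier G)" "subgroup H G" "prime p"
  obtains R where "subgroup R G" "R \<subseteq> H" "card R = p ^ multiplicity p (card H)"
proof -
  interpret group G by fact
  let ?a = "multiplicity p (card H)" and ?H = "G\<lparr>carrier := H\<rparr>"
  have "finite H" using assms(2,3) by (meson finite_subset subgroup.subset)
  moreover have "Coset.order ?H = p ^ ?a * (card H div p ^ ?a)"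
    by (simp add: Coset.order_def multiplicity_dvd)
  ultimately obtain R where R: "subgroup R ?H" "card R = p ^ ?a"
    using sylow_thm[OF assms(4) subgroup_imp_group[OF assms(3)]] by auto
  thus thesis using that[OF incl_subgroup[OF assms(3) R(1)]] subgroup.subset[OF R(1)] by simp
qed

text \<open>
  One element for each odd prime divisor of \<open>card H\<close>, of order divisible by the full power of that
  prime, generates \<open>H\<close> together with a Sylow 2-subgroup, by comparison of orders.
\<close>

lemma exists_short_generating_list:
  assumes G: "group G" "finite (carrier G)" and H: "subgroup H G" and Q: "subgroup Q G" "Q \<subseteq> H"
    and Q2: "card Q = 2 ^ multiplicity 2 (card H)"
    and cyc: "\<And>p. prime p \<Longrightarrow> p dvd card H \<Longrightarrow> p \<noteq> 2 \<Longrightarrow> \<exists>x\<in>H. p ^ multiplicity p (card H) dvd group.ord G x"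
    and w: "card (prime_factors (card (carrier G))) \<le> w"
  shows "\<exists>xs. set xs \<subseteq> carrier G \<and> length xs = w \<and> generate G (Q \<union> set xs) = H"
proof -
  interpret group G by fact
  let ?Ps = "prime_factors (card H) - {2}"
  have sub: "H \<subseteq> carrier G" using H by (rule subgroup.subset)
  have pos: "card H > 0" "card (carrier G) > 0"
    using H G sub by (meson finite_subset subgroup.finite_imp_card_positive subgroup_self)+
  have "card H dvd card (carrier G)"
    by (rule card_dvd_of_subgroup_le[OF G(1) subgroup_self H sub])
  hence "prime_factors (card H) \<subseteq> prime_factors (card (carrier G))"
    using pos by (intro dvd_prime_factors) auto
  hence "card ?Ps \<le> card (prime_factors (card (carrier G)))" by (intro card_mono) auto
  hence "card ?Ps \<le> w" using w by (rule order_trans)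
  obtain x where x: "\<And>p. p \<in> ?Ps \<Longrightarrow> x p \<in> H \<and> p ^ multiplicity p (card H) dvd ord (x p)"
    using cyc by (metis DiffE in_prime_factors_iff singletonI)
  obtain ps where ps: "set ps = ?Ps" "length ps = card ?Ps"
    using finite_distinct_list[of ?Ps] distinct_card by fastforce
  \<comment> \<open>padded with units to the length \<open>w\<close>\<close>
  define xs where "xs = map x ps @ replicate (w - card ?Ps) \<one>\<^bsub>G\<^esub>"
  have xs: "set xs \<subseteq> H" "length xs = w"
    using x ps \<open>card ?Ps \<le> w\<close> subgroup.one_closed[OF H] by (auto simp: xs_def)
  have QH: "Q \<union> set xs \<subseteq> H" using Q xs by auto
  let ?K = "generate G (Q \<union> set xs)"
  have K: "subgroup ?K G" using QH sub by (intro generate_is_subgroup) auto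
  have KH: "?K \<subseteq> H" by (rule generate_subgroup_incl[OF QH H])
  have "?K = H"
  proof (rule subgroup_eq_if_multiplicities[OF G H K KH])
    fix p assume p: "prime p" "p dvd card H"
    show "p ^ multiplicity p (card H) dvd card ?K"
    proof (cases "p = 2")
      case True
      have "Q \<subseteq> ?K" by (auto intro: generate.incl)
      thus ?thesis using card_dvd_of_subgroup_le[OF G(1) K Q(1)] Q2 True by simp
    next
      case False
      hence pP: "p \<in> ?Ps" using p pos by (auto simp: prime_factors_dvd)
      hence xp: "x p \<in> ?K" using ps by (auto simp: xs_def intro: generate.incl)
      have "ord (x p) dvd card ?K" by (rule ord_dvd_card_subgroup[OF G(1) K xp])
      thus ?thesis using x[OF pP] dvd_trans by blast
    qed
  qed
  thus ?thesis using xs sub by blast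
qed

lemma card_generated_le:
  assumes fin: "finite (carrier G)" "finite \<Q>"
    and gen: "\<And>H. H \<in> \<H> \<Longrightarrow> \<exists>Q\<in>\<Q>. \<exists>xs. set xs \<subseteq> carrier G \<and> length xs = w \<and> generate G (Q \<union> set xs) = H"
  shows "card \<H> \<le> card \<Q> * card (carrier G) ^ w"
proof -
  let ?L = "{xs. set xs \<subseteq> carrier G \<and> length xs = w}"
  have finL: "finite ?L" by (rule finite_lists_length_eq[OF fin(1)])
  have "\<H> \<subseteq> (\<lambda>(Q, xs). generate G (Q \<union> set xs)) ` (\<Q> \<times> ?L)"
  proof
    fix H assume "H \<in> \<H>"
    from gen[OF this] obtain Q xs where "Q \<in> \<Q>" "xs \<in> ?L" "H = generate G (Q \<union> set xs)" by auto
    thus "H \<in> (\<lambda>(Q, xs). generate G (Q \<union> set xs)) ` (\<Q> \<times> ?L)" by force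
  qed
  hence "card \<H> \<le> card (\<Q> \<times> ?L)" using fin finL by (intro surj_card_le) auto
  thus ?thesis by (simp add: card_cartesian_product card_lists_length_eq[OF fin(1)])
qed

section \<open>Eigenvectors with distinct eigenvalues\<close>

definition linear_op :: "('a::field ^ 'n \<Rightarrow> 'a ^ 'n) \<Rightarrow> bool" where
  "linear_op T \<longleftrightarrow> (\<forall>x y. T (x + y) = T x + T y) \<and> (\<forall>c x. T (c *s x) = c *s T x)"

lemma linear_opD:
  assumes "linear_op T"
  shows "T (x + y) = T x + T y" "T (c *s x) = c *s T x" "T 0 = 0" "T (x - y) = T x - T y"
    "T (- x) = - T x" "T (sum f I) = (\<Sum>i\<in>I. T (f i))"
proof -
  show add: "T (x + y) = T x + T y" and scale: "T (c *s x) = c *s T x" for x y c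
    using assms by (auto simp: linear_op_def)
  show zero: "T 0 = 0" using scale[of 0 0] by simp
  show neg: "T (- x) = - T x" for x using scale[of "-1" x] by simp
  show "T (x - y) = T x - T y" using add[of x "- y"] neg by simp
  show "T (sum f I) = (\<Sum>i\<in>I. T (f i))"
    by (induction I rule: infinite_finite_induct) (auto simp: add zero)
qed

text \<open>
  Applying \<open>T - \<mu> j\<close> removes one summand and multiplies the others by nonzero scalars.
\<close>

lemma eigenvectors_sum_zero:
  fixes w :: "'i \<Rightarrow> 'a::field ^ 'n"
  assumes T: "linear_op T"
  shows "finite I \<Longrightarrow> inj_on \<mu> I \<Longrightarrow> (\<And>i. i \<in> I \<Longrightarrow> T (w i) = \<mu> i *s w i) \<Longrightarrow> (\<Sum>i\<in>I. w i) = 0 \<Longrightarrow>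
    \<forall>i\<in>I. w i = 0"
proof (induction I arbitrary: w rule: finite_induct)
  case (insert j I)
  have "(\<Sum>i\<in>I. (\<mu> i - \<mu> j) *s w i) = (\<Sum>i\<in>insert j I. (\<mu> i - \<mu> j) *s w i)"
    using insert by simp
  also have "\<dots> = (\<Sum>i\<in>insert j I. T (w i)) - \<mu> j *s (\<Sum>i\<in>insert j I. w i)"
    unfolding vec.scale_sum_right sum_subtractf[symmetric]
    by (intro sum.cong) (auto simp: insert.prems(2) vec.scale_left_diff_distrib)
  also have "\<dots> = 0" using insert.prems(3) linear_opD(6)[OF T, of w "insert j I"] linear_opD(3)[OF T] by simp
  finally have "\<forall>i\<in>I. (\<mu> i - \<mu> j) *s w i = 0"
    using insert.prems by (intro insert.IH) (auto simp: inj_on_def linear_opD(2)[OF T] vec.scale_left_commute mult.commute)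
  hence I: "\<forall>i\<in>I. w i = 0"
    using insert.prems(1) insert.hyps(2) by (auto simp: inj_on_def)
  hence "w j = 0" using insert.prems(3) insert.hyps by simp
  with I show ?case by simp
qed simp

lemma eigenvectors_independent:
  fixes w :: "'i \<Rightarrow> 'a::field ^ 'n"
  assumes T: "linear_op T" and I: "finite I" "inj_on \<mu> I"
    and w: "\<And>i. i \<in> I \<Longrightarrow> T (w i) = \<mu> i *s w i" "\<And>i. i \<in> I \<Longrightarrow> w i \<noteq> 0"
  shows "inj_on w I" "vec.independent (w ` I)"
proof -
  show inj: "inj_on w I"
  proof (rule inj_onI)
    fix i j assume ij: "i \<in> I" "j \<in> I" "w i = w j"
    hence "\<mu> i *s w i = \<mu> j *s w i" using w(1) by metis
    hence "\<mu> i = \<mu> j" using w(2)[OF ij(1)] by (simp add: vec.scale_cancel_right)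
    thus "i = j" using I(2) ij by (auto simp: inj_on_def)
  qed
  show "vec.independent (w ` I)"
    unfolding vec.dependent_finite[OF finite_imageI[OF I(1)]]
  proof clarify
    fix u j assume j: "j \<in> I" "u (w j) \<noteq> 0" and s: "(\<Sum>v\<in>w ` I. u v *s v) = 0"
    have "(\<Sum>i\<in>I. u (w i) *s w i) = 0" using s by (simp add: sum.reindex[OF inj])
    hence "\<forall>i\<in>I. u (w i) *s w i = 0"
      using w by (intro eigenvectors_sum_zero[OF T I]) (auto simp: linear_opD(2)[OF T] mult.commute)
    thus False using j w(2) by auto
  qed
qed

lemma card_eigenvalues_le:
  fixes w :: "'i \<Rightarrow> 'a::field ^ 'n"
  assumes "linear_op T" "finite I" "inj_on \<mu> I"
    "\<And>i. i \<in> I \<Longrightarrow> T (w i) = \<mu> i *s w i" "\<And>i. i \<in> I \<Longrightarrow> w i \<noteq> 0"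
  shows "card I \<le> CARD('n)"
proof -
  note * = eigenvectors_independent[OF assms]
  have "card I = card (w ` I)" using *(1) by (simp add: card_image)
  also have "\<dots> \<le> vec.dim (UNIV :: ('a ^ 'n) set)" by (intro vec.independent_card_le_dim *) auto
  finally show ?thesis by (simp add: card_cart_basis)
qed

text \<open>
  The eigenvectors \<open>w i\<close> form a basis; by \<open>eigenvectors_sum_zero\<close> the components of \<open>u\<close> along
  the others vanish.
\<close>

lemma simple_eigenspace:
  fixes w :: "'i \<Rightarrow> 'a::field ^ 'n"
  assumes T: "linear_op T" and I: "finite I" "inj_on \<mu> I"
    and w: "\<And>i. i \<in> I \<Longrightarrow> T (w i) = \<mu> i *s w i" "\<And>i. i \<in> I \<Longrightarrow> w i \<noteq> 0"
    and card: "card I = CARD('n)" and j: "j \<in> I" and u: "T u = \<mu> j *s u"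
  shows "\<exists>c. u = c *s w j"
proof -
  note * = eigenvectors_independent[OF T I w]
  have "card (w ` I) = CARD('n)" using *(1) card by (simp add: card_image)
  hence "UNIV \<subseteq> vec.span (w ` I)" using *(2)
    by (intro vec.card_ge_dim_independent) (auto simp: card_cart_basis)
  hence "u \<in> vec.span (w ` I)" by auto
  then obtain c where c: "u = (\<Sum>v\<in>w ` I. c v *s v)"
    using I(1) by (auto simp: vec.span_finite)
  hence u': "u = (\<Sum>i\<in>I. c (w i) *s w i)" by (simp add: sum.reindex[OF *(1)])
  define z where "z i = c (w i) *s w i - (if i = j then u else 0)" for i
  have "(\<Sum>i\<in>I. z i) = 0" using u' I(1) j by (simp add: z_def sum_subtractf)
  moreover have "T (z i) = \<mu> i *s z i" if "i \<in> I" for i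
    using w(1)[OF that] u by (auto simp: z_def linear_opD[OF T] vec.scale_right_diff_distrib mult.commute)
  ultimately have "z j = 0" using eigenvectors_sum_zero[OF T I, of z] j by blast
  thus ?thesis by (auto simp: z_def)
qed

text \<open>
  The value \<open>p(T) w\<close> in Horner form.
\<close>

definition poly_op :: "('a::field ^ 'n \<Rightarrow> 'a ^ 'n) \<Rightarrow> 'a poly \<Rightarrow> 'a ^ 'n \<Rightarrow> 'a ^ 'n" where
  "poly_op T p w = fold_coeffs (\<lambda>c u. c *s w + T u) p 0"

lemma poly_op_pCons: "linear_op T \<Longrightarrow> poly_op T (pCons c p) w = c *s w + T (poly_op T p w)"
  by (cases "c = 0 \<and> p = 0") (auto simp: poly_op_def linear_opD)

lemma poly_op_0 [simp]: "poly_op T 0 w = 0"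
  by (simp add: poly_op_def)

lemma poly_op_add: "linear_op T \<Longrightarrow> poly_op T (p + q) w = poly_op T p w + poly_op T q w"
  by (induction p q rule: poly_induct2) (auto simp: poly_op_pCons linear_opD vec.scale_left_distrib)

lemma poly_op_smult: "linear_op T \<Longrightarrow> poly_op T (smult a p) w = a *s poly_op T p w"
  by (induction p) (auto simp: poly_op_pCons linear_opD vec.scale_right_distrib)

lemma poly_op_mult: "linear_op T \<Longrightarrow> poly_op T (p * q) w = poly_op T p (poly_op T q w)"
  by (induction p) (auto simp: poly_op_pCons poly_op_add poly_op_smult)

lemma poly_op_monom: "linear_op T \<Longrightarrow> poly_op T (monom 1 n) w = (T ^^ n) w"
  by (induction n) (auto simp: poly_op_pCons monom_0 monom_Suc linear_opD)

text \<open>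
  Apply the linear factors of \<open>p\<close> to \<open>w\<close> one after the other. The last nonzero vector that
  occurs is an eigenvector.
\<close>

lemma eigenvector_of_poly_op_zero:
  fixes T :: "'a::alg_closed_field ^ 'n \<Rightarrow> 'a ^ 'n"
  assumes T: "linear_op T" and p: "p \<noteq> 0" and w: "w \<noteq> 0" "poly_op T p w = 0"
  shows "\<exists>a v. poly p a = 0 \<and> v \<noteq> 0 \<and> T v = a *s v"
proof -
  obtain A where A: "size A = degree p" "p = smult (lead_coeff p) (\<Prod>x\<in>#A. [:-x, 1:])"
    using alg_closed_imp_factorization[OF p] by blast
  obtain as where as: "A = mset as" using ex_mset by metis
  have p_eq: "p = smult (lead_coeff p) (\<Prod>x\<leftarrow>as. [:-x, 1:])"
    using A(2) as by (metis mset_map prod_mset_prod_list)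
  have lc: "lead_coeff p \<noteq> 0" using p by simp
  have root: "poly p a = 0" if "a \<in> set as" for a
  proof -
    have "poly (\<Prod>x\<leftarrow>as. [:-x, 1:]) a = 0" using that by (induction as) auto
    thus ?thesis by (subst p_eq) simp
  qed
  have "poly_op T (\<Prod>x\<leftarrow>as. [:-x, 1:]) w = 0 \<Longrightarrow> \<exists>a\<in>set as. \<exists>v. v \<noteq> 0 \<and> T v = a *s v" for as
  proof (induction as)
    case Nil
    thus ?case using w(1) by (simp add: one_pCons poly_op_pCons[OF T] linear_opD[OF T])
  next
    case (Cons a as)
    let ?u = "poly_op T (\<Prod>x\<leftarrow>as. [:-x, 1:]) w"
    show ?case
    proof (cases "?u = 0")
      case True thus ?thesis using Cons.IH by auto
    next
      case False
      have "poly_op T ([:-a, 1:] * (\<Prod>x\<leftarrow>as. [:-x, 1:])) w = 0" using Cons.prems by simp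
      hence "T ?u = a *s ?u" unfolding poly_op_mult[OF T] by (simp add: poly_op_pCons[OF T] linear_opD[OF T])
      thus ?thesis using False by auto
    qed
  qed
  moreover have "poly_op T (\<Prod>x\<leftarrow>as. [:-x, 1:]) w = 0"
    using w(2) lc by (subst (asm) p_eq) (simp add: poly_op_smult[OF T])
  ultimately show ?thesis using root by blast
qed

text \<open>
  For odd \<open>N\<close> the number \<open>1\<close> is a simple root of \<open>x^N - 1 = (x - 1) g\<close> in characteristic 2. Thus
  \<open>g(1) \<noteq> 0\<close>, while \<open>g(T)\<close> annihilates every vector \<open>T v - v\<close>.
\<close>

lemma eigenvalue_ne_1:
  fixes T :: "bit alg_closure ^ 'n \<Rightarrow> bit alg_closure ^ 'n"
  assumes T: "linear_op T" and N: "odd N" "T ^^ N = id" and ne: "T \<noteq> id"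
  shows "\<exists>a v. a \<noteq> 1 \<and> v \<noteq> 0 \<and> T v = a *s v"
proof -
  obtain v where v: "T v \<noteq> v" using ne by (auto simp: fun_eq_iff)
  define p :: "bit alg_closure poly" where "p = monom 1 N - 1"
  have "poly p 1 = 0" by (simp add: p_def poly_monom)
  then obtain g where g: "p = [:-1, 1:] * g" unfolding poly_eq_0_iff_dvd by (auto elim: dvdE)
  have "poly (pderiv p) 1 = poly g 1"
    unfolding g pderiv_mult by (simp add: pderiv_pCons)
  moreover have "poly (pderiv p) 1 = of_nat N" by (simp add: p_def pderiv_diff pderiv_monom poly_monom)
  moreover have "of_nat N = (1 :: bit alg_closure)"
    using N(1) by (auto elim!: oddE simp: two_eq_0_ac)
  ultimately have g1: "poly g 1 = 1" by simp
  let ?w = "poly_op T [:-1, 1:] v"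
  have "?w = T v - v" by (simp add: poly_op_pCons[OF T] linear_opD[OF T])
  hence w: "?w \<noteq> 0" using v by simp
  have "poly_op T g ?w = poly_op T p v" unfolding g poly_op_mult[OF T, symmetric] by (simp add: mult.commute)
  also have "\<dots> = (T ^^ N) v - v"
    using poly_op_add[OF T, of p "1" v] by (simp add: p_def one_pCons poly_op_pCons[OF T] linear_opD[OF T] poly_op_monom[OF T])
  also have "\<dots> = 0" using N(2) by simp
  finally have "\<exists>a v. poly g a = 0 \<and> v \<noteq> 0 \<and> T v = a *s v"
    using g1 w by (intro eigenvector_of_poly_op_zero[OF T]) auto
  then show ?thesis using g1 by (metis zero_neq_one)
qed

section \<open>Operators commuting with a Frobenius map\<close>

lemma power2_inj_ac: "x ^ 2 ^ k = y ^ 2 ^ k \<Longrightarrow> x = (y :: bit alg_closure)"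
proof -
  assume "x ^ 2 ^ k = y ^ 2 ^ k"
  hence "(x + y) ^ 2 ^ k = 0" by (simp add: add_power_2_ac add_self_ac)
  hence "x + y = 0" by simp
  thus "x = y" by (metis eq_neg_iff_add_eq_0 uminus_ac)
qed

definition frob :: "nat \<Rightarrow> bit alg_closure ^ 'n \<Rightarrow> bit alg_closure ^ 'n" where
  "frob q v = (\<chi> i. vec_nth v i ^ q)"

lemma frob_scale: "frob q (c *s v) = c ^ q *s frob q v"
  by (simp add: frob_def vec_eq_iff power_mult_distrib)

lemma frob_eq_0: "q > 0 \<Longrightarrow> frob q v = 0 \<longleftrightarrow> v = 0"
  by (simp add: frob_def vec_eq_iff)

text \<open>
  An eigenvalue \<open>l\<close> satisfies \<open>l^(q^2 + 1) = 1\<close>, so that \<open>l^(q^2)\<close> is the inverse of \<open>l\<close>. Since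
  \<open>T\<close> commutes with the Frobenius map, \<open>l^q\<close>, \<open>l^(q^2)\<close> and \<open>l^(q^3)\<close> are eigenvalues as well. Any
  coincidence among the four would make \<open>l\<close> its own inverse, which in characteristic 2 means \<open>l = 1\<close>.
\<close>

lemma four_eigenvalues:
  fixes T :: "bit alg_closure ^ 4 \<Rightarrow> bit alg_closure ^ 4"
  assumes T: "linear_op T" and q: "q = 2 ^ k" "k > 0" and N: "T ^^ (q\<^sup>2 + 1) = id" and ne: "T \<noteq> id"
    and comm: "\<And>v. T (frob q v) = frob q (T v)"
  obtains l v where "v \<noteq> 0" "inj_on (\<lambda>i. l ^ q ^ i) {..<4}" "\<forall>i<4. l ^ q ^ i \<noteq> 1"
    "\<forall>i. T ((frob q ^^ i) v) = l ^ q ^ i *s (frob q ^^ i) v" "\<forall>i. (frob q ^^ i) v \<noteq> 0"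
proof -
  have q0: "q > 0" and ev: "even q" using q by auto
  have inj: "x = y" if "x ^ q ^ i = y ^ q ^ i" for x y :: "bit alg_closure" and i
  proof -
    have "q ^ i = 2 ^ (k * i)" using q(1) by (simp add: power_mult)
    thus ?thesis using that power2_inj_ac by metis
  qed
  obtain l v where l: "l \<noteq> 1" "v \<noteq> 0" "T v = l *s v"
    using eigenvalue_ne_1[OF T _ N ne] ev by auto
  have "(T ^^ n) v = l ^ n *s v" for n
    by (induction n) (auto simp: l linear_opD[OF T] mult.commute)
  hence "l ^ (q\<^sup>2 + 1) *s v = v" using N by (metis id_apply)
  hence "(l ^ (q\<^sup>2 + 1) - 1) *s v = 0" by (simp add: vec.scale_left_diff_distrib)
  hence lN: "l ^ q ^ 2 * l = 1" using l(2) by (simp add: mult.commute)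
  have l0: "l \<noteq> 0" using lN by auto
  have eig: "T ((frob q ^^ i) v) = l ^ q ^ i *s (frob q ^^ i) v" for i
    by (induction i) (auto simp: l comm frob_scale simp flip: power_mult, simp add: mult.commute)
  have nz: "(frob q ^^ i) v \<noteq> 0" for i by (induction i) (auto simp: l frob_eq_0[OF q0])
  have sq: "l ^ q ^ 2 \<noteq> l"
  proof
    assume "l ^ q ^ 2 = l"
    hence "l ^ 2 ^ 1 = 1 ^ 2 ^ 1" using lN by (simp add: power2_eq_square)
    from power2_inj_ac[OF this] show False using l by simp
  qed
  have step: "l ^ q ^ Suc i = (l ^ q ^ i) ^ q" for i by (simp flip: power_mult add: mult.commute)
  have d1: "l ^ q ^ 1 \<noteq> l"
  proof
    assume *: "l ^ q ^ 1 = l"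
    hence "l ^ q ^ 2 = l" using step[of 1] by (simp add: numeral_2_eq_2)
    thus False using sq by simp
  qed
  have d3: "l ^ q ^ 3 \<noteq> l"
  proof
    assume *: "l ^ q ^ 3 = l"
    have l2: "l ^ q ^ 2 = inverse l" using lN l0 by (simp add: field_simps)
    have "l ^ q ^ 4 = (l ^ q ^ 2) ^ q ^ 2" by (simp flip: power_mult power_add)
    also have "\<dots> = l" unfolding l2 power_inverse using l2 by simp
    finally have "l ^ q ^ 4 = l" .
    moreover have "l ^ q ^ 4 = (l ^ q ^ 3) ^ q" using step[of 3] by (simp add: eval_nat_numeral)
    ultimately show False using * d1 by simp
  qed
  have dist: "l ^ q ^ i \<noteq> l ^ q ^ j" if "i < j" "j < 4" for i j
  proof
    assume *: "l ^ q ^ i = l ^ q ^ j"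
    have "l ^ q ^ j = (l ^ q ^ (j - i)) ^ q ^ i" using that by (simp flip: power_mult power_add)
    hence "l = l ^ q ^ (j - i)" by (rule inj[OF trans[OF *]])
    moreover have "j - i = 1 \<or> j - i = 2 \<or> j - i = 3" using that by auto
    ultimately show False using d1 sq d3 by metis
  qed
  show thesis
  proof (rule that)
    show "inj_on (\<lambda>i. l ^ q ^ i) {..<4}"
      using dist by (intro linorder_inj_onI') auto
    show "\<forall>i<4. l ^ q ^ i \<noteq> 1"
    proof (intro allI impI notI)
      fix i assume "l ^ q ^ i = 1"
      thus False using inj[of l i 1] l by simp
    qed
  qed (use l eig nz in auto)
qed

text \<open>
  Otherwise \<open>1\<close> would be a fifth eigenvalue, besides the four of \<open>four_eigenvalues\<close>.
\<close>

lemma no_eigenvalue_1: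
  fixes T :: "bit alg_closure ^ 4 \<Rightarrow> bit alg_closure ^ 4"
  assumes T: "linear_op T" and q: "q = 2 ^ k" "k > 0" and N: "T ^^ (q\<^sup>2 + 1) = id"
    and comm: "\<And>v. T (frob q v) = frob q (T v)" and u: "T u = u" "u \<noteq> 0"
  shows "T = id"
proof (rule ccontr)
  assume "T \<noteq> id"
  then obtain l v where l: "v \<noteq> 0" "inj_on (\<lambda>i. l ^ q ^ i) {..<4}" "\<forall>i<4. l ^ q ^ i \<noteq> 1"
    "\<forall>i. T ((frob q ^^ i) v) = l ^ q ^ i *s (frob q ^^ i) v" "\<forall>i. (frob q ^^ i) v \<noteq> 0"
    by (rule four_eigenvalues[OF T q N _ comm])
  have "card {..<5::nat} \<le> CARD(4)"
  proof (rule card_eigenvalues_le[OF T, of _ "\<lambda>i. if i = 4 then 1 else l ^ q ^ i" "\<lambda>i. if i = 4 then u else (frob q ^^ i) v"])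
    show "inj_on (\<lambda>i. if i = 4 then 1 else l ^ q ^ i) {..<5}"
    proof (rule inj_onI)
      fix i j :: nat assume ij: "i \<in> {..<5}" "j \<in> {..<5}" "(if i = 4 then 1 else l ^ q ^ i) = (if j = 4 then 1 else l ^ q ^ j)"
      have "i < 4" if "i \<noteq> 4" using that ij by auto
      moreover have "j < 4" if "j \<noteq> 4" using that ij by auto
      ultimately show "i = j" using ij(3) l(3) inj_onD[OF l(2), of i j]
        by (cases "i = 4"; cases "j = 4") auto
    qed
  qed (use l u in auto)
  thus False by simp
qed

text \<open>
  The four eigenspaces of \<open>T\<close> are lines, which every operator commuting with \<open>T\<close> preserves.
\<close>

lemma commuting_eigenvector:
  fixes T :: "bit alg_closure ^ 4 \<Rightarrow> bit alg_closure ^ 4"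
  assumes T: "linear_op T" and q: "q = 2 ^ k" "k > 0" and N: "T ^^ (q\<^sup>2 + 1) = id" and ne: "T \<noteq> id"
    and comm: "\<And>v. T (frob q v) = frob q (T v)"
  obtains v where "v \<noteq> 0" "\<And>S. linear_op S \<Longrightarrow> (\<And>x. S (T x) = T (S x)) \<Longrightarrow> \<exists>c. S v = c *s v"
proof -
  obtain l v where l: "v \<noteq> 0" "inj_on (\<lambda>i. l ^ q ^ i) {..<4}" "\<forall>i<4. l ^ q ^ i \<noteq> 1"
    "\<forall>i. T ((frob q ^^ i) v) = l ^ q ^ i *s (frob q ^^ i) v" "\<forall>i. (frob q ^^ i) v \<noteq> 0"
    by (rule four_eigenvalues[OF T q N ne comm])
  have Tv: "T v = l *s v" using l(4)[rule_format, of 0] by simp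
  have "\<exists>c. S v = c *s (frob q ^^ 0) v" if S: "linear_op S" "\<And>x. S (T x) = T (S x)" for S
  proof (rule simple_eigenspace[OF T _ l(2), where w = "\<lambda>i. (frob q ^^ i) v" and j = 0])
    show "T (S v) = l ^ q ^ 0 *s S v" using S(2)[of v] Tv linear_opD(2)[OF S(1)] by simp
  qed (use l in auto)
  thus thesis using that l(1) by auto
qed

section \<open>Matrices of degree four acting on lines\<close>

text \<open>
  The type \<^typ>\<open>4\<close> consists of 1, 2, 3 and 4 = 0, whereas matrix indices start at 0.
\<close>

definition idx :: "4 \<Rightarrow> nat" where
  "idx i = (if i = 1 then 0 else if i = 2 then 1 else if i = 3 then 2 else 3)"

definition V4 :: "'a \<Rightarrow> 'a \<Rightarrow> 'a \<Rightarrow> 'a \<Rightarrow> 'a ^ 4" where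
  "V4 a b c d = (\<chi> i. if i = 1 then a else if i = 2 then b else if i = 3 then c else d)"

definition mat_vec :: "'a::comm_ring_1 mat \<Rightarrow> 'a ^ 4 \<Rightarrow> 'a ^ 4" where
  "mat_vec g v = (\<chi> i. \<Sum>j\<in>UNIV. g $$ (idx i, idx j) * vec_nth v j)"

lemma idx_simps [simp]: "idx 1 = 0" "idx 2 = 1" "idx 3 = 2" "idx 4 = 3"
  by (simp_all add: idx_def)

lemma V4_nth [simp]: "vec_nth (V4 a b c d) 1 = a" "vec_nth (V4 a b c d) 2 = b"
  "vec_nth (V4 a b c d) 3 = c" "vec_nth (V4 a b c d) 4 = d"
  by (simp_all add: V4_def)

lemma vec4_eq_iff: "v = w \<longleftrightarrow> vec_nth v 1 = vec_nth w 1 \<and> vec_nth v 2 = vec_nth w 2 \<and>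
    vec_nth v 3 = vec_nth w 3 \<and> vec_nth v 4 = vec_nth w 4" for v w :: "'a ^ 4"
  by (simp add: vec_eq_iff forall_4)

lemma V4_eq_iff [simp]: "V4 a b c d = V4 a' b' c' d' \<longleftrightarrow> a = a' \<and> b = b' \<and> c = c' \<and> d = d'"
  by (simp add: vec4_eq_iff)

lemma V4_scale: "c *s V4 x y z w = V4 (c * x) (c * y) (c * z) (c * w)"
  by (simp add: vec4_eq_iff)

lemma mat_vec_nth: "vec_nth (mat_vec g v) i = g $$ (idx i, 0) * vec_nth v 1 + g $$ (idx i, 1) * vec_nth v 2 +
    g $$ (idx i, 2) * vec_nth v 3 + g $$ (idx i, 3) * vec_nth v 4"
  by (simp add: mat_vec_def sum_4)

lemma mat_vec_one: "mat_vec (1\<^sub>m 4) v = v"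
  by (simp add: vec4_eq_iff mat_vec_nth)

lemma mat_vec_mult:
  assumes "g \<in> carrier_mat 4 4" "h \<in> carrier_mat 4 4"
  shows "mat_vec (g * h) v = mat_vec g (mat_vec h v)"
proof -
  have "(g * h) $$ (i, j) = g $$ (i, 0) * h $$ (0, j) + g $$ (i, 1) * h $$ (1, j) +
      g $$ (i, 2) * h $$ (2, j) + g $$ (i, 3) * h $$ (3, j)" if "i < 4" "j < 4" for i j
    using assms that by (simp add: scalar_prod_def numeral_eq_Suc)
  thus ?thesis by (simp add: vec4_eq_iff mat_vec_nth algebra_simps)
qed

lemma linear_op_mat_vec: "linear_op (mat_vec g)"
  by (simp add: linear_op_def vec4_eq_iff mat_vec_nth algebra_simps)

lemma mat_vec_inject:
  fixes g h :: "'a::comm_ring_1 mat"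
  assumes "g \<in> carrier_mat 4 4" "h \<in> carrier_mat 4 4" "\<And>v. mat_vec g v = mat_vec h v"
  shows "g = h"
proof -
  have "\<forall>i<4. \<forall>j<4. g $$ (i, j) = h $$ (i, j)"
    using assms(3)[of "V4 1 0 0 0"] assms(3)[of "V4 0 1 0 0"] assms(3)[of "V4 0 0 1 0"] assms(3)[of "V4 0 0 0 1"]
    unfolding all_less_4 by (simp add: vec4_eq_iff mat_vec_nth)
  thus ?thesis using assms(1,2) by (intro eq_matI) auto
qed

lemma mat_vec_frob:
  assumes q: "q = 2 ^ k" and g: "\<And>i j. i < 4 \<Longrightarrow> j < 4 \<Longrightarrow> g $$ (i, j) \<in> GF q"
  shows "mat_vec g (frob q v) = frob q (mat_vec g v)"
proof -
  have "g $$ (idx i, j) ^ q = g $$ (idx i, j)" if "j < 4" for i j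
    using g[of "idx i" j] that by (simp add: GF_def idx_def)
  thus ?thesis
    by (simp add: vec4_eq_iff mat_vec_nth frob_def add_power_2_ac q power_mult_distrib)
qed

text \<open>
  A point of projective space, as a one-dimensional subspace.
\<close>

definition line :: "'a::field ^ 4 \<Rightarrow> ('a ^ 4) set" where
  "line v = range (\<lambda>c. c *s v)"

lemma mat_vec_line: "mat_vec g ` line v = line (mat_vec g v)"
  by (auto simp: line_def image_image linear_opD(2)[OF linear_op_mat_vec])

lemma line_scale: "c \<noteq> 0 \<Longrightarrow> line (c *s v) = line v"
proof
  assume c: "c \<noteq> 0"
  show "line (c *s v) \<subseteq> line v" by (auto simp: line_def)
  show "line v \<subseteq> line (c *s v)"
  proof
    fix x assume "x \<in> line v"
    then obtain d where "x = d *s v" by (auto simp: line_def)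
    hence "x = (d / c) *s (c *s v)" using c by simp
    thus "x \<in> line (c *s v)" unfolding line_def by blast
  qed
qed

lemma line_eqD:
  assumes "line v = line w" "v \<noteq> 0"
  obtains c where "c \<noteq> 0" "v = c *s w"
proof -
  have "v \<in> line v" unfolding line_def by (metis rangeI vec.scale_one)
  then obtain c where "v = c *s w" using assms by (auto simp: line_def)
  thus thesis using that assms(2) by (cases "c = 0") auto
qed

section \<open>The Suzuki ovoid and the symplectic form\<close>

lemma add_self_left_ac: "x + (x + y) = (y :: bit alg_closure)"
  by (metis add.assoc add.left_neutral add_self_ac)

lemmas char2 = add_self_ac add_self_left_ac

lemma add_eq_0_iff_ac: "x + y = 0 \<longleftrightarrow> x = (y :: bit alg_closure)"
  by (metis add_self_ac add_self_left_ac add.right_neutral)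

text \<open>
  For \<open>n > 0\<close> the three exponents of the ovoid are distinct and smaller than \<open>q\<close>, so that
  coefficients of polynomial functions on the field can be compared.
\<close>

locale suzuki =
  fixes n :: nat
  assumes n_pos: "0 < n"
begin

abbreviation "q \<equiv> suz_q n"
abbreviation "t \<equiv> suz_theta n"
abbreviation "h \<equiv> suz_theta n div 2"
abbreviation "F \<equiv> GF (suz_q n)"
abbreviation "G \<equiv> Sz n"

lemma q_eq: "q = 2 ^ (2 * n + 1)" and q_gt: "2 + t < q" and t_ge: "t \<ge> 4" and q_pos: "q > 0"
proof -
  show "q = 2 ^ (2 * n + 1)" "q > 0" by (simp_all add: suz_q_def)
  obtain m where m: "n = Suc m" using n_pos by (cases n) auto
  show "t \<ge> 4" by (simp add: suz_theta_def m)
  define c :: nat where "c = 2 ^ m"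
  have c: "c \<ge> 1" by (simp add: c_def)
  have t: "t = 4 * c" by (simp add: suz_theta_def m c_def)
  have "2 * n + 1 = m + m + 3" using m by simp
  hence "q = 2 ^ (m + m + 3)" by (simp only: suz_q_def)
  also have "\<dots> = c * c * 2 ^ 3" by (simp only: power_add c_def)
  finally have "q = 8 * (c * c)" by simp
  moreover have "c \<le> c * c" using c by simp
  ultimately show "2 + t < q" using c t by linarith
qed

lemma t_pos [simp]: "0 < t" "t \<noteq> 0" using t_ge by auto

lemma F_power_q: "x \<in> F \<Longrightarrow> x ^ q = x" by (simp add: GF_def)

lemma F_closed [simp, intro]: "0 \<in> F" "1 \<in> F" "x \<in> F \<Longrightarrow> y \<in> F \<Longrightarrow> x + y \<in> F"
  "x \<in> F \<Longrightarrow> y \<in> F \<Longrightarrow> x * y \<in> F" "x \<in> F \<Longrightarrow> inverse x \<in> F" "x \<in> F \<Longrightarrow> x ^ k \<in> F"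
  "x \<in> F \<Longrightarrow> y \<in> F \<Longrightarrow> x / y \<in> F"
  by (auto intro: GF_suz_q_closed GF_1 GF_mult GF_inverse GF_power simp: divide_inverse)

lemma card_F: "card F = q" and fin_F: "finite F"
proof -
  show "card F = q" using card_GF[of "2 * n + 1"] by (simp add: suz_q_def)
  thus "finite F" using q_pos card_ge_0_finite by metis
qed

lemma pow_t_add: "(x + y) ^ t = x ^ t + y ^ t" for x y :: "bit alg_closure"
  by (simp only: suz_theta_def add_power_2_ac)

text \<open>
  Raising to the power \<open>t\<close> is a square root of the Frobenius automorphism of \<open>F\<close>.
\<close>

lemma pow_t_t: "x \<in> F \<Longrightarrow> (x ^ t) ^ t = x ^ 2"
proof -
  assume x: "x \<in> F"
  have "n + 1 + (n + 1) = Suc (2 * n + 1)" by simp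
  hence "t * t = q * 2" unfolding suz_theta_def suz_q_def by (metis power_add power_Suc2)
  hence "(x ^ t) ^ t = (x ^ q) ^ 2" by (simp flip: power_mult)
  thus ?thesis using F_power_q[OF x] by simp
qed

lemma t_h: "t = 2 * h" by (simp add: suz_theta_def)

lemma pow_t_1: "x ^ t = 1 \<Longrightarrow> x = (1 :: bit alg_closure)"
  unfolding suz_theta_def by (rule power2_inj_ac[of _ "n + 1"]) simp

text \<open>
  In affine coordinates the Suzuki ovoid is the surface \<open>z = ov x y\<close>. The vector \<open>pt a b\<close>
  below is the first column of \<open>suz_S n a b\<close>.
\<close>

definition ov :: "bit alg_closure \<Rightarrow> bit alg_closure \<Rightarrow> bit alg_closure" where
  "ov a b = a ^ (2 + t) + a * b + b ^ t"

definition pt where "pt a b = V4 1 a b (ov a b)"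

definition inf_pt :: "bit alg_closure ^ 4" where "inf_pt = V4 0 0 0 1"

definition Ovoid where "Ovoid = insert (line inf_pt) ((\<lambda>(a, b). line (pt a b)) ` (F \<times> F))"

definition act :: "bit alg_closure mat \<Rightarrow> (bit alg_closure ^ 4) set \<Rightarrow> (bit alg_closure ^ 4) set" where
  "act g L = mat_vec g ` L"

lemma act_line: "act g (line v) = line (mat_vec g v)"
  unfolding act_def by (rule mat_vec_line)

lemma ov_closed [simp, intro]: "a \<in> F \<Longrightarrow> b \<in> F \<Longrightarrow> ov a b \<in> F"
  by (auto simp: ov_def)

lemma ov_00 [simp]: "ov 0 0 = 0" using t_ge by (simp add: ov_def)

lemma pt_ne [simp]: "pt a b \<noteq> 0" "inf_pt \<noteq> 0" by (auto simp: pt_def inf_pt_def vec4_eq_iff)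

lemma line_pt_eq: "line (pt a b) = line (pt c d) \<longleftrightarrow> a = c \<and> b = d"
proof
  assume "line (pt a b) = line (pt c d)"
  then obtain k where "pt a b = k *s pt c d" using line_eqD pt_ne by metis
  thus "a = c \<and> b = d" by (auto simp: pt_def V4_scale)
qed auto

lemma line_pt_ne_inf: "line (pt a b) \<noteq> line inf_pt" "line inf_pt \<noteq> line (pt a b)"
proof -
  show "line (pt a b) \<noteq> line inf_pt"
  proof
    assume "line (pt a b) = line inf_pt"
    then obtain k where "pt a b = k *s inf_pt" using line_eqD pt_ne by metis
    thus False by (auto simp: pt_def inf_pt_def V4_scale)
  qed
  thus "line inf_pt \<noteq> line (pt a b)" by metis
qed

lemma inj_pt: "inj_on (\<lambda>(a, b). line (pt a b)) (F \<times> F)"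
  by (auto simp: inj_on_def line_pt_eq)

lemma fin_Ovoid: "finite Ovoid" and card_Ovoid: "card Ovoid = q\<^sup>2 + 1"
proof -
  show "finite Ovoid" using fin_F by (simp add: Ovoid_def)
  have "card ((\<lambda>(a, b). line (pt a b)) ` (F \<times> F)) = q\<^sup>2"
    using card_image[OF inj_pt] by (simp add: card_cartesian_product card_F power2_eq_square)
  moreover have "line inf_pt \<notin> (\<lambda>(a, b). line (pt a b)) ` (F \<times> F)" using line_pt_ne_inf by auto
  ultimately show "card Ovoid = q\<^sup>2 + 1" using fin_F by (simp add: Ovoid_def)
qed

text \<open>
  With \<open>b = a^(1+t) x\<close> the equation becomes \<open>x^t = x + 1\<close>. Raising to the power \<open>t\<close> again yields
  \<open>x^2 = x\<close>, but neither 0 nor 1 is a solution.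
\<close>

lemma ov_eq_0:
  assumes ab: "a \<in> F" "b \<in> F" and z: "ov a b = 0"
  shows "a = 0 \<and> b = 0"
proof (cases "a = 0")
  case True
  thus ?thesis using z t_ge by (simp add: ov_def)
next
  case False
  \<comment> \<open>\<open>a^(1+t)\<close> is the weight that makes \<open>ov\<close> homogeneous, see \<open>ov_scale\<close> below\<close>
  define x where "x = b / a ^ (1 + t)"
  have x: "x \<in> F" using ab by (simp add: x_def del: power_Suc power_add)
  have b: "b = a ^ (1 + t) * x" using False by (simp add: x_def)
  have bt: "b ^ t = a ^ (2 + t) * x ^ t"
    unfolding b by (simp add: power_mult_distrib pow_t_t[OF ab(1)] power_add power2_eq_square mult.commute)
  have "ov a b = a ^ (2 + t) * (1 + x + x ^ t)"
    unfolding ov_def bt by (subst b) (simp add: algebra_simps power_add power2_eq_square)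
  hence *: "1 + x + x ^ t = 0" using z False by simp
  hence xt: "x ^ t = 1 + x" by (simp add: add_eq_0_iff_ac)
  have "x ^ 2 = (1 + x) ^ t" using pow_t_t[OF x] xt by simp
  also have "\<dots> = x" unfolding pow_t_add xt by (simp add: char2 add.assoc[symmetric])
  finally have "x * (x - 1) = 0" by (simp add: algebra_simps power2_eq_square)
  hence "x = 0 \<or> x = 1" by auto
  thus ?thesis using * by (auto simp: char2 zero_power)
qed

lemma mat_vec_S: "mat_vec (suz_S n a b) (V4 x y z w) =
    V4 x (a * x + y) (b * x + a ^ t * y + z) (ov a b * x + (a ^ (1 + t) + b) * y + a * z + w)"
  by (simp add: vec4_eq_iff mat_vec_nth suz_S_def Let_def mat_of_rows_list_4 ov_def)

lemma mat_vec_C: "mat_vec (suz_C n l) (V4 x y z w) =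
    V4 (l ^ (1 + h) * x) (l ^ h * y) (inverse l ^ h * z) (inverse l ^ (1 + h) * w)"
  by (simp add: vec4_eq_iff mat_vec_nth suz_C_def Let_def mat_of_rows_list_4)

lemma mat_vec_T: "mat_vec suz_T (V4 x y z w) = V4 w z y x"
  by (simp add: vec4_eq_iff mat_vec_nth suz_T_def mat_of_rows_list_4)

lemma ov_shift: "c \<in> F \<Longrightarrow> ov (c + a) (d + c ^ t * a + b) =
    ov c d + (c ^ (1 + t) + d) * a + c * b + ov a b"
  unfolding ov_def
  by (simp add: pow_t_add power_mult_distrib pow_t_t power_add power2_eq_square algebra_simps char2)

lemma mat_vec_S_pt: "c \<in> F \<Longrightarrow> mat_vec (suz_S n c d) (pt a b) = pt (c + a) (d + c ^ t * a + b)"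
  by (simp add: pt_def mat_vec_S ov_shift)

lemma mat_vec_S_inf: "mat_vec (suz_S n c d) inf_pt = inf_pt"
  by (simp add: inf_pt_def mat_vec_S)

lemma ov_scale: "l \<in> F \<Longrightarrow> ov (l * a) (l ^ (1 + t) * b) = l ^ (2 + t) * ov a b"
  unfolding ov_def
  by (simp add: power_mult_distrib pow_t_t power_add power2_eq_square algebra_simps)

lemma mat_vec_C_pt:
  assumes "l \<in> F" "l \<noteq> 0"
  shows "mat_vec (suz_C n l) (pt a b) = l ^ (1 + h) *s pt (inverse l * a) (inverse l ^ (1 + t) * b)"
proof -
  have "l ^ h * inverse l ^ h = 1" using assms by (simp flip: power_mult_distrib)
  hence *: "l ^ h * (inverse l ^ h * z) = z" for z by (simp add: mult.assoc[symmetric])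
  have l1: "l * (inverse l * z) = z" for z using assms by (simp add: mult.assoc[symmetric])
  have "inverse l ^ t = inverse l ^ (h + h)" using t_h by (simp only: mult_2)
  hence "l * (l ^ h * (inverse l * inverse l ^ t)) = l * (inverse l * (l ^ h * (inverse l ^ h * inverse l ^ h)))"
    by (simp only: power_add mult_ac)
  hence "l * (l ^ h * (inverse l * inverse l ^ t)) = inverse l ^ h" unfolding l1 * .
  note key = arg_cong[OF this, of "\<lambda>y. y * z" for z]
  have "l ^ (1 + h) * (inverse l * a) = l * (inverse l * (l ^ h * a))"
    by (simp only: power_add power_one_right mult_ac)
  moreover have "l ^ (1 + h) * (inverse l ^ (1 + t) * b) = l * (l ^ h * (inverse l * inverse l ^ t)) * b"
    by (simp only: power_add power_one_right mult_ac)
  moreover have "l ^ (1 + h) * (inverse l ^ (2 + t) * ov a b) = l * (l ^ h * (inverse l * inverse l ^ t)) * (inverse l * ov a b)"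
    by (simp only: power_add power_one_right power2_eq_square mult_ac)
  ultimately show ?thesis unfolding pt_def V4_scale mat_vec_C ov_scale[OF F_closed(5)[OF assms(1)]] key l1
    by (simp only: power_add power_one_right mult_ac mult_1_right)
qed

text \<open>
  Divided by \<open>ov a b ^ (2 + t)\<close>, this says that the point \<open>(ov a b, b, a, 1)\<close>, which is the image of
  \<open>pt a b\<close> under \<open>suz_T\<close>, satisfies the equation of the ovoid.
\<close>

lemma ov_swap:
  assumes "a \<in> F" "b \<in> F"
  shows "b ^ (2 + t) + a * b * ov a b ^ t + a ^ t * ov a b ^ 2 = ov a b ^ (1 + t)"
  using assms
  unfolding ov_def
  by (simp add: power_mult_distrib pow_t_t power_add power2_eq_square algebra_simps char2 pow_t_add)

lemma mat_vec_T_pt: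
  assumes ab: "a \<in> F" "b \<in> F" and nz: "ov a b \<noteq> 0"
  shows "mat_vec suz_T (pt a b) = ov a b *s pt (b / ov a b) (a / ov a b)"
proof -
  define c where "c = ov a b"
  have c: "c \<noteq> 0" using nz by (simp add: c_def)
  have "c ^ (2 + t) * ov (b / c) (a / c) = b ^ (2 + t) + a * b * c ^ t + a ^ t * c ^ 2"
    unfolding ov_def using c by (simp add: power_divide field_simps power_add power2_eq_square)
  also have "\<dots> = c ^ (1 + t)" using ov_swap[OF ab] by (simp add: c_def)
  also have "\<dots> = c ^ (2 + t) * (1 / c)" using c by (simp add: power_add power2_eq_square)
  finally have "ov (b / c) (a / c) = 1 / c" using c by (simp add: field_simps)
  thus ?thesis using c unfolding pt_def mat_vec_T V4_scale c_def[symmetric] by simp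
qed

lemma gens_cases:
  assumes "g \<in> suz_generators n"
  obtains a b where "a \<in> F" "b \<in> F" "g = suz_S n a b" | l where "l \<in> F" "l \<noteq> 0" "g = suz_C n l" | "g = suz_T"
  using assms unfolding suz_generators_def by blast

lemma gens_Ovoid:
  assumes g: "g \<in> suz_generators n" and L: "L \<in> Ovoid"
  shows "act g L \<in> Ovoid"
proof -
  from L consider "L = line inf_pt" | a b where "a \<in> F" "b \<in> F" "L = line (pt a b)"
    unfolding Ovoid_def by auto
  moreover have in_Ovoid: "line (pt a b) \<in> Ovoid" if "a \<in> F" "b \<in> F" for a b
    using that unfolding Ovoid_def by auto
  have inf_Ovoid: "line inf_pt \<in> Ovoid" by (simp add: Ovoid_def)
  note act_line [simp]
  from g show ?thesis
  proof (cases rule: gens_cases)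
    case (1 c d)
    show ?thesis using calculation
    proof cases
      case 1 thus ?thesis using inf_Ovoid by (simp add: \<open>g = suz_S n c d\<close> mat_vec_S_inf)
    next
      case (2 a b) thus ?thesis using in_Ovoid[of "c + a" "d + c ^ t * a + b"] 1 by (simp add: mat_vec_S_pt)
    qed
  next
    case (2 l)
    show ?thesis using calculation
    proof cases
      case 1
      have "mat_vec (suz_C n l) inf_pt = (inverse l ^ (1 + h)) *s inf_pt" by (simp add: inf_pt_def mat_vec_C V4_scale)
      thus ?thesis using inf_Ovoid 1 2 by (simp add: line_scale del: power_Suc)
    next
      case (2 a b) thus ?thesis using in_Ovoid[of "inverse l * a" "inverse l ^ (1 + t) * b"] \<open>l \<in> F\<close> \<open>l \<noteq> 0\<close>
        by (simp add: \<open>g = suz_C n l\<close> mat_vec_C_pt line_scale del: power_Suc power_inverse)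
    qed
  next
    case 3
    show ?thesis using calculation
    proof cases
      case 1
      have "mat_vec suz_T inf_pt = pt 0 0" by (simp add: inf_pt_def pt_def mat_vec_T)
      thus ?thesis using 1 3 in_Ovoid[of 0 0] by simp
    next
      case (2 a b)
      show ?thesis
      proof (cases "ov a b = 0")
        case True
        hence "a = 0" "b = 0" using ov_eq_0[OF 2(1,2) True] by auto
        hence "mat_vec suz_T (pt a b) = inf_pt" by (simp add: inf_pt_def pt_def mat_vec_T)
        thus ?thesis using 2 3 inf_Ovoid by simp
      next
        case False
        thus ?thesis using 2 3 in_Ovoid[of "b / ov a b" "a / ov a b"] by (simp add: mat_vec_T_pt line_scale)
      qed
    qed
  qed
qed

text \<open>
  The alternating form with Gram matrix \<open>suz_T\<close>.
\<close>

definition symp :: "bit alg_closure ^ 4 \<Rightarrow> bit alg_closure ^ 4 \<Rightarrow> bit alg_closure" where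
  "symp u v = vec_nth u 1 * vec_nth v 4 + vec_nth u 2 * vec_nth v 3 + vec_nth u 3 * vec_nth v 2 + vec_nth u 4 * vec_nth v 1"

lemma symp_V4: "symp (V4 a b c d) (V4 x y z w) = a * w + b * z + c * y + d * x"
  by (simp add: symp_def)

lemma V4_cases: obtains x y z w where "v = V4 x y z w"
  using that[of "vec_nth v 1" "vec_nth v 2" "vec_nth v 3" "vec_nth v 4"] by (simp add: vec4_eq_iff)

lemma gens_symp:
  assumes g: "g \<in> suz_generators n"
  shows "symp (mat_vec g u) (mat_vec g v) = symp u v"
proof -
  obtain x y z w where u: "u = V4 x y z w" by (rule V4_cases)
  obtain x' y' z' w' where v: "v = V4 x' y' z' w'" by (rule V4_cases)
  from g show ?thesis
  proof (cases rule: gens_cases)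
    case (1 a b)
    show ?thesis unfolding u v 1 mat_vec_S symp_V4 by (simp add: algebra_simps power_add char2)
  next
    case (2 l)
    have *: "l ^ k * (inverse l ^ k * c) = c" for k c
      using 2 by (simp add: mult.assoc[symmetric] power_mult_distrib[symmetric] del: power_inverse)
    have k: "l ^ k * c * (inverse l ^ k * d) = c * d" "inverse l ^ k * c * (l ^ k * d) = c * d" for k c d
      using *[of k "c * d"] by (simp_all only: mult_ac)
    show ?thesis by (simp only: u v 2 mat_vec_C symp_V4 k)
  next
    case 3
    show ?thesis unfolding u v 3 mat_vec_T symp_V4 by (simp add: algebra_simps)
  qed
qed

section \<open>The Suzuki group acting on the ovoid\<close>

lemma GL4_carrier: "g \<in> carrier (GL4 q) \<Longrightarrow> g \<in> carrier_mat 4 4"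
  "g \<in> carrier (GL4 q) \<Longrightarrow> i < 4 \<Longrightarrow> j < 4 \<Longrightarrow> g $$ (i, j) \<in> F"
proof -
  show "g \<in> carrier (GL4 q) \<Longrightarrow> g \<in> carrier_mat 4 4" by (simp add: carrier_GL4_suz_q)
  thus "g \<in> carrier (GL4 q) \<Longrightarrow> i < 4 \<Longrightarrow> j < 4 \<Longrightarrow> g $$ (i, j) \<in> F"
    by (auto simp: carrier_GL4_suz_q elements_mat_subset_iff)
qed

lemma GL4_simps: "monoid.mult (GL4 q) = (*)" "\<one>\<^bsub>GL4 q\<^esub> = 1\<^sub>m 4"
  by (simp_all add: GL4_def units_of_def mat_monoid_def)

lemma G_simps: "monoid.mult G = (*)" "\<one>\<^bsub>G\<^esub> = 1\<^sub>m 4"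
  using GL4_simps by (simp_all add: Sz_def)

lemma group_GL4: "group (GL4 q)"
  unfolding GL4_def suz_q_def by (intro monoid.units_group monoid_mat_monoid)

lemma G_eq: "G = (GL4 q)\<lparr>carrier := carrier G\<rparr>"
  by (simp add: Sz_def)

lemma group_G: "group G"
  using group.subgroup_imp_group[OF group_GL4 Sz_subgroup] G_eq by simp

lemma G_sub_GL4: "g \<in> carrier G \<Longrightarrow> g \<in> carrier (GL4 q)"
  using subgroup.subset[OF Sz_subgroup] by auto

lemma G_mat: "g \<in> carrier G \<Longrightarrow> g \<in> carrier_mat 4 4"
  "g \<in> carrier G \<Longrightarrow> i < 4 \<Longrightarrow> j < 4 \<Longrightarrow> g $$ (i, j) \<in> F"
  using G_sub_GL4 GL4_carrier by auto

lemma fin_G: "finite (carrier G)" and card_G: "card (carrier G) \<le> q ^ 16"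
proof -
  let ?I = "{0..<4} \<times> {0..<4} :: (nat \<times> nat) set"
  let ?f = "\<lambda>g :: bit alg_closure mat. restrict (\<lambda>ij. g $$ ij) ?I"
  have "inj_on ?f (carrier G)"
  proof (rule inj_onI)
    fix x y assume xy: "x \<in> carrier G" "y \<in> carrier G" "?f x = ?f y"
    have "x $$ (i, j) = y $$ (i, j)" if "i < 4" "j < 4" for i j
      using fun_cong[OF xy(3), of "(i, j)"] that by simp
    thus "x = y" using G_mat(1)[OF xy(1)] G_mat(1)[OF xy(2)] by (intro eq_matI) auto
  qed
  moreover have "?f ` carrier G \<subseteq> ?I \<rightarrow>\<^sub>E F"
    using G_mat(2) by (intro image_subsetI) (auto simp only: restrict_PiE_iff mem_Times_iff fst_conv snd_conv atLeastLessThan_iff)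
  moreover have "finite (?I \<rightarrow>\<^sub>E F)" using fin_F by (intro finite_PiE) auto
  moreover have "card (?I \<rightarrow>\<^sub>E F) = q ^ 16" by (simp add: card_PiE card_F)
  ultimately show "finite (carrier G)" "card (carrier G) \<le> q ^ 16"
    by (metis inj_on_finite, metis card_inj_on_le)
qed

lemma GL4_mat_vec_inv:
  assumes g: "g \<in> carrier (GL4 q)"
  shows "mat_vec g (mat_vec (inv\<^bsub>GL4 q\<^esub> g) v) = v" "mat_vec (inv\<^bsub>GL4 q\<^esub> g) (mat_vec g v) = v"
proof -
  interpret GL: group "GL4 q" by (rule group_GL4)
  have i: "inv\<^bsub>GL4 q\<^esub> g \<in> carrier (GL4 q)" using g by simp
  show "mat_vec g (mat_vec (inv\<^bsub>GL4 q\<^esub> g) v) = v" "mat_vec (inv\<^bsub>GL4 q\<^esub> g) (mat_vec g v) = v"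
    using GL.r_inv[OF g] GL.l_inv[OF g] mat_vec_mult[OF GL4_carrier(1)[OF g] GL4_carrier(1)[OF i], of v]
      mat_vec_mult[OF GL4_carrier(1)[OF i] GL4_carrier(1)[OF g], of v]
    by (simp_all add: GL4_simps mat_vec_one)
qed

text \<open>
  For the inverse of a generator, invariance of the ovoid follows from its finiteness.
\<close>

lemma G_preserves:
  assumes "g \<in> carrier G"
  shows "(\<forall>L\<in>Ovoid. act g L \<in> Ovoid) \<and> (\<forall>u v. symp (mat_vec g u) (mat_vec g v) = symp u v)"
proof -
  interpret GL: group "GL4 q" by (rule group_GL4)
  have gens: "g \<in> suz_generators n \<Longrightarrow> g \<in> carrier (GL4 q)" for g using suz_generators_in_GL4 by auto
  have gen: "g \<in> generate (GL4 q) (suz_generators n)" using assms by (simp add: Sz_def)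
  thus ?thesis
  proof induction
    case one
    show ?case by (simp add: GL4_simps act_def mat_vec_one)
  next
    case (incl g)
    thus ?case using gens_Ovoid gens_symp by simp
  next
    case (inv g)
    note i = GL4_mat_vec_inv[OF gens[OF inv]]
    have cancel: "act (inv\<^bsub>GL4 q\<^esub> g) (act g L) = L" "act g (act (inv\<^bsub>GL4 q\<^esub> g) L) = L" for L
      using i by (simp_all add: act_def image_image)
    have "act g ` Ovoid = Ovoid"
      using gens_Ovoid[OF inv] cancel(1)
      by (intro endo_inj_surj fin_Ovoid inj_on_inverseI[of _ "act (inv\<^bsub>GL4 q\<^esub> g)"]) auto
    hence "act (inv\<^bsub>GL4 q\<^esub> g) L \<in> Ovoid" if "L \<in> Ovoid" for L using that cancel(1) by (metis imageE)
    moreover have "symp (mat_vec (inv\<^bsub>GL4 q\<^esub> g) u) (mat_vec (inv\<^bsub>GL4 q\<^esub> g) v) = symp u v" for u v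
      using gens_symp[OF inv, of "mat_vec (inv\<^bsub>GL4 q\<^esub> g) u" "mat_vec (inv\<^bsub>GL4 q\<^esub> g) v"] i by simp
    ultimately show ?case by simp
  next
    case (eng g1 g2)
    have c: "g1 \<in> carrier_mat 4 4" "g2 \<in> carrier_mat 4 4"
      using eng(1,2) GL.generate_in_carrier[OF suz_generators_in_GL4] GL4_carrier by auto
    have m: "mat_vec (g1 * g2) v = mat_vec g1 (mat_vec g2 v)" for v by (rule mat_vec_mult[OF c])
    hence "act (g1 * g2) L = act g1 (act g2 L)" for L by (simp add: act_def image_image)
    thus ?case using eng.IH m by (simp add: GL4_simps)
  qed
qed

lemma mat_vec_G_mult: "g \<in> carrier G \<Longrightarrow> k \<in> carrier G \<Longrightarrow> mat_vec (g \<otimes>\<^bsub>G\<^esub> k) v = mat_vec g (mat_vec k v)"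
  by (simp add: G_simps mat_vec_mult G_mat)

lemma act_G_mult: "g \<in> carrier G \<Longrightarrow> k \<in> carrier G \<Longrightarrow> act (g \<otimes>\<^bsub>G\<^esub> k) L = act g (act k L)"
  by (simp add: act_def mat_vec_G_mult image_image)

lemma act_one: "act \<one>\<^bsub>G\<^esub> L = L"
  by (simp add: act_def G_simps(2) mat_vec_one)

lemma acts_G: "acts_on G (carrier G) act Ovoid"
  unfolding acts_on_def
  using group_G group.subgroup_self[OF group_G] G_preserves
  by (simp add: act_G_mult act_one)

end

section \<open>Stabilizers of one and of two points\<close>

lemma line_eq_scale:
  assumes "line v = line w" "w \<noteq> 0"
  obtains c where "c \<noteq> 0" "v = c *s w"
proof -
  obtain c where c: "c \<noteq> 0" "w = c *s v" using line_eqD[OF assms(1)[symmetric] assms(2)] by auto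
  hence "v = inverse c *s w" by simp
  thus thesis using c that by (metis nonzero_imp_inverse_nonzero)
qed

lemma subgroup_nat_pow:
  assumes "group G" "subgroup H G" "x \<in> H"
  shows "x [^]\<^bsub>G\<^esub> (k :: nat) \<in> H"
proof -
  interpret group G by fact
  show ?thesis using assms(3)
    by (induction k) (auto intro: subgroup.m_closed[OF assms(2)] subgroup.one_closed[OF assms(2)])
qed

context suzuki
begin

text \<open>
  The polynomial has degree less than \<open>q\<close>, the number of its roots, and its three exponents differ.
\<close>

lemma three_term_zero:
  assumes z: "\<And>x. x \<in> F \<Longrightarrow> a * x ^ (2 + t) + b * x ^ 2 + c * x ^ t = 0"
  shows "a = 0" "b = 0" "c = 0"
proof -
  define p where "p = monom a (2 + t) + monom b 2 + monom c t"
  have p: "p = 0"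
  proof (rule ccontr)
    assume nz: "p \<noteq> 0"
    have "degree p \<le> 2 + t" unfolding p_def
      by (intro degree_add_le order_trans[OF degree_monom_le]) auto
    moreover have "F \<subseteq> {x. poly p x = 0}" using z by (auto simp: p_def poly_monom)
    hence "card F \<le> card {x. poly p x = 0}" using poly_roots_finite[OF nz] by (rule card_mono[rotated])
    moreover have "card {x. poly p x = 0} \<le> degree p" by (rule card_poly_roots_bound[OF nz])
    ultimately show False using q_gt card_F by linarith
  qed
  have "coeff p (2 + t) = a" "coeff p 2 = b" "coeff p t = c"
    using t_ge by (auto simp: p_def)
  thus "a = 0" "b = 0" "c = 0" using p by auto
qed

lemma Ovoid_cases:
  assumes "L \<in> Ovoid"
  obtains "L = line inf_pt" | a b where "a \<in> F" "b \<in> F" "L = line (pt a b)"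
  using assms unfolding Ovoid_def by auto

lemma Ovoid_finite_point:
  assumes "L \<in> Ovoid" "L \<noteq> line inf_pt"
  obtains a b where "a \<in> F" "b \<in> F" "L = line (pt a b)"
  using assms unfolding Ovoid_def by auto

lemma Ovoid_mem: "line inf_pt \<in> Ovoid" "a \<in> F \<Longrightarrow> b \<in> F \<Longrightarrow> line (pt a b) \<in> Ovoid"
  unfolding Ovoid_def by auto

lemma G_symp: "g \<in> carrier G \<Longrightarrow> symp (mat_vec g u) (mat_vec g v) = symp u v"
  using G_preserves by simp

text \<open>
  The first coordinate of a vector is its product with \<open>inf_pt\<close> under the invariant form. Therefore
  the entry at \<open>(0, 0)\<close> is a linear character of the stabilizer of the point at infinity.
\<close>

lemma inf_stabilizer:
  assumes g: "g \<in> carrier G" and fx: "act g (line inf_pt) = line inf_pt"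
  shows "vec_nth (mat_vec g v) 1 = g $$ (0, 0) * vec_nth v 1" "g $$ (0, 0) \<noteq> 0"
proof -
  obtain c where c: "c \<noteq> 0" "mat_vec g inf_pt = c *s inf_pt"
    using line_eq_scale[OF fx[unfolded act_line] pt_ne(2)] by auto
  have *: "vec_nth (mat_vec g v) 1 * c = vec_nth v 1" for v
    using G_symp[OF g, of v inf_pt] unfolding c(2) by (simp add: symp_def inf_pt_def mult.commute)
  have "g $$ (0, 0) * c = 1" using *[of "V4 1 0 0 0"] by (simp add: mat_vec_nth)
  thus "g $$ (0, 0) \<noteq> 0" by auto
  have "vec_nth (mat_vec g v) 1 * c = g $$ (0, 0) * vec_nth v 1 * c"
    using *[of v] \<open>g $$ (0, 0) * c = 1\<close> by (simp add: mult_ac)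
  thus "vec_nth (mat_vec g v) 1 = g $$ (0, 0) * vec_nth v 1" using c(1) by simp
qed

text \<open>
  The invariant form makes \<open>k\<close> block diagonal, with a block \<open>(m11, m12; m21, m22)\<close> in the middle. This
  block maps the surface \<open>z = ov x y\<close> to itself up to a factor \<open>r\<close>. Comparing coefficients for
  \<open>a = 0\<close>, for \<open>b = 0\<close> and for \<open>a = b = 1\<close> shows that the block is diagonal and determined by \<open>m11\<close>.
\<close>

lemma two_point_stabilizer:
  assumes k: "k \<in> carrier G" and fx: "act k (line inf_pt) = line inf_pt" "act k (line (pt 0 0)) = line (pt 0 0)"
  obtains l where "l \<in> F" "l \<noteq> 0" "l ^ (2 + t) * k $$ (0, 0) ^ 2 = 1"
    "\<And>x y z w. mat_vec k (V4 x y z w) = k $$ (0, 0) *s V4 x (l * y) (l ^ (1 + t) * z) (l ^ (2 + t) * w)"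
proof -
  let ?e1 = "V4 0 1 0 (0 :: bit alg_closure)" and ?e2 = "V4 0 0 1 (0 :: bit alg_closure)"
  obtain c3 where c3: "c3 \<noteq> 0" "mat_vec k inf_pt = c3 *s inf_pt"
    using line_eq_scale[OF fx(1)[unfolded act_line] pt_ne(2)] by auto
  obtain c0 where c0: "c0 \<noteq> 0" "mat_vec k (pt 0 0) = c0 *s pt 0 0"
    using line_eq_scale[OF fx(2)[unfolded act_line] pt_ne(1)] by auto
  have col3: "k $$ (0, 3) = 0" "k $$ (Suc 0, 3) = 0" "k $$ (2, 3) = 0" "k $$ (3, 3) = c3"
    using c3(2) by (auto simp: vec4_eq_iff mat_vec_nth inf_pt_def)
  have col0: "k $$ (0, 0) = c0" "k $$ (Suc 0, 0) = 0" "k $$ (2, 0) = 0" "k $$ (3, 0) = 0"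
    using c0(2) by (auto simp: vec4_eq_iff mat_vec_nth pt_def)
  have col1: "k $$ (0, Suc 0) = 0" "k $$ (3, Suc 0) = 0"
    using G_symp[OF k, of ?e1 inf_pt] G_symp[OF k, of ?e1 "pt 0 0"] c0(1) c3(1)
    unfolding c3(2) c0(2) by (auto simp: symp_def pt_def inf_pt_def mat_vec_nth)
  have col2: "k $$ (0, 2) = 0" "k $$ (3, 2) = 0"
    using G_symp[OF k, of ?e2 inf_pt] G_symp[OF k, of ?e2 "pt 0 0"] c0(1) c3(1)
    unfolding c3(2) c0(2) by (auto simp: symp_def pt_def inf_pt_def mat_vec_nth)
  have c03: "c0 * c3 = 1"
    using G_symp[OF k, of "pt 0 0" inf_pt] unfolding c3(2) c0(2) by (auto simp: symp_def pt_def inf_pt_def)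
  define m11 m12 m21 m22 r where "m11 = k $$ (1, 1) / c0" and "m12 = k $$ (1, 2) / c0"
    and "m21 = k $$ (2, 1) / c0" and "m22 = k $$ (2, 2) / c0" and "r = c3 / c0"
  have mat_vec_k: "mat_vec k (V4 x y z w) = c0 *s V4 x (m11 * y + m12 * z) (m21 * y + m22 * z) (r * w)" for x y z w
    using c0(1) by (simp add: vec4_eq_iff mat_vec_nth col0 col1 col2 col3 m11_def m12_def m21_def m22_def r_def distrib_left)
  have mF: "m11 \<in> F" "m12 \<in> F" "m21 \<in> F" "m22 \<in> F" "r \<in> F"
    using G_mat(2)[OF k] unfolding m11_def m12_def m21_def m22_def r_def col0(1)[symmetric] col3(4)[symmetric] by auto
  have key: "ov (m11 * a + m12 * b) (m21 * a + m22 * b) = r * ov a b" if ab: "a \<in> F" "b \<in> F" for a b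
  proof -
    have mvp: "mat_vec k (pt a b) = c0 *s V4 1 (m11 * a + m12 * b) (m21 * a + m22 * b) (r * ov a b)"
      by (simp add: pt_def mat_vec_k)
    have "act k (line (pt a b)) \<in> Ovoid" using G_preserves[OF k] Ovoid_mem(2)[OF ab] by blast
    thus ?thesis
    proof (cases rule: Ovoid_cases)
      case 1
      obtain d where "mat_vec k (pt a b) = d *s inf_pt"
        using line_eq_scale[OF 1[unfolded act_line] pt_ne(2)] by auto
      thus ?thesis unfolding mvp using c0(1) by (simp add: V4_scale inf_pt_def)
    next
      case (2 a' b')
      obtain d where "mat_vec k (pt a b) = d *s pt a' b'"
        using line_eq_scale[OF 2(3)[unfolded act_line] pt_ne(1)] by auto
      thus ?thesis unfolding mvp using c0(1) by (auto simp: V4_scale pt_def)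
    qed
  qed
  have "m12 ^ (2 + t) * x ^ (2 + t) + m12 * m22 * x ^ 2 + (m22 ^ t + r) * x ^ t = 0" if x: "x \<in> F" for x
    using iffD2[OF add_eq_0_iff_ac key[OF F_closed(1) x]]
    by (simp add: ov_def power_mult_distrib power2_eq_square algebra_simps zero_power char2)
  from three_term_zero[OF this] have m12: "m12 = 0" and m22: "m22 ^ t = r"
    by (auto simp: add_eq_0_iff_ac)
  have "(m11 ^ (2 + t) + r) * x ^ (2 + t) + m11 * m21 * x ^ 2 + m21 ^ t * x ^ t = 0" if x: "x \<in> F" for x
    using iffD2[OF add_eq_0_iff_ac key[OF x F_closed(1)]]
    by (simp add: ov_def power_mult_distrib power2_eq_square algebra_simps zero_power char2)
  from three_term_zero[OF this] have m21: "m21 = 0" and m11: "m11 ^ (2 + t) = r"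
    by (auto simp: add_eq_0_iff_ac)
  have r0: "r \<noteq> 0" using c3 c0 by (simp add: r_def)
  have "m11 ^ (2 + t) + m11 * m22 + m22 ^ t = r * (1 + 1 + 1)"
    using key[OF F_closed(2) F_closed(2)] m12 m21 by (simp add: ov_def)
  hence "m11 * m22 = r" unfolding m11 m22 by (simp add: algebra_simps char2)
  moreover have "m11 \<noteq> 0" using m11 r0 by auto
  moreover have "m11 * m11 ^ (1 + t) = r" using m11 by (simp add: power_add power2_eq_square mult_ac)
  ultimately have "m22 = m11 ^ (1 + t)" by (metis mult_left_cancel)
  moreover have "r * c0 ^ 2 = 1" using c03 c0 by (simp add: r_def power2_eq_square mult.commute)
  ultimately show thesis using that[of m11] mF(1) m11 m12 m21 mat_vec_k col0(1) \<open>m11 \<noteq> 0\<close> by simp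
qed

definition Stab_inf where "Stab_inf = {g \<in> carrier G. act g (line inf_pt) = line inf_pt}"

definition P where "P = {suz_S n a b | a b. a \<in> F \<and> b \<in> F}"

lemma S_in_G: "a \<in> F \<Longrightarrow> b \<in> F \<Longrightarrow> suz_S n a b \<in> carrier G"
  unfolding Sz_def by (auto simp: suz_generators_def intro!: generate.incl)

lemma T_in_G: "suz_T \<in> carrier G"
  unfolding Sz_def by (auto simp: suz_generators_def intro!: generate.incl)

lemma S_chi: "suz_S n a b $$ (0, 0) = 1"
  by (simp add: suz_S_def Let_def mat_of_rows_list_4)

lemma act_S_pt: "c \<in> F \<Longrightarrow> act (suz_S n c d) (line (pt a b)) = line (pt (c + a) (d + c ^ t * a + b))"
  by (simp add: act_line mat_vec_S_pt)

lemma act_S_inf: "act (suz_S n c d) (line inf_pt) = line inf_pt"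
  by (simp add: act_line mat_vec_S_inf)

lemma S_inject: "a \<in> F \<Longrightarrow> c \<in> F \<Longrightarrow> suz_S n a b = suz_S n c d \<longleftrightarrow> a = c \<and> b = d"
proof
  assume ac: "a \<in> F" "c \<in> F" and e: "suz_S n a b = suz_S n c d"
  have "line (pt a b) = act (suz_S n a b) (line (pt 0 0))" by (simp add: act_S_pt ac)
  also have "\<dots> = line (pt c d)" unfolding e by (simp add: act_S_pt ac)
  finally show "a = c \<and> b = d" by (simp add: line_pt_eq)
qed auto

lemma S_00: "suz_S n 0 0 = \<one>\<^bsub>G\<^esub>"
proof -
  have "mat_vec (suz_S n 0 0) v = mat_vec (1\<^sub>m 4) v" for v
    by (rule V4_cases[of v]) (simp add: mat_vec_S mat_vec_one zero_power)
  thus ?thesis unfolding G_simps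
    by (intro mat_vec_inject G_mat(1)[OF S_in_G]) auto
qed

lemma Stab_inf_subgroup: "subgroup Stab_inf G"
proof -
  interpret group G by (rule group_G)
  show ?thesis
  proof (rule subgroupI)
    show "Stab_inf \<subseteq> carrier G" "Stab_inf \<noteq> {}" using act_one by (auto simp: Stab_inf_def)
    show "inv\<^bsub>G\<^esub> g \<in> Stab_inf" if "g \<in> Stab_inf" for g
      using that acts_on_inv[OF acts_G, of g "line inf_pt"] Ovoid_mem by (auto simp: Stab_inf_def)
    show "g \<otimes>\<^bsub>G\<^esub> k \<in> Stab_inf" if "g \<in> Stab_inf" "k \<in> Stab_inf" for g k
      using that by (auto simp: Stab_inf_def act_G_mult)
  qed
qed

lemma chi_mult:
  assumes "g \<in> Stab_inf" "k \<in> Stab_inf"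
  shows "(g \<otimes>\<^bsub>G\<^esub> k) $$ (0, 0) = g $$ (0, 0) * k $$ (0, 0)"
proof -
  have gk: "g \<otimes>\<^bsub>G\<^esub> k \<in> Stab_inf" using subgroup.m_closed[OF Stab_inf_subgroup assms] .
  have *: "g \<in> carrier G" "act g (line inf_pt) = line inf_pt" if "g \<in> Stab_inf" for g using that by (auto simp: Stab_inf_def)
  show ?thesis
    using inf_stabilizer(1)[OF *[OF gk], of "V4 1 0 0 0"] inf_stabilizer(1)[OF *[OF assms(1)], of "mat_vec k (V4 1 0 0 0)"]
      inf_stabilizer(1)[OF *[OF assms(2)], of "V4 1 0 0 0"] mat_vec_G_mult[OF *(1)[OF assms(1)] *(1)[OF assms(2)], of "V4 1 0 0 0"]
    by simp
qed

lemma chi_one: "\<one>\<^bsub>G\<^esub> $$ (0, 0) = 1"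
  by (simp add: G_simps)

lemma chi_pow: "g \<in> Stab_inf \<Longrightarrow> (g [^]\<^bsub>G\<^esub> (k :: nat)) $$ (0, 0) = g $$ (0, 0) ^ k"
proof (induction k)
  case (Suc k)
  interpret group G by (rule group_G)
  have "g [^]\<^bsub>G\<^esub> k \<in> Stab_inf" by (rule subgroup_nat_pow[OF group_G Stab_inf_subgroup Suc.prems])
  thus ?case using Suc by (simp add: chi_mult mult.commute)
qed (simp add: chi_one)

lemma chi_nonzero: "g \<in> Stab_inf \<Longrightarrow> g $$ (0, 0) \<noteq> 0" and chi_F: "g \<in> Stab_inf \<Longrightarrow> g $$ (0, 0) \<in> F"
  using inf_stabilizer(2) G_mat(2) by (auto simp: Stab_inf_def)

lemma F_unit_power: "x \<in> F \<Longrightarrow> x \<noteq> 0 \<Longrightarrow> x ^ (q - 1) = 1"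
proof -
  assume x: "x \<in> F" "x \<noteq> 0"
  have "x ^ (q - 1) * x = 1 * x" using F_power_q[OF x(1)] q_pos by (simp flip: power_Suc2)
  thus ?thesis using x(2) by simp
qed

text \<open>
  An element of the kernel of the character agrees with some \<open>suz_S n a b\<close> at \<open>pt 0 0\<close>. Their
  quotient fixes two points and has character value 1, which forces \<open>l = 1\<close> in
  \<open>two_point_stabilizer\<close>.
\<close>

lemma P_eq: "P = {g \<in> Stab_inf. g $$ (0, 0) = 1}"
proof
  show "P \<subseteq> {g \<in> Stab_inf. g $$ (0, 0) = 1}"
    using act_S_inf S_in_G by (auto simp: P_def Stab_inf_def S_chi)
  show "{g \<in> Stab_inf. g $$ (0, 0) = 1} \<subseteq> P"
  proof clarify
    fix g assume g: "g \<in> Stab_inf" "g $$ (0, 0) = 1"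
    interpret group G by (rule group_G)
    have gG: "g \<in> carrier G" "act g (line inf_pt) = line inf_pt" using g by (auto simp: Stab_inf_def)
    have "act g (line (pt 0 0)) \<in> Ovoid" using G_preserves[OF gG(1)] Ovoid_mem(2)[of 0 0] by auto
    moreover have "act g (line (pt 0 0)) \<noteq> line inf_pt"
      using acts_on_inv(1)[OF acts_G gG(1) Ovoid_mem(1)] acts_on_inv(1)[OF acts_G gG(1) Ovoid_mem(2)[of 0 0]] gG(2)
        line_pt_ne_inf F_closed(1) by metis
    ultimately obtain a b where ab: "a \<in> F" "b \<in> F" "act g (line (pt 0 0)) = line (pt a b)"
      by (rule Ovoid_finite_point)
    let ?s = "suz_S n a b"
    have s: "?s \<in> Stab_inf" "?s \<in> carrier G" using ab act_S_inf S_in_G by (auto simp: Stab_inf_def)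
    have i: "inv\<^bsub>G\<^esub> ?s \<in> Stab_inf" "inv\<^bsub>G\<^esub> ?s \<in> carrier G" using s subgroup.m_inv_closed[OF Stab_inf_subgroup] by auto
    define k where "k = inv\<^bsub>G\<^esub> ?s \<otimes>\<^bsub>G\<^esub> g"
    have k: "k \<in> Stab_inf" using i g subgroup.m_closed[OF Stab_inf_subgroup] by (simp add: k_def)
    hence k': "k \<in> carrier G" "act k (line inf_pt) = line inf_pt" by (auto simp: Stab_inf_def)
    have "act ?s (line (pt 0 0)) = line (pt a b)" using act_S_pt[OF ab(1), of b 0 0] by simp
    hence "act k (line (pt 0 0)) = line (pt 0 0)"
      using acts_on_inv(1)[OF acts_G s(2) Ovoid_mem(2)[of 0 0]] by (simp add: k_def act_G_mult i gG ab(3))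
    with k' obtain l where l: "l \<in> F" "l ^ (2 + t) * k $$ (0, 0) ^ 2 = 1"
      "\<And>x y z w. mat_vec k (V4 x y z w) = k $$ (0, 0) *s V4 x (l * y) (l ^ (1 + t) * z) (l ^ (2 + t) * w)"
      by (metis two_point_stabilizer)
    have "?s \<otimes>\<^bsub>G\<^esub> k = g" unfolding k_def using s gG by (simp add: m_assoc[symmetric])
    hence "k $$ (0, 0) = 1" using chi_mult[OF s(1) k] g(2) S_chi by simp
    hence 1: "l ^ (2 + t) = 1" using l(2) by simp
    have "(l ^ (1 + t)) ^ t = l ^ (2 + t)" using pow_t_t[OF l(1)] by (simp add: power_add power_mult_distrib power2_eq_square mult.commute)
    hence "l ^ (1 + t) = 1" using 1 pow_t_1 by simp
    hence "l = 1" using 1 by (simp add: power_add power2_eq_square mult.assoc)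
    hence "mat_vec k v = mat_vec (1\<^sub>m 4) v" for v
      by (rule_tac V4_cases[of v]) (simp add: l(3) \<open>k $$ (0, 0) = 1\<close> mat_vec_one)
    hence "k = \<one>\<^bsub>G\<^esub>" unfolding G_simps by (rule mat_vec_inject[OF G_mat(1)[OF k'(1)] one_carrier_mat])
    hence "g = ?s" using \<open>?s \<otimes>\<^bsub>G\<^esub> k = g\<close> s by simp
    thus "g \<in> P" using ab by (auto simp: P_def)
  qed
qed

lemma P_subgroup: "subgroup P G"
proof -
  interpret group G by (rule group_G)
  show ?thesis
  proof (rule subgroupI)
    show "P \<subseteq> carrier G" by (auto simp: P_eq Stab_inf_def)
    show "P \<noteq> {}" by (auto simp: P_def)
    show m: "g \<otimes>\<^bsub>G\<^esub> k \<in> P" if "g \<in> P" "k \<in> P" for g k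
      using that subgroup.m_closed[OF Stab_inf_subgroup] chi_mult by (auto simp: P_eq)
    show "inv\<^bsub>G\<^esub> g \<in> P" if "g \<in> P" for g
      using that subgroup.m_inv_closed[OF Stab_inf_subgroup] chi_mult[of "inv\<^bsub>G\<^esub> g" g] chi_one
      by (auto simp: P_eq Stab_inf_def)
  qed
qed

lemma card_P: "card P = q\<^sup>2"
proof -
  have "P = (\<lambda>(a, b). suz_S n a b) ` (F \<times> F)" by (auto simp: P_def)
  moreover have "inj_on (\<lambda>(a, b). suz_S n a b) (F \<times> F)" by (auto simp: inj_on_def S_inject)
  ultimately show ?thesis by (simp add: card_image card_cartesian_product card_F power2_eq_square)
qed

text \<open>
  The product belongs to \<open>P\<close>, and an element of \<open>P\<close> is determined by the image of \<open>pt 0 0\<close>. This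
  replaces the multiplication of matrices.
\<close>

lemma S_mult:
  assumes "a \<in> F" "b \<in> F" "c \<in> F" "d \<in> F"
  shows "suz_S n a b \<otimes>\<^bsub>G\<^esub> suz_S n c d = suz_S n (a + c) (b + d + a ^ t * c)"
proof -
  have "suz_S n a b \<otimes>\<^bsub>G\<^esub> suz_S n c d \<in> P"
    using assms by (intro subgroup.m_closed[OF P_subgroup]) (auto simp: P_def)
  then obtain x y where xy: "x \<in> F" "y \<in> F" "suz_S n a b \<otimes>\<^bsub>G\<^esub> suz_S n c d = suz_S n x y" by (auto simp: P_def)
  have "line (pt x y) = act (suz_S n a b \<otimes>\<^bsub>G\<^esub> suz_S n c d) (line (pt 0 0))"
    using act_S_pt[OF xy(1), of y 0 0] xy(3) by simp
  also have "\<dots> = line (pt (a + c) (b + d + a ^ t * c))"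
    using act_G_mult[OF S_in_G[OF assms(1,2)] S_in_G[OF assms(3,4)]] act_S_pt[OF assms(3), of d 0 0]
      act_S_pt[OF assms(1)] by (simp add: add_ac)
  finally show ?thesis using xy(3) line_pt_eq by simp
qed

lemma P_free:
  assumes "s \<in> P" "L \<in> Ovoid" "L \<noteq> line inf_pt" "act s L = L"
  shows "s = \<one>\<^bsub>G\<^esub>"
proof -
  obtain a b where L: "a \<in> F" "b \<in> F" "L = line (pt a b)" using assms(2,3) by (rule Ovoid_finite_point)
  obtain c d where s: "c \<in> F" "d \<in> F" "s = suz_S n c d" using assms(1) by (auto simp: P_def)
  have "line (pt (c + a) (d + c ^ t * a + b)) = line (pt a b)"
    using assms(4) act_S_pt[OF s(1), of d a b] unfolding s(3) L(3) by simp
  hence "c + a = a" "d + c ^ t * a + b = b" unfolding line_pt_eq by auto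
  hence "c = 0" "d = 0" using t_pos by (auto simp: zero_power)
  thus ?thesis using s S_00 by simp
qed

lemma P_trans:
  assumes "L \<in> Ovoid" "L \<noteq> line inf_pt"
  obtains s where "s \<in> P" "act s (line (pt 0 0)) = L"
proof -
  obtain a b where L: "a \<in> F" "b \<in> F" "L = line (pt a b)" using assms by (rule Ovoid_finite_point)
  show thesis using that[of "suz_S n a b"] L act_S_pt[OF L(1), of b 0 0] by (auto simp: P_def)
qed

lemma G_trans:
  assumes "L \<in> Ovoid"
  obtains g where "g \<in> carrier G" "act g (line inf_pt) = L"
proof (cases "L = line inf_pt")
  case True
  thus thesis using that[of "\<one>\<^bsub>G\<^esub>"] act_one group.subgroup_self[OF group_G] subgroup.one_closed by blast
next
  case False
  then obtain s where s: "s \<in> P" "act s (line (pt 0 0)) = L" using P_trans assms by metis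
  have sG: "s \<in> carrier G" using s subgroup.subset[OF P_subgroup] by auto
  have "mat_vec suz_T inf_pt = pt 0 0" by (simp add: inf_pt_def pt_def mat_vec_T)
  hence "act suz_T (line inf_pt) = line (pt 0 0)" by (simp add: act_line)
  hence "act (s \<otimes>\<^bsub>G\<^esub> suz_T) (line inf_pt) = L" using s by (simp only: act_G_mult sG T_in_G)
  moreover have "s \<otimes>\<^bsub>G\<^esub> suz_T \<in> carrier G"
    using sG T_in_G group_G by (meson group.is_monoid monoid.m_closed)
  ultimately show thesis using that by blast
qed

end

section \<open>Conjugation and linear characters of p-groups\<close>

lemma acts_on_subgroup: "acts_on G H act U \<Longrightarrow> subgroup K G \<Longrightarrow> K \<subseteq> H \<Longrightarrow> acts_on G K act U"
  unfolding acts_on_def by (simp add: subset_iff)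

definition conj_by :: "('a, 'b) monoid_scheme \<Rightarrow> 'a \<Rightarrow> 'a \<Rightarrow> 'a" where
  "conj_by G g x = g \<otimes>\<^bsub>G\<^esub> x \<otimes>\<^bsub>G\<^esub> inv\<^bsub>G\<^esub> g"

context group
begin

lemma conj_by_closed [simp, intro]: "g \<in> carrier G \<Longrightarrow> x \<in> carrier G \<Longrightarrow> conj_by G g x \<in> carrier G"
  by (simp add: conj_by_def)

lemma conj_by_conj_by: "g \<in> carrier G \<Longrightarrow> k \<in> carrier G \<Longrightarrow> x \<in> carrier G \<Longrightarrow> conj_by G g (conj_by G k x) = conj_by G (g \<otimes> k) x"
  by (simp add: conj_by_def m_assoc inv_mult_group)

lemma conj_by_one_left [simp]: "x \<in> carrier G \<Longrightarrow> conj_by G \<one> x = x"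
  by (simp add: conj_by_def)

lemma conj_by_one [simp]: "g \<in> carrier G \<Longrightarrow> conj_by G g \<one> = \<one>"
  by (simp add: conj_by_def)

lemma conj_by_inv [simp]: "g \<in> carrier G \<Longrightarrow> x \<in> carrier G \<Longrightarrow> conj_by G (inv g) (conj_by G g x) = x"
  "g \<in> carrier G \<Longrightarrow> x \<in> carrier G \<Longrightarrow> conj_by G g (conj_by G (inv g) x) = x"
  by (simp_all add: conj_by_conj_by)

lemma conj_by_mult: "g \<in> carrier G \<Longrightarrow> x \<in> carrier G \<Longrightarrow> y \<in> carrier G \<Longrightarrow> conj_by G g (x \<otimes> y) = conj_by G g x \<otimes> conj_by G g y"
proof -
  assume g: "g \<in> carrier G" "x \<in> carrier G" "y \<in> carrier G"
  have "inv g \<otimes> (g \<otimes> z) = z" if "z \<in> carrier G" for z using g that by (simp add: m_assoc[symmetric])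
  thus ?thesis using g by (simp add: conj_by_def m_assoc)
qed

lemma conj_by_inj: "g \<in> carrier G \<Longrightarrow> inj_on (conj_by G g) (carrier G)"
  by (rule inj_on_inverseI[of _ "conj_by G (inv g)"]) simp

lemma conj_by_pow: "g \<in> carrier G \<Longrightarrow> x \<in> carrier G \<Longrightarrow> conj_by G g x [^] (k :: nat) = conj_by G g (x [^] k)"
  by (induction k) (auto simp: conj_by_mult)

lemma conj_by_eq_one: "g \<in> carrier G \<Longrightarrow> x \<in> carrier G \<Longrightarrow> conj_by G g x = \<one> \<longleftrightarrow> x = \<one>"
  by (metis conj_by_inv(1) conj_by_one inv_closed)

lemma conj_by_subgroup:
  assumes "g \<in> carrier G" "subgroup H G"
  shows "subgroup (conj_by G g ` H) G"
proof -
  interpret H: subgroup H G by fact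
  show ?thesis
  proof (rule subgroupI)
    show "inv a \<in> conj_by G g ` H" if a: "a \<in> conj_by G g ` H" for a
    proof -
      obtain x where x: "x \<in> H" "a = conj_by G g x" using a by auto
      have "inv a = conj_by G g (inv x)"
        using x assms(1) by (intro inv_equality) (auto simp flip: conj_by_mult)
      thus ?thesis using x by simp
    qed
    show "a \<otimes> b \<in> conj_by G g ` H" if "a \<in> conj_by G g ` H" "b \<in> conj_by G g ` H" for a b
      using that assms(1) by (auto simp flip: conj_by_mult)
    show "conj_by G g ` H \<noteq> {}" using H.one_closed by blast
  qed (use assms in auto)
qed

lemma conj_by_image_inv:
  assumes "g \<in> carrier G" "H \<subseteq> carrier G"
  shows "conj_by G (inv g) ` conj_by G g ` H = H" "conj_by G g ` conj_by G (inv g) ` H = H"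
  using assms by (force simp: image_image subset_iff)+

lemma card_conj_by:
  assumes "g \<in> carrier G" "H \<subseteq> carrier G"
  shows "card (conj_by G g ` H) = card H"
  by (rule card_image[OF inj_on_subset[OF conj_by_inj[OF assms(1)] assms(2)]])

lemma conj_by_generate:
  assumes "g \<in> carrier G" "x \<in> carrier G"
  shows "conj_by G g ` generate G {x} = generate G {conj_by G g x}"
proof
  have *: "conj_by G g ` generate G {x} \<subseteq> generate G {conj_by G g x}" if gx: "g \<in> carrier G" "x \<in> carrier G" for g x
  proof (rule image_subsetI)
    fix y assume "y \<in> generate G {x}"
    thus "conj_by G g y \<in> generate G {conj_by G g x}"
    proof induction
      case one show ?case using gx by (simp add: generate.one)
    next
      case (incl h) thus ?case by (auto intro: generate.incl)
    next
      case (inv h)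
      have "conj_by G g (inv x) = inv (conj_by G g x)"
        using gx by (intro inv_equality[symmetric]) (auto simp flip: conj_by_mult)
      thus ?case using inv by (auto intro: generate.inv)
    next
      case (eng a b)
      have "a \<in> carrier G" "b \<in> carrier G" using eng(1,2) gx generate_in_carrier[of "{x}"] by auto
      thus ?case using eng gx by (simp add: conj_by_mult generate.eng)
    qed
  qed
  show "conj_by G g ` generate G {x} \<subseteq> generate G {conj_by G g x}" by (rule *[OF assms])
  show "generate G {conj_by G g x} \<subseteq> conj_by G g ` generate G {x}"
  proof
    fix y assume y: "y \<in> generate G {conj_by G g x}"
    hence yc: "y \<in> carrier G" using generate_in_carrier[of "{conj_by G g x}"] assms by auto
    have "conj_by G (inv g) y \<in> generate G {conj_by G (inv g) (conj_by G g x)}"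
      using *[of "inv g" "conj_by G g x"] y assms by auto
    hence "conj_by G (inv g) y \<in> generate G {x}" using assms by simp
    thus "y \<in> conj_by G g ` generate G {x}" using yc assms(1) by (metis conj_by_inv(2) image_eqI)
  qed
qed

text \<open>
  Otherwise the character would take \<open>p ^ a\<close> distinct values among the roots of
  \<open>x ^ (p ^ (a - 1)) - 1\<close>.
\<close>

lemma exists_element_of_p_power_order:
  fixes ch :: "'a \<Rightarrow> 'k::field"
  assumes R: "subgroup R G" and card: "card R = p ^ a" and p: "prime p"
    and mult: "\<And>x y. x \<in> R \<Longrightarrow> y \<in> R \<Longrightarrow> ch (x \<otimes> y) = ch x * ch y"
    and one: "ch \<one> = 1" and ker: "\<And>x. x \<in> R \<Longrightarrow> ch x = 1 \<Longrightarrow> x = \<one>"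
  shows "\<exists>x\<in>R. p ^ a dvd ord x"
proof (rule ccontr)
  assume no: "\<not> ?thesis"
  interpret R: subgroup R G by fact
  have "a \<noteq> 0"
  proof
    assume "a = 0"
    hence "p ^ a dvd ord \<one>" by simp
    thus False using no R.one_closed by blast
  qed
  then obtain b where b: "a = Suc b" by (cases a) auto
  have xp: "x [^] (p ^ b) = \<one>" if x: "x \<in> R" for x
  proof -
    have xG: "x \<in> carrier G" using x by simp
    have "ord x dvd p ^ a" using ord_dvd_card_subgroup[OF group_axioms R x] card by simp
    then obtain i where i: "i \<le> a" "ord x = p ^ i" using p divides_primepow_nat by blast
    have "i \<noteq> a" using no x i by auto
    hence "ord x dvd p ^ b" using i b by (simp add: le_imp_power_dvd)
    thus ?thesis using xG by (simp add: pow_eq_id)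
  qed
  have ch_pow: "ch (x [^] (k::nat)) = ch x ^ k" if "x \<in> R" for x k
    by (induction k) (use that mult one subgroup_nat_pow[OF group_axioms R that] in \<open>auto simp: mult.commute\<close>)
  have inj: "inj_on ch R"
  proof (rule inj_onI)
    fix x y assume xy: "x \<in> R" "y \<in> R" "ch x = ch y"
    have iy: "inv y \<in> R" using xy by simp
    have "ch (x \<otimes> inv y) = ch (y \<otimes> inv y)" unfolding mult[OF xy(1) iy] mult[OF xy(2) iy] xy(3) ..
    also have "\<dots> = 1" using xy one by simp
    finally have "x \<otimes> inv y = \<one>" using xy by (intro ker) auto
    thus "x = y" using xy by (metis R.mem_carrier inv_closed inv_equality inv_inv)
  qed
  define P where "P = monom (1::'k) (p ^ b) - 1"
  have pb: "p ^ b > 0" using p prime_gt_0_nat by simp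
  have deg: "degree P = p ^ b" unfolding P_def diff_conv_add_uminus
    using pb by (subst degree_add_eq_left) (auto simp: degree_monom_eq)
  hence P0: "P \<noteq> 0" using pb by auto
  have "ch ` R \<subseteq> {z. poly P z = 0}" 
  proof clarify
    fix x assume x: "x \<in> R"
    have "ch x ^ (p ^ b) = 1" using ch_pow[OF x, of "p ^ b"] xp[OF x] one by simp
    thus "poly P (ch x) = 0" by (simp add: P_def poly_monom)
  qed
  hence "card (ch ` R) \<le> card {z. poly P z = 0}" using poly_roots_finite[OF P0] by (intro card_mono)
  also have "\<dots> \<le> p ^ b" using card_poly_roots_bound[OF P0] deg by simp
  finally have "p ^ a \<le> p ^ b" using card_image[OF inj] card by simp
  thus False using b prime_gt_1_nat[OF p] by simp
qed

text \<open>
  The group acts by conjugation on its nontrivial elements, whose number is prime to \<open>p\<close>.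
\<close>

lemma p_group_center:
  assumes R: "subgroup R G" and card: "card R = p ^ a" and p: "prime p" and a: "a > 0"
  obtains z where "z \<in> R" "z \<noteq> \<one>" "\<And>x. x \<in> R \<Longrightarrow> z \<otimes> x = x \<otimes> z"
proof -
  interpret R: subgroup R G by fact
  have finR: "finite R" using card p by (metis card.infinite prime_gt_0_nat zero_less_power less_irrefl)
  have "acts_on G R (conj_by G) (R - {\<one>})"
    unfolding acts_on_def
  proof (intro conjI ballI)
    show "conj_by G x y \<in> R - {\<one>}" if "x \<in> R" "y \<in> R - {\<one>}" for x y
      using that conj_by_eq_one[of x y] by (auto simp: conj_by_def)
    show "conj_by G \<one> x = x" if "x \<in> R - {\<one>}" for x using that by simp
    show "conj_by G (x \<otimes> y) z = conj_by G x (conj_by G y z)" if "x \<in> R" "y \<in> R" "z \<in> R - {\<one>}" for x y z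
      using that by (simp add: conj_by_conj_by)
  qed (use R group_axioms in auto)
  moreover have "\<not> p dvd card (R - {\<one>})"
  proof
    assume d: "p dvd card (R - {\<one>})"
    have "card R = Suc (card (R - {\<one>}))" using finR R.one_closed by (metis card_Suc_Diff1)
    moreover have "p dvd card R" using card a by simp
    ultimately have "p dvd 1" using d by (metis Suc_eq_plus1 dvd_add_right_iff)
    thus False using p by (metis not_prime_unit)
  qed
  ultimately obtain z where z: "z \<in> R" "z \<noteq> \<one>" "\<And>x. x \<in> R \<Longrightarrow> conj_by G x z = z"
    using p_group_fixed_point[of G R "conj_by G" "R - {\<one>}" p a] finR p card by auto
  have "z \<otimes> x = x \<otimes> z" if x: "x \<in> R" for x
  proof -
    have "conj_by G x z \<otimes> x = x \<otimes> z" using x z(1) by (simp add: conj_by_def m_assoc)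
    thus ?thesis using z(3)[OF x] by simp
  qed
  thus thesis using that z by blast
qed

end

section \<open>Sylow subgroups for odd primes\<close>

context suzuki
begin

lemma act_conj_by: "g \<in> carrier G \<Longrightarrow> x \<in> carrier G \<Longrightarrow> L \<in> Ovoid \<Longrightarrow> act (conj_by G g x) (act g L) = act g (act x L)"
proof -
  assume a: "g \<in> carrier G" "x \<in> carrier G" "L \<in> Ovoid"
  interpret group G by (rule group_G)
  have "conj_by G g x \<otimes>\<^bsub>G\<^esub> g = g \<otimes>\<^bsub>G\<^esub> x" using a by (simp add: conj_by_def m_assoc)
  thus ?thesis using a by (metis act_G_mult conj_by_closed)
qed

lemma act_closed: "g \<in> carrier G \<Longrightarrow> L \<in> Ovoid \<Longrightarrow> act g L \<in> Ovoid"
  using G_preserves by blast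

lemma conj_by_in_Stab_inf:
  assumes "g \<in> carrier G" "x \<in> carrier G" "act g (line inf_pt) = L" "act x L = L"
  shows "conj_by G (inv\<^bsub>G\<^esub> g) x \<in> Stab_inf"
proof -
  interpret group G by (rule group_G)
  have L: "L \<in> Ovoid" using assms act_closed Ovoid_mem by blast
  have "act (inv\<^bsub>G\<^esub> g) L = line inf_pt" using assms acts_on_inv(1)[OF acts_G assms(1) Ovoid_mem(1)] by simp
  thus ?thesis using act_conj_by[of "inv\<^bsub>G\<^esub> g" x L] assms L by (simp add: Stab_inf_def)
qed

lemma P_sub: "P \<subseteq> Stab_inf" "P \<subseteq> carrier G" "Stab_inf \<subseteq> carrier G"
  using subgroup.subset[OF P_subgroup] subgroup.subset[OF Stab_inf_subgroup] by (auto simp: P_eq)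

lemma P_pow: "x \<in> P \<Longrightarrow> x [^]\<^bsub>G\<^esub> q\<^sup>2 = \<one>\<^bsub>G\<^esub>"
proof -
  assume x: "x \<in> P"
  interpret group G by (rule group_G)
  have xG: "x \<in> carrier G" using x P_sub by auto
  have "ord x dvd q\<^sup>2" using ord_dvd_card_subgroup[OF group_G P_subgroup x] card_P by simp
  thus ?thesis using xG by (simp add: pow_eq_id)
qed

lemma pow_coprime_one:
  assumes "group K" "x \<in> carrier K" "x [^]\<^bsub>K\<^esub> (m :: nat) = \<one>\<^bsub>K\<^esub>" "x [^]\<^bsub>K\<^esub> (k :: nat) = \<one>\<^bsub>K\<^esub>" "coprime m k"
  shows "x = \<one>\<^bsub>K\<^esub>"
proof -
  interpret K: group K by fact
  have "K.ord x dvd m" "K.ord x dvd k" using assms by (simp_all add: K.pow_eq_id)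
  hence "K.ord x dvd 1" using assms(5) by (metis coprime_common_divisor)
  thus ?thesis using K.ord_eq_1[OF assms(2)] by simp
qed

lemma field_pow_coprime_one:
  fixes x :: "'k::field"
  assumes "x ^ m = 1" "x ^ k = 1" "coprime m k"
  shows "x = 1"
proof (cases "k = 0 \<or> m = 0")
  case True thus ?thesis using assms by auto
next
  case False
  then obtain a b where "a * m = b * k + 1" using bezout_nat[of m k] assms(3)
    by (metis coprime_imp_gcd_eq_1 mult.commute)
  hence "(x ^ m) ^ a = (x ^ k) ^ b * x" by (metis power_add power_mult power_one_right mult.commute)
  thus ?thesis using assms by simp
qed

lemma mat_vec_pow: "x \<in> carrier G \<Longrightarrow> mat_vec (x [^]\<^bsub>G\<^esub> (k :: nat)) = mat_vec x ^^ k"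
proof (induction k)
  case 0
  interpret group G by (rule group_G)
  show ?case by (simp add: fun_eq_iff mat_vec_one G_simps(2))
next
  case (Suc k)
  interpret group G by (rule group_G)
  show ?case using Suc by (simp add: fun_eq_iff mat_vec_G_mult funpow_swap1)
qed

lemma q2_odd: "odd (q\<^sup>2 + 1)" using q_eq by simp

text \<open>
  Let \<open>R\<close> be a Sylow \<open>p\<close>-subgroup of \<open>H\<close>. If \<open>p\<close> divides \<open>q - 1\<close>, then \<open>R\<close> fixes one of the
  \<open>q^2 + 1 = (q - 1) (q + 1) + 2\<close> points of the ovoid, and then another one, since the number
  \<open>q^2\<close> of remaining points is prime to \<open>p\<close>. The character of the stabilizer of the first point is
  faithful on \<open>R\<close>. Otherwise \<open>R\<close> acts freely on the ovoid and its order divides \<open>q^2 + 1\<close>; an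
  eigenvector of a central element is a common eigenvector of \<open>R\<close> by \<open>commuting_eigenvector\<close>,
  and the corresponding character is faithful by \<open>no_eigenvalue_1\<close>.
\<close>

lemma odd_prime_sylow_cyclic:
  assumes H: "subgroup H G" and p: "prime p" "p \<noteq> 2" "p dvd card H"
  shows "\<exists>x\<in>H. p ^ multiplicity p (card H) dvd group.ord G x"
proof -
  interpret group G by (rule group_G)
  define a where "a = multiplicity p (card H)"
  have finH: "finite H" using H fin_G by (meson finite_subset subgroup.subset)
  have H0: "card H > 0" using H finH by (meson subgroup.finite_imp_card_positive fin_G)
  have a0: "a > 0" using p H0 unfolding a_def by (metis gr0I not_dvd_imp_multiplicity_0 multiplicity_eq_zero_iff not_prime_unit less_irrefl)
  obtain R where R: "subgroup R G" and RH: "R \<subseteq> H" and cR: "card R = p ^ a"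
    using exists_sylow_subgroup_of_subgroup[OF group_G fin_G H p(1)] unfolding a_def by metis
  have RG: "R \<subseteq> carrier G" using subgroup.subset[OF R] .
  have odd_p: "odd p" using p by (metis primes_dvd_imp_eq two_is_prime_nat)
  have q_odd: "coprime p q"
    using odd_p by (simp add: q_eq)
  have pow_R: "x [^]\<^bsub>G\<^esub> (p ^ a) = \<one>\<^bsub>G\<^esub>" if "x \<in> R" for x
    using ord_dvd_card_subgroup[OF group_G R that] cR that RG by (auto simp: pow_eq_id)
  have actR: "acts_on G R act Ovoid" by (rule acts_on_subgroup[OF acts_G R RG])
  have "\<exists>x\<in>R. p ^ a dvd ord x"
  proof (cases "p dvd q - 1")
    case True
    have "\<not> p dvd card Ovoid"
    proof
      assume "p dvd card Ovoid"
      moreover have "q\<^sup>2 + 1 = (q - 1) * (q + 1) + 2" using q_pos by (cases q) (auto simp: power2_eq_square)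
      ultimately have "p dvd 2" using True card_Ovoid by (metis dvd_add_right_iff dvd_mult2)
      thus False using p odd_p by (metis primes_dvd_imp_eq two_is_prime_nat)
    qed
    from p_group_fixed_point[OF actR fin_Ovoid p(1) cR this]
    obtain L where L: "L \<in> Ovoid" "\<And>x. x \<in> R \<Longrightarrow> act x L = L" by auto
    have "acts_on G R act (Ovoid - {L})"
      unfolding acts_on_def
    proof (intro conjI ballI)
      show "act x M \<in> Ovoid - {L}" if "x \<in> R" "M \<in> Ovoid - {L}" for x M
        using that acts_onD(3)[OF actR] L(2) acts_on_inv(1)[OF actR, of x L] acts_on_inv(1)[OF actR, of x M] L(1) by auto
    qed (use acts_onD[OF actR] in auto)
    moreover have "card (Ovoid - {L}) = q\<^sup>2" using L(1) card_Ovoid fin_Ovoid by simp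
    moreover have "\<not> p dvd q\<^sup>2" using q_odd p(1) by (metis coprime_absorb_left not_prime_unit prime_dvd_power)
    ultimately obtain M where M: "M \<in> Ovoid" "M \<noteq> L" "\<And>x. x \<in> R \<Longrightarrow> act x M = M"
      using p_group_fixed_point[of G R act "Ovoid - {L}" p a] fin_Ovoid p(1) cR by auto
    obtain g where g: "g \<in> carrier G" "act g (line inf_pt) = L" using G_trans[OF L(1)] .
    define c where "c x = conj_by G (inv\<^bsub>G\<^esub> g) x" for x
    have c: "c x \<in> Stab_inf" if "x \<in> R" for x
      unfolding c_def using that RG L(2) by (intro conj_by_in_Stab_inf[OF g(1) _ g(2)]) auto
    show ?thesis
    proof (rule exists_element_of_p_power_order[OF R cR p(1), of "\<lambda>x. c x $$ (0, 0)"])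
      show "c (x \<otimes>\<^bsub>G\<^esub> y) $$ (0, 0) = c x $$ (0, 0) * c y $$ (0, 0)" if "x \<in> R" "y \<in> R" for x y
        using chi_mult[OF c c, OF that] that RG g by (simp add: c_def conj_by_mult subset_iff)
      show "c \<one>\<^bsub>G\<^esub> $$ (0, 0) = 1" using g by (simp add: c_def chi_one)
      fix x assume x: "x \<in> R" "c x $$ (0, 0) = 1"
      have cP: "c x \<in> P" using x c by (simp add: P_eq)
      have M': "act (inv\<^bsub>G\<^esub> g) M \<in> Ovoid" using g M act_closed by simp
      have "act g (act (inv\<^bsub>G\<^esub> g) M) = M" by (rule acts_on_inv(2)[OF acts_G g(1) M(1)])
      hence ne: "act (inv\<^bsub>G\<^esub> g) M \<noteq> line inf_pt" using g M(2) by metis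
      have "act (c x) (act (inv\<^bsub>G\<^esub> g) M) = act (inv\<^bsub>G\<^esub> g) M"
        unfolding c_def using x RG g M by (subst act_conj_by) auto
      hence "c x = \<one>\<^bsub>G\<^esub>" using P_free[OF cP M' ne] by simp
      thus "x = \<one>\<^bsub>G\<^esub>" using x RG g unfolding c_def by (subst (asm) conj_by_eq_one) auto
    qed
  next
    case False
    have free: "x = \<one>\<^bsub>G\<^esub>" if x: "x \<in> R" and L: "L \<in> Ovoid" "act x L = L" for x L
    proof -
      obtain g where g: "g \<in> carrier G" "act g (line inf_pt) = L" using G_trans[OF L(1)] .
      let ?y = "conj_by G (inv\<^bsub>G\<^esub> g) x"
      have xG: "x \<in> carrier G" using x RG by auto
      have y: "?y \<in> Stab_inf" using conj_by_in_Stab_inf[OF g(1) xG g(2) L(2)] .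
      have yG: "?y \<in> carrier G" using y P_sub by auto
      have yp: "?y [^]\<^bsub>G\<^esub> (p ^ a) = \<one>\<^bsub>G\<^esub>" using conj_by_pow[of "inv\<^bsub>G\<^esub> g" x "p ^ a"] pow_R[OF x] xG g by simp
      hence "?y $$ (0, 0) ^ (p ^ a) = 1" using chi_pow[OF y, of "p ^ a"] chi_one by simp
      moreover have "?y $$ (0, 0) ^ (q - 1) = 1" using F_unit_power chi_F chi_nonzero y by simp
      moreover have "coprime (p ^ a) (q - 1)" using False p(1) by (simp add: prime_imp_coprime)
      ultimately have "?y $$ (0, 0) = 1" by (rule field_pow_coprime_one)
      hence "?y \<in> P" using y by (simp add: P_eq)
      hence "?y [^]\<^bsub>G\<^esub> q\<^sup>2 = \<one>\<^bsub>G\<^esub>" by (rule P_pow)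
      hence "?y = \<one>\<^bsub>G\<^esub>" using pow_coprime_one[OF group_G yG yp] q_odd by simp
      thus ?thesis using conj_by_eq_one[of "inv\<^bsub>G\<^esub> g" x] xG g by simp
    qed
    have dv: "p ^ a dvd q\<^sup>2 + 1"
      using free_action_card_dvd[OF actR fin_Ovoid free] cR card_Ovoid by simp
    have N: "mat_vec x ^^ (q\<^sup>2 + 1) = id" if x: "x \<in> R" for x
    proof -
      have xG: "x \<in> carrier G" using x RG by auto
      have "ord x dvd q\<^sup>2 + 1" using pow_R[OF x] dv xG by (meson dvd_trans pow_eq_id)
      hence "x [^]\<^bsub>G\<^esub> (q\<^sup>2 + 1) = \<one>\<^bsub>G\<^esub>" using xG pow_eq_id by blast
      thus ?thesis using mat_vec_pow[OF xG, of "q\<^sup>2 + 1"] by (simp add: fun_eq_iff mat_vec_one G_simps(2))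
    qed
    have idG: "x = \<one>\<^bsub>G\<^esub>" if x: "x \<in> carrier G" and i: "mat_vec x = id" for x
      unfolding G_simps(2) using i by (intro mat_vec_inject[OF G_mat(1)[OF x] one_carrier_mat]) (simp add: mat_vec_one)
    have fr: "mat_vec x (frob q v) = frob q (mat_vec x v)" if "x \<in> carrier G" for x v
      using G_mat(2)[OF that] q_eq by (intro mat_vec_frob[of q "2 * n + 1"]) auto
    have q': "q = 2 ^ (2 * n + 1)" "0 < 2 * n + 1" using q_eq by auto
    obtain z where z: "z \<in> R" "z \<noteq> \<one>\<^bsub>G\<^esub>" "\<And>x. x \<in> R \<Longrightarrow> z \<otimes>\<^bsub>G\<^esub> x = x \<otimes>\<^bsub>G\<^esub> z"
      using p_group_center[OF R cR p(1) a0] by blast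
    have zG: "z \<in> carrier G" using z RG by auto
    have "mat_vec z \<noteq> id" using idG[OF zG] z(2) by auto
    from commuting_eigenvector[OF linear_op_mat_vec q' N[OF z(1)] this fr[OF zG]]
    obtain v where v: "v \<noteq> 0" "\<And>S. linear_op S \<Longrightarrow> (\<And>x. S (mat_vec z x) = mat_vec z (S x)) \<Longrightarrow> \<exists>c. S v = c *s v"
      by metis
    have "\<exists>c. mat_vec x v = c *s v" if x: "x \<in> R" for x
    proof (rule v(2)[OF linear_op_mat_vec])
      have "x \<in> carrier G" using x RG by auto
      thus "mat_vec x (mat_vec z y) = mat_vec z (mat_vec x y)" for y using z(3)[OF x] zG by (metis mat_vec_G_mult)
    qed
    then obtain ch where ch: "\<And>x. x \<in> R \<Longrightarrow> mat_vec x v = ch x *s v" by metis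
    have uniq: "c = d" if "c *s v = d *s v" for c d
    proof -
      have "(c - d) *s v = 0" using that by (simp add: vec.scale_left_diff_distrib)
      thus ?thesis using v(1) by simp
    qed
    show ?thesis
    proof (rule exists_element_of_p_power_order[OF R cR p(1), of ch])
      show "ch (x \<otimes>\<^bsub>G\<^esub> y) = ch x * ch y" if xy: "x \<in> R" "y \<in> R" for x y
      proof (rule uniq)
        have xyG: "x \<in> carrier G" "y \<in> carrier G" using xy RG by auto
        have "ch (x \<otimes>\<^bsub>G\<^esub> y) *s v = mat_vec x (mat_vec y v)"
          using ch[OF subgroup.m_closed[OF R xy]] mat_vec_G_mult[OF xyG] by simp
        also have "\<dots> = (ch x * ch y) *s v"
          using ch[OF xy(1)] ch[OF xy(2)] by (simp add: linear_opD[OF linear_op_mat_vec] mult.commute)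
        finally show "ch (x \<otimes>\<^bsub>G\<^esub> y) *s v = (ch x * ch y) *s v" .
      qed
      show "ch \<one>\<^bsub>G\<^esub> = 1"
        using ch[OF subgroup.one_closed[OF R]] by (intro uniq) (simp add: G_simps(2) mat_vec_one)
      fix x assume x: "x \<in> R" "ch x = 1"
      have xG: "x \<in> carrier G" using x RG by auto
      have "mat_vec x = id"
        using no_eigenvalue_1[OF linear_op_mat_vec q' N[OF x(1)] fr[OF xG] _ v(1)] ch[OF x(1)] x(2) by simp
      thus "x = \<one>\<^bsub>G\<^esub>" by (rule idG[OF xG])
    qed
  qed
  thus ?thesis using RH unfolding a_def by blast
qed

section \<open>Sylow 2-subgroups of subgroups that are not 2-groups\<close>

lemma P_elem: "x \<in> P \<Longrightarrow> \<exists>a b. a \<in> F \<and> b \<in> F \<and> x = suz_S n a b" by (auto simp: P_def)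

text \<open>
  The equation says \<open>l^t = l^(-1)\<close>; raising it to the power \<open>t\<close> yields \<open>l^2 = l\<close>.
\<close>

lemma pow_1t_one: "l \<in> F \<Longrightarrow> l ^ (1 + t) = 1 \<Longrightarrow> l = 1"
proof -
  assume l: "l \<in> F" "l ^ (1 + t) = 1"
  have lt: "l * l ^ t = 1" using l(2) by (simp add: power_add)
  hence "l ^ t * (l ^ t) ^ t = 1" using power_mult_distrib[of l "l ^ t" t] by simp
  hence "l ^ t * (l * l) = 1" using pow_t_t[OF l(1)] by (simp add: power2_eq_square)
  hence "(l * l ^ t) * l = 1" by (simp add: mult_ac)
  thus "l = 1" unfolding lt by simp
qed

text \<open>
  The square of \<open>suz_S n a b\<close> is \<open>suz_S n 0 (a^(1+t))\<close>, and \<open>a \<mapsto> a^(1+t)\<close> is injective. If there is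
  only one involution, all elements of order 4 have the same \<open>a\<close>, and they are \<open>g\<close> and its inverse.
\<close>

lemma cyclic_if_unique_involution:
  assumes Q: "subgroup Q G" "Q \<subseteq> P"
    and unique: "\<And>x y. x \<in> Q \<Longrightarrow> y \<in> Q \<Longrightarrow> x \<noteq> \<one>\<^bsub>G\<^esub> \<Longrightarrow> y \<noteq> \<one>\<^bsub>G\<^esub> \<Longrightarrow> x \<otimes>\<^bsub>G\<^esub> x = \<one>\<^bsub>G\<^esub> \<Longrightarrow> y \<otimes>\<^bsub>G\<^esub> y = \<one>\<^bsub>G\<^esub> \<Longrightarrow> x = y"
  shows "\<exists>x\<in>Q. Q = generate G {x}"
proof -
  interpret group G by (rule group_G)
  interpret Q: subgroup Q G by fact
  have genQ: "generate G {x} \<subseteq> Q" if "x \<in> Q" for x using that Q by (intro generate_subgroup_incl) auto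
  have in_gen: "x \<in> generate G {x}" "\<one>\<^bsub>G\<^esub> \<in> generate G {x}" "inv\<^bsub>G\<^esub> x \<in> generate G {x}" "x \<otimes>\<^bsub>G\<^esub> x \<in> generate G {x}" for x
    by (auto intro: generate.intros)
  show ?thesis
  proof (cases "\<exists>g\<in>Q. g \<otimes>\<^bsub>G\<^esub> g \<noteq> \<one>\<^bsub>G\<^esub>")
    case False
    show ?thesis
    proof (cases "Q = {\<one>\<^bsub>G\<^esub>}")
      case True
      thus ?thesis using genQ in_gen(1) by (intro bexI[of _ "\<one>\<^bsub>G\<^esub>"]) blast+
    next
      case ne: False
      then obtain x where x: "x \<in> Q" "x \<noteq> \<one>\<^bsub>G\<^esub>" using Q.one_closed by blast
      have "y \<in> generate G {x}" if "y \<in> Q" for y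
        using unique[OF that x(1) _ x(2)] False that x in_gen[of x] by (cases "y = \<one>\<^bsub>G\<^esub>") auto
      thus ?thesis using genQ[OF x(1)] x(1) by (intro bexI[of _ x]) auto
    qed
  next
    case True
    then obtain g where g: "g \<in> Q" "g \<otimes>\<^bsub>G\<^esub> g \<noteq> \<one>\<^bsub>G\<^esub>" by blast
    have sq: "suz_S n a b \<otimes>\<^bsub>G\<^esub> suz_S n a b = suz_S n 0 (a ^ (1 + t))" if "a \<in> F" "b \<in> F" for a b
      using S_mult[OF that that] by (simp add: char2 power_add mult.commute)
    obtain a0 b0 where g': "a0 \<in> F" "b0 \<in> F" "g = suz_S n a0 b0" using g Q P_elem by blast
    have a0: "a0 \<noteq> 0"
    proof
      assume "a0 = 0"
      hence "g \<otimes>\<^bsub>G\<^esub> g = \<one>\<^bsub>G\<^esub>" using sq[OF g'(1,2)] g'(3) S_00 by simp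
      thus False using g(2) by simp
    qed
    have inv0: "suz_S n 0 b \<otimes>\<^bsub>G\<^esub> suz_S n 0 b = \<one>\<^bsub>G\<^esub>" if "b \<in> F" for b
      using sq[OF F_closed(1) that] S_00 by simp
    have gg: "g \<otimes>\<^bsub>G\<^esub> g \<in> Q" "(g \<otimes>\<^bsub>G\<^esub> g) \<otimes>\<^bsub>G\<^esub> (g \<otimes>\<^bsub>G\<^esub> g) = \<one>\<^bsub>G\<^esub>"
      using Q.m_closed[OF g(1) g(1)] inv0[of "a0 ^ (1 + t)"] sq[OF g'(1,2)] g'(1) unfolding g'(3) by simp_all
    have zero: "x \<in> {\<one>\<^bsub>G\<^esub>, g \<otimes>\<^bsub>G\<^esub> g}" if "x \<in> Q" "x = suz_S n 0 b" "b \<in> F" for x b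
      using unique[OF that(1) gg(1) _ g(2) _ gg(2)] inv0[OF that(3)] that(2) by auto
    have "x \<in> generate G {g}" if x: "x \<in> Q" for x
    proof -
      obtain a b where x': "a \<in> F" "b \<in> F" "x = suz_S n a b" using x Q P_elem by blast
      show ?thesis
      proof (cases "a = 0")
        case True
        thus ?thesis using zero[OF x _ x'(2)] x'(3) in_gen[of g] by auto
      next
        case False
        have xx: "x \<otimes>\<^bsub>G\<^esub> x \<in> {\<one>\<^bsub>G\<^esub>, g \<otimes>\<^bsub>G\<^esub> g}"
          by (rule zero[OF Q.m_closed[OF x x], of "a ^ (1 + t)"]) (use sq[OF x'(1,2)] x' in auto)
        have "suz_S n 0 (a ^ (1 + t)) \<noteq> suz_S n 0 0" using False x'(1) by (subst S_inject) auto
        hence "x \<otimes>\<^bsub>G\<^esub> x \<noteq> \<one>\<^bsub>G\<^esub>" using sq[OF x'(1,2)] x'(3) S_00 by simp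
        hence "suz_S n 0 (a ^ (1 + t)) = suz_S n 0 (a0 ^ (1 + t))"
          using xx sq[OF x'(1,2)] sq[OF g'(1,2)] x'(3) g'(3) by simp
        hence "a ^ (1 + t) = a0 ^ (1 + t)" by (subst (asm) S_inject) auto
        hence "(a / a0) ^ (1 + t) = 1" using a0 by (simp add: power_divide del: power_Suc power_add)
        hence "a / a0 = 1" using pow_1t_one[of "a / a0"] x'(1) g'(1) by auto
        hence aa: "a = a0" using a0 by simp
        have "x \<otimes>\<^bsub>G\<^esub> g = suz_S n 0 (b + b0 + a ^ t * a0)" using S_mult x' g' aa by (simp add: char2)
        hence "x \<otimes>\<^bsub>G\<^esub> g \<in> {\<one>\<^bsub>G\<^esub>, g \<otimes>\<^bsub>G\<^esub> g}" 
          by (intro zero[OF Q.m_closed[OF x g(1)], of "b + b0 + a ^ t * a0"]) (use x' g' in auto)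
        hence "x = inv\<^bsub>G\<^esub> g \<or> x = g" using x g(1) by (auto intro: inv_equality[symmetric])
        thus ?thesis using in_gen[of g] by auto
      qed
    qed
    thus ?thesis using genQ[OF g(1)] g(1) by (intro bexI[of _ g]) auto
  qed
qed

definition invariant_P_subgroups :: "bit alg_closure mat set set" where
  "invariant_P_subgroups = {Q. subgroup Q G \<and> Q \<subseteq> P \<and> (\<exists>k r. k \<in> Stab_inf \<and> act k (line (pt 0 0)) = line (pt 0 0) \<and>
     k \<noteq> \<one>\<^bsub>G\<^esub> \<and> prime r \<and> odd r \<and> k [^]\<^bsub>G\<^esub> (r :: nat) = \<one>\<^bsub>G\<^esub> \<and> conj_by G k ` Q \<subseteq> Q)}"

lemma two_group_in_P:
  assumes Q: "subgroup Q G" "Q \<subseteq> Stab_inf" "card Q = 2 ^ e"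
  shows "Q \<subseteq> P"
proof
  fix x assume x: "x \<in> Q"
  interpret group G by (rule group_G)
  have "x \<in> carrier G" using x Q(1) subgroup.subset by blast
  hence "x [^]\<^bsub>G\<^esub> (2 ^ e :: nat) = \<one>\<^bsub>G\<^esub>"
    using ord_dvd_card_subgroup[OF group_G Q(1) x] Q(3) by (simp add: pow_eq_id)
  hence "x $$ (0, 0) ^ 2 ^ e = 1 ^ 2 ^ e" using chi_pow[of x "2 ^ e"] x Q(2) chi_one by auto
  hence "x $$ (0, 0) = 1" by (rule power2_inj_ac)
  thus "x \<in> P" using x Q(2) by (auto simp: P_eq)
qed

text \<open>
  As \<open>H \<inter> P\<close> is a 2-group, it equals \<open>Q\<close>. Suppose that some element of \<open>H\<close> outside \<open>P\<close> fixes the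
  point at infinity. A power \<open>d\<close> of it has odd prime order and hence fixes a second point, which an
  element of \<open>P\<close> moves to \<open>pt 0 0\<close>. Since \<open>P\<close> is the kernel of a character, \<open>d\<close> normalizes
  \<open>H \<inter> P = Q\<close>. If there is no such element, the stabilizers in \<open>H\<close> of the points in the orbit of
  infinity are the conjugates of \<open>Q\<close>, and \<open>Q\<close> has at most one involution by
  \<open>frobenius_unique_involution\<close>.
\<close>

lemma restricted_at_infinity:
  assumes H: "subgroup H G" and Q: "subgroup Q G" "Q \<subseteq> H" "card Q = 2 ^ multiplicity 2 (card H)" "Q \<subseteq> Stab_inf"
    and ne: "H \<noteq> Q"
  shows "(\<exists>x\<in>carrier G. Q = generate G {x}) \<or> (\<exists>s\<in>carrier G. conj_by G s ` Q \<in> invariant_P_subgroups)"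
proof -
  interpret group G by (rule group_G)
  interpret Q: subgroup Q G by fact
  interpret H: subgroup H G by fact
  have finH: "finite H" using H fin_G by (meson finite_subset subgroup.subset)
  have H0: "card H > 0" using H finH by (meson subgroup.finite_imp_card_positive fin_G)
  have QP: "Q \<subseteq> P" by (rule two_group_in_P[OF Q(1,4,3)])
  have HP: "subgroup (H \<inter> P) G" by (rule subgroups_Inter_pair[OF H P_subgroup])
  have QHP: "Q = H \<inter> P"
  proof (rule card_seteq)
    show "finite (H \<inter> P)" using finH by simp
    show "Q \<subseteq> H \<inter> P" using Q QP by auto
    have "card (H \<inter> P) dvd card P" by (rule card_dvd_of_subgroup_le[OF group_G P_subgroup HP]) auto
    hence "card (H \<inter> P) dvd 2 ^ (2 * (2 * n + 1))" by (simp add: card_P q_eq power_mult[symmetric] mult.commute)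
    then obtain i where i: "card (H \<inter> P) = 2 ^ i" using divides_primepow_nat[OF two_is_prime_nat] by blast
    moreover have "card (H \<inter> P) dvd card H" by (rule card_dvd_of_subgroup_le[OF group_G H HP]) auto
    ultimately have "i \<le> multiplicity 2 (card H)" using H0 by (intro multiplicity_geI) auto
    thus "card (H \<inter> P) \<le> card Q" using i Q(3) by (simp add: power_increasing)
  qed
  show ?thesis
  proof (cases "H \<inter> Stab_inf \<subseteq> P")
    case False
    then obtain c where c: "c \<in> H" "c \<in> Stab_inf" "c \<notin> P" by blast
    have cG: "c \<in> carrier G" using c by auto
    define w where "w = ord c"
    have w_pos: "w > 0" using ord_ge_1[OF fin_G cG] unfolding w_def by simp
    have "\<exists>r. prime r \<and> r \<noteq> 2 \<and> r dvd w"
    proof (rule ccontr)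
      assume no: "\<not> ?thesis"
      then obtain e where "w = 2 ^ e"
        using Ex_other_prime_factor[of w 2] w_pos by (auto simp: in_prime_factors_iff)
      hence "c [^]\<^bsub>G\<^esub> (2 ^ e :: nat) = \<one>\<^bsub>G\<^esub>" using pow_ord_eq_1[OF cG] by (simp add: w_def)
      hence "c $$ (0, 0) ^ 2 ^ e = 1 ^ 2 ^ e" using chi_pow[OF c(2), of "2 ^ e"] chi_one by auto
      hence "c $$ (0, 0) = 1" by (rule power2_inj_ac)
      thus False using c by (simp add: P_eq)
    qed
    then obtain r where r: "prime r" "r \<noteq> 2" "r dvd w" by blast
    have odd_r: "odd r" using r by (metis primes_dvd_imp_eq two_is_prime_nat)
    define d where "d = c [^]\<^bsub>G\<^esub> (w div r)"
    have d: "d \<in> H" "d \<in> Stab_inf" unfolding d_def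
      using c by (auto intro: subgroup_nat_pow[OF group_G H] subgroup_nat_pow[OF group_G Stab_inf_subgroup])
    have dG: "d \<in> carrier G" using d by auto
    have d_r: "d [^]\<^bsub>G\<^esub> r = \<one>\<^bsub>G\<^esub>"
      unfolding d_def using cG r(3) pow_ord_eq_1[OF cG] by (simp add: nat_pow_pow w_def)
    have d1: "d \<noteq> \<one>\<^bsub>G\<^esub>"
    proof
      assume "d = \<one>\<^bsub>G\<^esub>"
      hence "w dvd w div r" using cG by (simp add: d_def w_def pow_eq_id)
      hence "w \<le> w div r" using r w_pos by (intro dvd_imp_le) (auto simp: dvd_div_eq_0_iff)
      thus False using div_less_dividend[OF prime_gt_1_nat[OF r(1)] w_pos] by simp
    qed
    have "\<exists>L\<in>Ovoid - {line inf_pt}. act d L = L"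
    proof (rule ccontr)
      assume no: "\<not> ?thesis"
      have d_inf: "act d (line inf_pt) = line inf_pt" using d by (simp add: Stab_inf_def)
      have it: "(act d ^^ k) L = act (d [^]\<^bsub>G\<^esub> k) L" for k L
        by (induction k arbitrary: L) (simp_all add: act_one act_G_mult dG funpow_Suc_right del: funpow.simps(2))
      have "r dvd card (Ovoid - {line inf_pt})"
      proof (rule prime_dvd_card_of_free[OF _ r(1), of _ "act d"])
        show "act d L \<in> Ovoid - {line inf_pt}" if "L \<in> Ovoid - {line inf_pt}" for L
          using that act_closed[OF dG] acts_on_inv(1)[OF acts_G dG, of L] acts_on_inv(1)[OF acts_G dG Ovoid_mem(1)] d_inf by auto
        show "(act d ^^ r) L = L" for L by (simp add: it d_r act_one)
      qed (use no fin_Ovoid in auto)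
      hence "r dvd q\<^sup>2" using card_Ovoid fin_Ovoid Ovoid_mem(1) by simp
      hence "r dvd 2" using r(1) q_eq by (metis prime_dvd_power)
      thus False using r odd_r by (metis primes_dvd_imp_eq two_is_prime_nat)
    qed
    then obtain L where L: "L \<in> Ovoid" "L \<noteq> line inf_pt" "act d L = L" by auto
    obtain s where s: "s \<in> P" "act s (line (pt 0 0)) = L" using P_trans[OF L(1,2)] .
    have sG: "s \<in> carrier G" "inv\<^bsub>G\<^esub> s \<in> carrier G" "inv\<^bsub>G\<^esub> s \<in> P"
      using s(1) P_sub subgroup.m_inv_closed[OF P_subgroup] by auto
    define k where "k = conj_by G (inv\<^bsub>G\<^esub> s) d"
    have k_inf: "k \<in> Stab_inf" unfolding k_def conj_by_def using sG P_sub d Stab_inf_subgroup s(1)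
      by (intro subgroup.m_closed[OF Stab_inf_subgroup]) auto
    have kG: "k \<in> carrier G" using k_inf P_sub by auto
    have s_inv: "act (inv\<^bsub>G\<^esub> s) L = line (pt 0 0)"
      using acts_on_inv(1)[OF acts_G sG(1) Ovoid_mem(2)[of 0 0]] s(2) by simp
    have k0: "act k (line (pt 0 0)) = line (pt 0 0)"
      using act_conj_by[OF sG(2) dG L(1)] s_inv L(3) by (simp add: k_def)
    have k1: "k \<noteq> \<one>\<^bsub>G\<^esub>" using d1 conj_by_eq_one[OF sG(2) dG] by (simp add: k_def)
    have kr: "k [^]\<^bsub>G\<^esub> r = \<one>\<^bsub>G\<^esub>" using conj_by_pow[OF sG(2) dG, of r] d_r sG by (simp add: k_def)
    have dQ: "conj_by G d x \<in> Q" if x: "x \<in> Q" for x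
    proof -
      have "conj_by G d x \<in> H" using x d Q by (auto simp: conj_by_def)
      moreover have xI: "x \<in> Stab_inf" "x $$ (0, 0) = 1" using x QP by (auto simp: P_eq)
      have id: "inv\<^bsub>G\<^esub> d \<in> Stab_inf" using d subgroup.m_inv_closed[OF Stab_inf_subgroup] by auto
      have dx: "d \<otimes>\<^bsub>G\<^esub> x \<in> Stab_inf" using d xI subgroup.m_closed[OF Stab_inf_subgroup] by auto
      have "conj_by G d x \<in> Stab_inf" unfolding conj_by_def using dx id by (rule subgroup.m_closed[OF Stab_inf_subgroup])
      moreover have "conj_by G d x $$ (0, 0) = d $$ (0, 0) * x $$ (0, 0) * (inv\<^bsub>G\<^esub> d) $$ (0, 0)"
        unfolding conj_by_def by (simp only: chi_mult[OF dx id] chi_mult[OF d(2) xI(1)])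
      moreover have "d $$ (0, 0) * (inv\<^bsub>G\<^esub> d) $$ (0, 0) = 1"
        using chi_mult[OF d(2) id] chi_one dG by simp
      ultimately show ?thesis unfolding QHP using xI by (simp add: P_eq)
    qed
    have "conj_by G (inv\<^bsub>G\<^esub> s) ` Q \<in> invariant_P_subgroups"
      unfolding invariant_P_subgroups_def
    proof (intro CollectI conjI exI[of _ k] exI[of _ r])
      show "subgroup (conj_by G (inv\<^bsub>G\<^esub> s) ` Q) G" using sG Q by (intro conj_by_subgroup) auto
      show "conj_by G (inv\<^bsub>G\<^esub> s) ` Q \<subseteq> P"
        using QP sG s(1) by (auto simp: conj_by_def intro!: subgroup.m_closed[OF P_subgroup])
      show "conj_by G k ` conj_by G (inv\<^bsub>G\<^esub> s) ` Q \<subseteq> conj_by G (inv\<^bsub>G\<^esub> s) ` Q"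
      proof clarify
        fix x assume x: "x \<in> Q"
        have xG: "x \<in> carrier G" using x by auto
        have "k \<otimes>\<^bsub>G\<^esub> inv\<^bsub>G\<^esub> s = inv\<^bsub>G\<^esub> s \<otimes>\<^bsub>G\<^esub> d" using sG dG by (simp add: k_def conj_by_def m_assoc)
        hence "conj_by G k (conj_by G (inv\<^bsub>G\<^esub> s) x) = conj_by G (inv\<^bsub>G\<^esub> s) (conj_by G d x)"
          using conj_by_conj_by[OF kG sG(2) xG] conj_by_conj_by[OF sG(2) dG xG] by simp
        thus "conj_by G k (conj_by G (inv\<^bsub>G\<^esub> s) x) \<in> conj_by G (inv\<^bsub>G\<^esub> s) ` Q" using dQ[OF x] by blast
      qed
    qed (use k_inf k0 k1 kr r odd_r in auto)
    thus ?thesis using sG by blast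
  next
    case True
    have HQ: "H \<inter> Stab_inf = Q" using True QHP Q by blast
    define U where "U = (\<lambda>x. act x (line inf_pt)) ` H"
    have UO: "U \<subseteq> Ovoid" unfolding U_def using act_closed[OF _ Ovoid_mem(1)] by auto
    have finU: "finite U" using finH by (simp add: U_def)
    have inf_U: "line inf_pt \<in> U" unfolding U_def using H.one_closed act_one by (metis image_eqI)
    have actHO: "acts_on G H act Ovoid" by (rule acts_on_subgroup[OF acts_G H]) auto
    have actH: "acts_on G H act U"
      unfolding acts_on_def
    proof (intro conjI ballI)
      show "act x y \<in> U" if xy: "x \<in> H" "y \<in> U" for x y
      proof -
        obtain z where z: "z \<in> H" "y = act z (line inf_pt)" using xy(2) unfolding U_def by blast
        hence "act x y = act (x \<otimes>\<^bsub>G\<^esub> z) (line inf_pt)" using xy(1) by (simp add: act_G_mult)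
        moreover have "x \<otimes>\<^bsub>G\<^esub> z \<in> H" using xy(1) z(1) by simp
        ultimately show ?thesis unfolding U_def by blast
      qed
    qed (use acts_onD[OF actHO] UO in auto)
    have "\<exists>x\<in>Q. Q = generate G {x}"
    proof (rule cyclic_if_unique_involution[OF Q(1) QP])
      fix x y assume x: "x \<in> Q" "x \<noteq> \<one>\<^bsub>G\<^esub>" "x \<otimes>\<^bsub>G\<^esub> x = \<one>\<^bsub>G\<^esub>" and y: "y \<in> Q" "y \<noteq> \<one>\<^bsub>G\<^esub>" "y \<otimes>\<^bsub>G\<^esub> y = \<one>\<^bsub>G\<^esub>"
      show "x = y"
      proof (rule frobenius_unique_involution[OF actH finU finH inf_U])
        show "\<exists>g\<in>H. act g (line inf_pt) = L" if "L \<in> U" for L using that by (auto simp: U_def)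
        show "card U > 1"
        proof (rule ccontr)
          assume "\<not> card U > 1"
          moreover have "card U > 0" using inf_U finU by (auto simp: card_gt_0_iff)
          ultimately have "card U = 1" by simp
          hence "U = {line inf_pt}" using inf_U by (metis card_1_singletonE singletonD)
          hence "H \<subseteq> Stab_inf" using H.subset by (auto simp: Stab_inf_def U_def)
          thus False using HQ ne by auto
        qed
        show "L = M" if g: "g \<in> H" "g \<noteq> \<one>\<^bsub>G\<^esub>" and LM: "L \<in> U" "M \<in> U" "act g L = L" "act g M = M" for g L M
        proof -
          have gG: "g \<in> carrier G" using g by auto
          obtain k where k: "k \<in> H" "act k (line inf_pt) = L" using LM(1) unfolding U_def by blast
          have kG: "k \<in> carrier G" "inv\<^bsub>G\<^esub> k \<in> carrier G" using k by auto
          let ?g = "conj_by G (inv\<^bsub>G\<^esub> k) g"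
          have "?g \<in> Stab_inf" by (rule conj_by_in_Stab_inf[OF kG(1) gG k(2) LM(3)])
          moreover have "?g \<in> H" using k g by (auto simp: conj_by_def)
          ultimately have gP: "?g \<in> P" using True by blast
          have MO: "M \<in> Ovoid" using LM UO by auto
          have "act ?g (act (inv\<^bsub>G\<^esub> k) M) = act (inv\<^bsub>G\<^esub> k) M" using act_conj_by[OF kG(2) gG MO] LM by simp
          moreover have "?g \<noteq> \<one>\<^bsub>G\<^esub>" using conj_by_eq_one[OF kG(2) gG] g by simp
          ultimately have "act (inv\<^bsub>G\<^esub> k) M = line inf_pt" using P_free[OF gP act_closed[OF kG(2) MO]] by blast
          hence "M = act k (line inf_pt)" using acts_on_inv(2)[OF acts_G kG(1) MO] by simp
          thus ?thesis using k by simp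
        qed
      qed (use x y Q QP in \<open>auto simp: P_eq Stab_inf_def\<close>)
    qed
    thus ?thesis using Q.subset by blast
  qed
qed

text \<open>
  The number of points of the ovoid is odd, so \<open>Q\<close> fixes one, which may be moved to infinity.
\<close>

lemma restricted_sylow:
  assumes H: "subgroup H G" and Q: "subgroup Q G" "Q \<subseteq> H" "card Q = 2 ^ multiplicity 2 (card H)"
    and ne: "H \<noteq> Q"
  shows "(\<exists>x\<in>carrier G. Q = generate G {x}) \<or> (\<exists>s\<in>carrier G. conj_by G s ` Q \<in> invariant_P_subgroups)"
proof -
  interpret group G by (rule group_G)
  have HG: "H \<subseteq> carrier G" and QG: "Q \<subseteq> carrier G" using H Q subgroup.subset by blast+
  have "acts_on G Q act Ovoid" by (rule acts_on_subgroup[OF acts_G Q(1) QG])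
  moreover have "\<not> 2 dvd card Ovoid" using card_Ovoid q2_odd by simp
  ultimately obtain L where L: "L \<in> Ovoid" "\<forall>x\<in>Q. act x L = L"
    using p_group_fixed_point[OF _ fin_Ovoid two_is_prime_nat Q(3)] by blast
  obtain g where g: "g \<in> carrier G" "act g (line inf_pt) = L" using G_trans[OF L(1)] .
  have ig: "inv\<^bsub>G\<^esub> g \<in> carrier G" using g by simp
  let ?c = "conj_by G (inv\<^bsub>G\<^esub> g)"
  have "(\<exists>x\<in>carrier G. ?c ` Q = generate G {x}) \<or> (\<exists>s\<in>carrier G. conj_by G s ` ?c ` Q \<in> invariant_P_subgroups)"
  proof (rule restricted_at_infinity)
    show "subgroup (?c ` H) G" "subgroup (?c ` Q) G" using ig H Q by (auto intro: conj_by_subgroup)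
    show "?c ` Q \<subseteq> ?c ` H" using Q by auto
    show "card (?c ` Q) = 2 ^ multiplicity 2 (card (?c ` H))" using card_conj_by[OF ig] HG QG Q by simp
    show "?c ` Q \<subseteq> Stab_inf" using L(2) QG by (intro image_subsetI conj_by_in_Stab_inf[OF g(1) _ g(2)]) auto
    show "?c ` H \<noteq> ?c ` Q" using ne conj_by_image_inv(2)[OF g(1)] HG QG by metis
  qed
  thus ?thesis
  proof
    assume "\<exists>x\<in>carrier G. ?c ` Q = generate G {x}"
    then obtain x where x: "x \<in> carrier G" "?c ` Q = generate G {x}" by blast
    have "Q = conj_by G g ` ?c ` Q" using conj_by_image_inv(2)[OF g(1) QG] by simp
    also have "\<dots> = generate G {conj_by G g x}" unfolding x(2) by (rule conj_by_generate[OF g(1) x(1)])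
    finally show ?thesis using g x by blast
  next
    assume "\<exists>s\<in>carrier G. conj_by G s ` ?c ` Q \<in> invariant_P_subgroups"
    then obtain s where s: "s \<in> carrier G" "conj_by G s ` ?c ` Q \<in> invariant_P_subgroups" by blast
    have "conj_by G s ` ?c ` Q = conj_by G (s \<otimes>\<^bsub>G\<^esub> inv\<^bsub>G\<^esub> g) ` Q"
      unfolding image_image using s ig QG by (intro image_cong) (auto simp: conj_by_conj_by)
    thus ?thesis using s ig by auto
  qed
qed

end

section \<open>Subgroups of P normalized by an element of odd prime order\<close>

text \<open>
  The number \<open>2^(2n+1) - 1\<close> is prime to 3 and to 5, and \<open>2^e - 1\<close> is 1, 3, 7 or 15 for \<open>e \<le> 4\<close>.
\<close>

lemma small_exponents:
  fixes r e n :: nat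
  assumes r: "prime r" "r dvd 2 ^ (2 * n + 1) - 1" "r dvd 2 ^ e - 1" and e: "e > 0"
  shows "3 \<le> e" "r = 7 \<or> 5 \<le> e"
proof -
  have step: "4 ^ Suc k mod s = 4 * (4 ^ k mod s) mod (s::nat)" for k s by (simp add: mod_mult_right_eq)
  have four3: "4 ^ k mod 3 = (1::nat)" for k by (induction k) (simp_all only: step, simp_all)
  have four5: "4 ^ k mod 5 = (1::nat) \<or> 4 ^ k mod 5 = (4::nat)" for k
    by (induction k) (auto simp only: step, auto)
  note four = four3[of n] four5[of n]
  have two: "2 ^ (2 * n + 1) = 2 * (4 ^ n :: nat)" by (simp add: power_mult)
  obtain c where "2 ^ (2 * n + 1) - 1 = r * c" using r(2) by (auto elim: dvdE)
  hence c: "2 * 4 ^ n = r * c + (1::nat)" unfolding two by (metis Suc_eq_plus1 Suc_diff_1 mult_pos_pos zero_less_numeral zero_less_power)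
  have "r \<noteq> 3"
  proof
    assume "r = 3"
    hence "2 * 4 ^ n mod 3 = (1::nat)" using c by simp
    moreover have "2 * 4 ^ n mod 3 = 2 * (4 ^ n mod 3) mod (3::nat)" by (simp add: mod_mult_right_eq)
    ultimately show False using four(1) by simp
  qed
  have "r \<noteq> 5"
  proof
    assume "r = 5"
    hence "2 * 4 ^ n mod 5 = (1::nat)" using c by simp
    moreover have "2 * 4 ^ n mod 5 = 2 * (4 ^ n mod 5) mod (5::nat)" by (simp add: mod_mult_right_eq)
    ultimately show False using four(2) by auto
  qed
  have prim: "r = s" if "r dvd s" "prime s" for s using that r(1) primes_dvd_imp_eq by blast
  have p: "prime (3::nat)" "prime (5::nat)" "prime (7::nat)" by simp_all
  have "e \<noteq> 1" using r(1,3) not_prime_1 by auto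
  moreover have "e \<noteq> 2" using r(3) prim[OF _ p(1)] \<open>r \<noteq> 3\<close> by auto
  moreover have "e = 3 \<Longrightarrow> r = 7" using r(3) prim[OF _ p(3)] by auto
  moreover have "e \<noteq> 4"
  proof
    assume "e = 4"
    hence "r dvd 3 * 5" using r(3) by simp
    hence "r dvd 3 \<or> r dvd 5" using r(1) by (simp only: prime_dvd_mult_iff)
    thus False using prim[OF _ p(1)] prim[OF _ p(2)] \<open>r \<noteq> 3\<close> \<open>r \<noteq> 5\<close> by auto
  qed
  ultimately show "3 \<le> e" "r = 7 \<or> 5 \<le> e" using e by (linarith, linarith)
qed

context suzuki
begin

lemma zero_pow_t [simp]: "0 ^ t = (0 :: bit alg_closure)" by (simp add: zero_power)

text \<open>
  The subgroups of \<open>P\<close> in the coordinates of \<open>suz_S\<close>; see \<open>S_mult\<close>.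
\<close>

definition closed_pairs :: "(bit alg_closure \<times> bit alg_closure) set \<Rightarrow> bool" where
  "closed_pairs D \<longleftrightarrow> D \<subseteq> F \<times> F \<and> (0, 0) \<in> D \<and>
     (\<forall>a b c d. (a, b) \<in> D \<longrightarrow> (c, d) \<in> D \<longrightarrow> (a + c, b + d + a ^ t * c) \<in> D)"

definition stable :: "bit alg_closure \<Rightarrow> bit alg_closure \<Rightarrow> (bit alg_closure \<times> bit alg_closure) set \<Rightarrow> bool" where
  "stable l m D \<longleftrightarrow> (\<forall>a b. (a, b) \<in> D \<longrightarrow> (l * a, m * b) \<in> D)"

lemma closed_pairsD:
  assumes "closed_pairs D"
  shows "D \<subseteq> F \<times> F" "(0, 0) \<in> D" "(a, b) \<in> D \<Longrightarrow> (c, d) \<in> D \<Longrightarrow> (a + c, b + d + a ^ t * c) \<in> D"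
    "(a, b) \<in> D \<Longrightarrow> a \<in> F" "(a, b) \<in> D \<Longrightarrow> b \<in> F" "finite D"
  using assms fin_F unfolding closed_pairs_def by (auto intro: finite_subset)

definition pairs_subgroup where "pairs_subgroup D = (\<lambda>(a, b). suz_S n a b) ` D"

lemma pairs_subgroup:
  assumes D: "closed_pairs D"
  shows "subgroup (pairs_subgroup D) G" "pairs_subgroup D \<subseteq> P" "card (pairs_subgroup D) = card D" "\<exists>i. card D = 2 ^ i"
proof -
  interpret group G by (rule group_G)
  note D' = closed_pairsD[OF D]
  have "suz_S n a b \<in> P" if "(a, b) \<in> D" for a b using D'(4,5)[OF that] by (auto simp: P_def)
  thus P: "pairs_subgroup D \<subseteq> P" by (auto simp: pairs_subgroup_def)
  show S: "subgroup (pairs_subgroup D) G"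
  proof (rule subgroupI)
    show "pairs_subgroup D \<subseteq> carrier G" using P P_sub by auto
    show "pairs_subgroup D \<noteq> {}" using D'(2) by (auto simp: pairs_subgroup_def)
    show "x \<otimes>\<^bsub>G\<^esub> y \<in> pairs_subgroup D" if xy: "x \<in> pairs_subgroup D" "y \<in> pairs_subgroup D" for x y
    proof -
      obtain a b c d where *: "(a, b) \<in> D" "x = suz_S n a b" "(c, d) \<in> D" "y = suz_S n c d"
        using xy by (auto simp: pairs_subgroup_def)
      show ?thesis using D'(3)[OF *(1,3)] S_mult[OF D'(4,5)[OF *(1)] D'(4,5)[OF *(3)]] *
        by (force simp: pairs_subgroup_def)
    qed
    show "inv\<^bsub>G\<^esub> x \<in> pairs_subgroup D" if x: "x \<in> pairs_subgroup D" for x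
    proof -
      obtain a b where *: "(a, b) \<in> D" "x = suz_S n a b" using x by (auto simp: pairs_subgroup_def)
      have ab: "a \<in> F" "b \<in> F" using D' * by auto
      have "(0, a ^ t * a) \<in> D" using D'(3)[OF *(1,1)] by (simp add: char2)
      hence i: "(a, a ^ t * a + b) \<in> D" using D'(3)[OF _ *(1), of 0 "a ^ t * a"] by simp
      have "suz_S n a (a ^ t * a + b) \<otimes>\<^bsub>G\<^esub> suz_S n a b = \<one>\<^bsub>G\<^esub>"
        using S_mult[of a "a ^ t * a + b" a b] ab S_00 by (simp add: add_ac char2)
      hence "inv\<^bsub>G\<^esub> x = suz_S n a (a ^ t * a + b)"
        using S_in_G[OF ab] S_in_G[of a "a ^ t * a + b"] ab unfolding *(2) by (intro inv_equality) auto
      thus ?thesis using i by (force simp: pairs_subgroup_def)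
    qed
  qed
  have "inj_on (\<lambda>(a, b). suz_S n a b) D" using D' by (auto simp: inj_on_def S_inject)
  thus c: "card (pairs_subgroup D) = card D" unfolding pairs_subgroup_def by (rule card_image)
  have "card D dvd card P" using card_dvd_of_subgroup_le[OF group_G P_subgroup S P] c by simp
  hence "card D dvd 2 ^ (2 * (2 * n + 1))" by (simp add: card_P q_eq power_mult[symmetric] mult.commute)
  thus "\<exists>i. card D = 2 ^ i" using divides_primepow_nat[OF two_is_prime_nat] by blast
qed

text \<open>
  The map \<open>(a, b) \<mapsto> (l a, m b)\<close> of order \<open>r\<close> acts freely on \<open>D' - D\<close>, so \<open>r\<close> divides
  \<open>card D' - card D\<close>, where both cardinalities are powers of 2.
\<close>

lemma stable_jump:
  assumes D: "closed_pairs D" "closed_pairs D'" "D \<subset> D'" "stable l m D" "stable l m D'"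
    and r: "prime r" "l ^ r = 1" "m ^ r = 1" "l \<noteq> 1" "m \<noteq> 1" and rq: "r dvd q - 1"
  shows "8 * card D \<le> card D'" "r \<noteq> 7 \<Longrightarrow> 32 * card D \<le> card D'"
proof -
  note D1 = closed_pairsD[OF D(1)] and D2 = closed_pairsD[OF D(2)]
  obtain i j where ij: "card D = 2 ^ i" "card D' = 2 ^ j" using pairs_subgroup(4) D by meson
  define f where "f = (\<lambda>(a, b). (l * a, m * b))"
  have fk: "(f ^^ k) (a, b) = (l ^ k * a, m ^ k * b)" for k a b
    by (induction k) (auto simp: f_def)
  have st: "f x \<in> D" if "x \<in> D" for x using that D(4) by (cases x) (simp add: f_def stable_def)
  have stk: "(f ^^ k) x \<in> D" if "x \<in> D" for x k using that by (induction k) (auto intro: st)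
  have "r dvd card (D' - D)"
  proof (rule prime_dvd_card_of_free[OF _ r(1), of _ f])
    show "finite (D' - D)" using D2 by simp
    show fr: "(f ^^ r) x = x" for x using r by (cases x) (simp add: fk)
    show "f x \<in> D' - D" if x: "x \<in> D' - D" for x
    proof -
      have "f x \<in> D'" using x D(5) by (cases x) (simp add: f_def stable_def)
      moreover have "f x \<notin> D"
      proof
        assume "f x \<in> D"
        hence "(f ^^ (r - 1)) (f x) \<in> D" by (rule stk)
        moreover have "(f ^^ (r - 1)) (f x) = (f ^^ r) x" using prime_gt_0_nat[OF r(1)]
          by (metis Suc_diff_1 comp_apply funpow_Suc_right)
        ultimately show False using fr x by simp
      qed
      ultimately show ?thesis by simp
    qed
    show "f x \<noteq> x" if x: "x \<in> D' - D" for x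
    proof
      assume e: "f x = x"
      obtain a b where ab: "x = (a, b)" by (cases x)
      have "(l - 1) * a = 0" "(m - 1) * b = 0" using e unfolding ab f_def by (auto simp: algebra_simps)
      hence "a = 0" "b = 0" using r by auto
      thus False using x ab D1(2) by simp
    qed
  qed
  hence "r dvd 2 ^ j - 2 ^ i" using D1 D(3) ij by (simp add: card_Diff_subset psubset_imp_subset)
  moreover have "i < j" using psubset_card_mono[OF D2(6) D(3)] ij by simp
  hence "2 ^ j - 2 ^ i = 2 ^ i * (2 ^ (j - i) - (1::nat))"
    by (simp add: diff_mult_distrib2 power_add[symmetric])
  moreover have "\<not> r dvd 2 ^ i"
  proof
    assume "r dvd 2 ^ i"
    hence "r dvd 2" using r(1) by (metis prime_dvd_power)
    hence "r = 2" using r(1) by (metis primes_dvd_imp_eq two_is_prime_nat)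
    thus False using rq q_eq by (simp add: even_diff_nat)
  qed
  ultimately have "r dvd 2 ^ (j - i) - 1" using r(1) by (simp add: prime_dvd_mult_iff)
  from small_exponents[OF r(1) _ this, of n] rq q_eq \<open>i < j\<close>
  have e: "3 \<le> j - i" "r = 7 \<or> 5 \<le> j - i" by auto
  have "2 ^ j = 2 ^ (j - i) * (2::nat) ^ i" using \<open>i < j\<close> by (simp flip: power_add)
  moreover have "(2::nat) ^ 3 \<le> 2 ^ (j - i)" using e by (intro power_increasing) auto
  moreover have "(2::nat) ^ 5 \<le> 2 ^ (j - i)" if "r \<noteq> 7" using e that by (intro power_increasing) auto
  ultimately show "8 * card D \<le> card D'" "r \<noteq> 7 \<Longrightarrow> 32 * card D \<le> card D'"
    unfolding ij by (auto intro!: mult_right_mono)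
qed

definition stable_pairs where "stable_pairs l m = {D. closed_pairs D \<and> stable l m D}"

text \<open>
  The additive counterpart of \<open>stable_pairs\<close>, for the centre of \<open>P\<close> and for the quotient by it.
\<close>

definition stable_sums where
  "stable_sums m = {A. A \<subseteq> F \<and> 0 \<in> A \<and> (\<forall>x\<in>A. \<forall>y\<in>A. x + y \<in> A) \<and> (\<forall>x\<in>A. m * x \<in> A)}"

lemma card_stable_pairs:
  assumes r: "prime r" "l ^ r = 1" "m ^ r = 1" "l \<noteq> 1" "m \<noteq> 1" "r dvd q - 1" "r \<noteq> 7"
    and E: "(4 * n + 8)\<^sup>2 \<le> 20 * E"
  shows "card (stable_pairs l m) \<le> (4 * n + 3) * 2 ^ E"
proof -
  have "card (stable_pairs l m) \<le> (4 * n + 2 + 1) * 2 ^ E"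
  proof (rule card_closed_family_le[where d = 5 and U = "F \<times> F"])
    have "card (F \<times> F) = q * q" by (simp only: card_cartesian_product card_F)
    also have "\<dots> = 2 ^ (2 * n + 1 + (2 * n + 1))" unfolding q_eq by (rule power_add[symmetric])
    also have "2 * n + 1 + (2 * n + 1) = 4 * n + 2" by simp
    finally show "card (F \<times> F) \<le> 2 ^ (4 * n + 2)" by simp
    show "finite (F \<times> F)" "stable_pairs l m \<subseteq> Pow (F \<times> F)" "{} \<notin> stable_pairs l m"
      using fin_F by (auto simp: stable_pairs_def closed_pairs_def)
    show "A \<inter> B \<in> stable_pairs l m" if "A \<in> stable_pairs l m" "B \<in> stable_pairs l m" for A B
      using that by (auto simp: stable_pairs_def closed_pairs_def stable_def)
    show "2 ^ 5 * card A \<le> card B" if "A \<in> stable_pairs l m" "B \<in> stable_pairs l m" "A \<subset> B" for A B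
      using stable_jump(2)[of A B l m r] that r by (auto simp: stable_pairs_def)
  qed (use E in \<open>auto simp: add.commute\<close>)
  moreover have "4 * n + 2 + 1 = 4 * n + 3" by simp
  ultimately show ?thesis by (simp only:)
qed

lemma card_stable_sums:
  assumes r: "prime r" "m ^ r = 1" "m \<noteq> 1" "r dvd q - 1"
    and E: "(2 * n + 5)\<^sup>2 \<le> 12 * E"
  shows "card (stable_sums m) \<le> (2 * n + 2) * 2 ^ E"
proof -
  have "card (stable_sums m) \<le> (2 * n + 1 + 1) * 2 ^ E"
  proof (rule card_closed_family_le[where d = 3 and U = F])
    show "card F \<le> 2 ^ (2 * n + 1)" using card_F q_eq by simp
    show "finite F" "stable_sums m \<subseteq> Pow F" "{} \<notin> stable_sums m"
      using fin_F by (auto simp: stable_sums_def)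
    show "A \<inter> B \<in> stable_sums m" if "A \<in> stable_sums m" "B \<in> stable_sums m" for A B
      using that by (auto simp: stable_sums_def)
    have *: "closed_pairs ({0} \<times> A)" "stable m m ({0} \<times> A)" if "A \<in> stable_sums m" for A
      using that by (auto simp: stable_sums_def closed_pairs_def stable_def zero_power)
    show "2 ^ 3 * card A \<le> card B" if AB: "A \<in> stable_sums m" "B \<in> stable_sums m" "A \<subset> B" for A B
    proof -
      have "{0 :: bit alg_closure} \<times> A \<subset> {0} \<times> B" using AB(3) by auto
      from stable_jump(1)[OF *(1)[OF AB(1)] *(1)[OF AB(2)] this *(2)[OF AB(1)] *(2)[OF AB(2)] r(1,2,2,3,3,4)]
      show ?thesis by (simp add: card_cartesian_product)
    qed
  qed (use E in \<open>auto simp: add.commute\<close>)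
  moreover have "2 * n + 1 + 1 = 2 * n + 2" by simp
  ultimately show ?thesis by (simp only:)
qed

text \<open>
  If 7 divides \<open>2^(2n+1) - 1\<close>, then \<open>n\<close> is congruent to 1 modulo 3, and \<open>t\<close> to 4 modulo 7.
\<close>

lemma order_7_powers:
  fixes l :: "bit alg_closure"
  assumes "7 dvd q - 1" "l ^ 7 = 1"
  shows "l ^ t = l ^ 4"
proof -
  define k j where "k = n div 3" and "j = n mod 3"
  have n: "n = 3 * k + j" "j < 3" by (simp_all add: k_def j_def)
  have c8: "[8 ^ k = 1] (mod (7::nat))" "[64 ^ k = 1] (mod (7::nat))"
    using cong_pow[of "8::nat" 1 7 k] cong_pow[of "64::nat" 1 7 k] by (auto simp: cong_def)
  have "2 * n + 1 = 6 * k + (2 * j + 1)" using n(1) by simp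
  hence "q = 2 ^ (6 * k) * 2 ^ (2 * j + 1)" unfolding suz_q_def by (simp only: power_add)
  also have "(2 :: nat) ^ (6 * k) = 64 ^ k" by (simp add: power_mult)
  finally have "q = 64 ^ k * 2 ^ (2 * j + 1)" .
  hence "[q = 1 * 2 ^ (2 * j + 1)] (mod 7)" using cong_mult[OF c8(2) cong_refl] by simp
  moreover have "[q = 1] (mod 7)" using assms(1) q_pos by (simp add: cong_altdef_nat cong_sym_eq)
  ultimately have "[2 ^ (2 * j + 1) = 1] (mod (7 :: nat))" by (metis cong_sym cong_trans mult_1)
  moreover have "j = 0 \<or> j = 1 \<or> j = 2" using n(2) by auto
  ultimately have j: "j = 1" by (auto simp: cong_def)
  have "n + 1 = 3 * k + 2" using n(1) j by simp
  hence "t = 2 ^ (3 * k) * 2 ^ 2" unfolding suz_theta_def by (simp only: power_add)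
  also have "(2 :: nat) ^ (3 * k) = 8 ^ k" by (simp add: power_mult)
  finally have "t = 8 ^ k * 4" by simp
  hence "[t = 1 * 4] (mod 7)" using cong_mult[OF c8(1) cong_refl] by simp
  hence "t mod 7 = 4" by (simp add: cong_def)
  hence "t = 7 * (t div 7) + 4" by (metis mult_div_mod_eq)
  hence "l ^ t = l ^ (7 * (t div 7) + 4)" by (rule arg_cong)
  also have "\<dots> = (l ^ 7) ^ (t div 7) * l ^ 4" by (simp only: power_add power_mult)
  finally have "l ^ t = (l ^ 7) ^ (t div 7) * l ^ 4" .
  thus ?thesis using assms(2) by simp
qed

text \<open>
  For \<open>r = 7\<close> the jumps by a factor 8 alone would give too weak a bound. But now \<open>l\<close> and
  \<open>m = l^(1+t) = l^5\<close> are roots of different irreducible factors of \<open>x^7 - 1\<close> over the field with two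
  elements, so the actions on the centre of \<open>P\<close> and on the quotient have no common constituent,
  and a stable subgroup is determined by its intersection with the centre and by its image in the
  quotient. Explicitly, let \<open>R\<close> be the additive group of differences of two subgroups over the same
  first coordinate and \<open>c = (l, m)\<close>. Then \<open>c + c^2 + c^4\<close> acts on \<open>R\<close> as \<open>(s, 1 + s)\<close> with
  \<open>s = l + l^2 + l^4\<close>, which is 0 or 1. In either case \<open>R\<close> contains \<open>(0, d)\<close> along with \<open>(a, d)\<close>.
\<close>

lemma stable_pairs_7_subset:
  assumes l: "l ^ 7 = 1" "l \<noteq> 1" "7 dvd q - 1"
    and D: "D \<in> stable_pairs l (l ^ (1 + t))" "D' \<in> stable_pairs l (l ^ (1 + t))"
    and same: "\<And>b. (0, b) \<in> D \<longleftrightarrow> (0, b) \<in> D'" "\<And>a. (\<exists>b. (a, b) \<in> D) \<longleftrightarrow> (\<exists>b. (a, b) \<in> D')"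
  shows "D \<subseteq> D'"
proof clarify
  fix a y assume ay: "(a, y) \<in> D"
  define m where "m = l ^ (1 + t)"
  have m: "m = l ^ 5" using order_7_powers[OF l(3,1)] by (simp add: m_def eval_nat_numeral)
  have cl: "closed_pairs D" "closed_pairs D'" and st: "stable l m D" "stable l m D'"
    using D by (auto simp: stable_pairs_def m_def)
  define R where "R = {(a, d). \<exists>y. (a, y) \<in> D \<and> (a, y + d) \<in> D'}"
  have R_add: "(a + c, d + e) \<in> R" if ac: "(a, d) \<in> R" "(c, e) \<in> R" for a c d e
  proof -
    obtain y z where yz: "(a, y) \<in> D" "(a, y + d) \<in> D'" "(c, z) \<in> D" "(c, z + e) \<in> D'"
      using ac by (auto simp: R_def)
    have "(a + c, y + z + a ^ t * c) \<in> D" by (rule closed_pairsD(3)[OF cl(1) yz(1,3)])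
    moreover have "(a + c, (y + d) + (z + e) + a ^ t * c) \<in> D'" by (rule closed_pairsD(3)[OF cl(2) yz(2,4)])
    moreover have "(y + d) + (z + e) + a ^ t * c = (y + z + a ^ t * c) + (d + e)" by (simp add: add_ac)
    ultimately show ?thesis by (auto simp: R_def)
  qed
  have R_st: "(l * a, m * d) \<in> R" if "(a, d) \<in> R" for a d
    using that st by (force simp: R_def stable_def distrib_left)
  obtain y' where y': "(a, y') \<in> D'" using same(2) ay by blast
  define d where "d = y + y'"
  have "(a, y + d) \<in> D'" using y' by (simp add: d_def char2)
  hence ad: "(a, d) \<in> R" using ay by (auto simp: R_def)
  note R1 = R_st[OF ad]
  note R2 = R_st[OF R1]
  note R4 = R_st[OF R_st[OF R2]]
  define s where "s = l + l ^ 2 + l ^ 4"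
  have "s ^ 2 = l ^ 2 + l ^ 4 + l ^ 7 * l"
    unfolding s_def by (simp add: power2_sum two_eq_0_ac eval_nat_numeral algebra_simps)
  hence "s * (s - 1) = 0" using l(1) by (simp add: s_def power2_eq_square algebra_simps)
  hence s01: "s = 0 \<or> s = 1" by auto
  have "(l - 1) * (1 + l + l ^ 2 + l ^ 3 + l ^ 4 + l ^ 5 + l ^ 6) = l ^ 7 - 1"
    by (simp add: eval_nat_numeral algebra_simps)
  hence "1 + l + l ^ 2 + l ^ 3 + l ^ 4 + l ^ 5 + l ^ 6 = 0" using l by simp
  hence "(1 + s) + (l ^ 3 + l ^ 5 + l ^ 6) = 0" by (simp add: s_def add_ac)
  hence s': "l ^ 3 + l ^ 5 + l ^ 6 = 1 + s" by (simp add: add_eq_0_iff_ac)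
  have "m ^ 2 = l ^ 7 * l ^ 3" "m ^ 4 = l ^ 7 * l ^ 7 * l ^ 6" unfolding m by (simp_all flip: power_mult power_add)
  hence ms: "m + m ^ 2 + m ^ 4 = 1 + s" using s' l(1) m by (simp add: add_ac)
  have "(l * a + l * (l * a) + l * (l * (l * (l * a))), m * d + m * (m * d) + m * (m * (m * (m * d)))) \<in> R"
    by (intro R_add R1 R2 R4)
  moreover have "l * a + l * (l * a) + l * (l * (l * (l * a))) = s * a"
    by (simp add: s_def eval_nat_numeral algebra_simps)
  moreover have "m * d + m * (m * d) + m * (m * (m * (m * d))) = (m + m ^ 2 + m ^ 4) * d"
    by (simp add: eval_nat_numeral algebra_simps)
  ultimately have "(s * a, (1 + s) * d) \<in> R" using ms by simp
  hence "(0, d) \<in> R" using s01 R_add[OF ad, of a 0] by (auto simp: char2)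
  then obtain z where z: "(0, z) \<in> D" "(0, z + d) \<in> D'" by (auto simp: R_def)
  have "(0, z) \<in> D'" using z(1) same(1) by simp
  hence "(0, d) \<in> D'" using closed_pairsD(3)[OF cl(2) _ z(2), of 0 z] by (simp add: char2)
  from closed_pairsD(3)[OF cl(2) y' this] have "(a, y' + d) \<in> D'" by simp
  thus "(a, y) \<in> D'" by (simp add: d_def char2 add.commute)
qed

lemma card_stable_pairs_7:
  assumes l: "l ^ 7 = 1" "l \<noteq> 1" "l \<in> F" "7 dvd q - 1"
    and E: "(2 * n + 5)\<^sup>2 \<le> 12 * E"
  shows "card (stable_pairs l (l ^ (1 + t))) \<le> ((2 * n + 2) * 2 ^ E)\<^sup>2"
proof -
  define m where "m = l ^ (1 + t)"
  have "m ^ 7 = (l ^ 7) ^ (1 + t)" unfolding m_def by (simp only: power_mult[symmetric] mult.commute)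
  moreover have "m \<noteq> 1" using l(2) pow_1t_one[OF l(3)] unfolding m_def by blast
  ultimately have m: "m ^ 7 = 1" "m \<noteq> 1" using l(1) by simp_all
  \<comment> \<open>intersection with the centre of \<open>P\<close>, and image in the quotient by it\<close>
  define f where "f = (\<lambda>D. ({b. (0 :: bit alg_closure, b :: bit alg_closure) \<in> D}, {a :: bit alg_closure. \<exists>b :: bit alg_closure. (a, b) \<in> D}))"
  have inj: "inj_on f (stable_pairs l m)"
  proof (rule inj_onI)
    fix D D' assume *: "D \<in> stable_pairs l m" "D' \<in> stable_pairs l m" "f D = f D'"
    have e: "(0, b) \<in> D \<longleftrightarrow> (0, b) \<in> D'" "(\<exists>b. (a, b) \<in> D) \<longleftrightarrow> (\<exists>b. (a, b) \<in> D')" for a b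
      using *(3) by (auto simp: f_def set_eq_iff)
    show "D = D'" using * e l
      by (intro equalityI stable_pairs_7_subset[OF l(1,2,4)]) (auto simp: m_def)
  qed
  have img: "f ` stable_pairs l m \<subseteq> stable_sums m \<times> stable_sums l"
  proof (rule image_subsetI)
    fix D assume D: "D \<in> stable_pairs l m"
    hence cl: "closed_pairs D" and st: "stable l m D" by (auto simp: stable_pairs_def)
    note D' = closed_pairsD[OF cl]
    have "{b. (0, b) \<in> D} \<in> stable_sums m"
      using D'(2,5) D'(3)[of 0 _ 0] st by (force simp: stable_sums_def stable_def)
    moreover have "{a. \<exists>b. (a, b) \<in> D} \<in> stable_sums l"
      using D'(2,4) D'(3) st unfolding stable_sums_def stable_def by blast
    ultimately show "f D \<in> stable_sums m \<times> stable_sums l" by (simp add: f_def)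
  qed
  have fin: "finite (stable_sums k)" for k
    by (rule finite_subset[of _ "Pow F"]) (use fin_F in \<open>auto simp: stable_sums_def\<close>)
  have "card (stable_pairs l m) \<le> card (stable_sums m \<times> stable_sums l)"
    using fin by (intro card_inj_on_le[OF inj img]) auto
  also have "\<dots> \<le> ((2 * n + 2) * 2 ^ E) * ((2 * n + 2) * 2 ^ E)"
    unfolding card_cartesian_product
    using card_stable_sums[of 7 m E] card_stable_sums[of 7 l E] m l E by (intro mult_mono) auto
  finally show ?thesis by (simp add: m_def power2_eq_square)
qed

definition coords where "coords Q = {(a, b). a \<in> F \<and> b \<in> F \<and> suz_S n a b \<in> Q}"

lemma pairs_subgroup_coords: "Q \<subseteq> P \<Longrightarrow> pairs_subgroup (coords Q) = Q"
proof
  show "pairs_subgroup (coords Q) \<subseteq> Q" by (auto simp: pairs_subgroup_def coords_def)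
  assume Q: "Q \<subseteq> P"
  show "Q \<subseteq> pairs_subgroup (coords Q)"
  proof
    fix x assume x: "x \<in> Q"
    then obtain a b where "a \<in> F" "b \<in> F" "x = suz_S n a b" using Q P_elem by blast
    thus "x \<in> pairs_subgroup (coords Q)" using x by (force simp: pairs_subgroup_def coords_def)
  qed
qed

lemma closed_pairs_coords:
  assumes "subgroup Q G"
  shows "closed_pairs (coords Q)"
  unfolding closed_pairs_def
proof (intro conjI allI impI)
  show "coords Q \<subseteq> F \<times> F" by (auto simp: coords_def)
  show "(0, 0) \<in> coords Q" using S_00 subgroup.one_closed[OF assms] by (simp add: coords_def)
  fix a b c d assume "(a, b) \<in> coords Q" "(c, d) \<in> coords Q"
  hence *: "a \<in> F" "b \<in> F" "c \<in> F" "d \<in> F" "suz_S n a b \<in> Q" "suz_S n c d \<in> Q" by (auto simp: coords_def)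
  have "suz_S n (a + c) (b + d + a ^ t * c) \<in> Q"
    using subgroup.m_closed[OF assms *(5,6)] S_mult[OF *(1-4)] by simp
  thus "(a + c, b + d + a ^ t * c) \<in> coords Q" using *(1-4) by (auto simp: coords_def)
qed

text \<open>
  The conjugate belongs to \<open>P\<close>, so it suffices to follow the point \<open>pt 0 0\<close>.
\<close>

lemma stabilizer_conjugation:
  assumes k: "k \<in> Stab_inf" "act k (line (pt 0 0)) = line (pt 0 0)"
  obtains l where "l \<in> F" "l \<noteq> 0" "l = 1 \<Longrightarrow> k = \<one>\<^bsub>G\<^esub>"
    "\<And>r. k [^]\<^bsub>G\<^esub> (r :: nat) = \<one>\<^bsub>G\<^esub> \<Longrightarrow> l ^ r = 1"
    "\<And>a b. a \<in> F \<Longrightarrow> b \<in> F \<Longrightarrow> conj_by G k (suz_S n a b) = suz_S n (l * a) (l ^ (1 + t) * b)"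
proof -
  interpret group G by (rule group_G)
  have kG: "k \<in> carrier G" "act k (line inf_pt) = line inf_pt" using k by (auto simp: Stab_inf_def)
  obtain l where l: "l \<in> F" "l \<noteq> 0" "l ^ (2 + t) * k $$ (0, 0) ^ 2 = 1"
    "\<And>x y z w. mat_vec k (V4 x y z w) = k $$ (0, 0) *s V4 x (l * y) (l ^ (1 + t) * z) (l ^ (2 + t) * w)"
    using two_point_stabilizer[OF kG k(2)] by metis
  have k00: "k $$ (0, 0) \<noteq> 0" by (rule chi_nonzero[OF k(1)])
  have act_k: "act k (line (pt a b)) = line (pt (l * a) (l ^ (1 + t) * b))" for a b
    unfolding act_line pt_def l(4) line_scale[OF k00] by (simp only: ov_scale[OF l(1)])
  show thesis
  proof (rule that[OF l(1,2)])
    show "k = \<one>\<^bsub>G\<^esub>" if "l = 1"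
    proof -
      have "k $$ (0, 0) ^ 2 ^ 1 = 1 ^ 2 ^ 1" using l(3) that by simp
      hence "k $$ (0, 0) = 1" by (rule power2_inj_ac)
      hence "k \<in> P" using k(1) by (simp add: P_eq)
      thus ?thesis using P_free[OF _ Ovoid_mem(2) _ k(2)] line_pt_ne_inf by simp
    qed
    show "l ^ r = 1" if "k [^]\<^bsub>G\<^esub> r = \<one>\<^bsub>G\<^esub>" for r :: nat
    proof -
      have "\<exists>b. act (k [^]\<^bsub>G\<^esub> r) (line (pt 1 1)) = line (pt (l ^ r) b)" for r :: nat
      proof (induction r)
        case (Suc r)
        then obtain b where "act (k [^]\<^bsub>G\<^esub> r) (line (pt 1 1)) = line (pt (l ^ r) b)" by blast
        hence "act (k \<otimes>\<^bsub>G\<^esub> k [^]\<^bsub>G\<^esub> r) (line (pt 1 1)) = line (pt (l ^ Suc r) (l ^ (1 + t) * b))"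
          using kG(1) by (simp add: act_G_mult act_k del: power_Suc add_Suc) simp
        thus ?case unfolding nat_pow_Suc2[OF kG(1)] by blast
      qed (auto simp: act_one)
      from this[of r] that show ?thesis by (auto simp: act_one line_pt_eq)
    qed
    fix a b assume ab: "a \<in> F" "b \<in> F"
    let ?s = "suz_S n a b"
    have s: "?s \<in> carrier G" "?s \<in> P" using S_in_G ab by (auto simp: P_def)
    have i: "inv\<^bsub>G\<^esub> k \<in> Stab_inf" using k subgroup.m_inv_closed[OF Stab_inf_subgroup] by simp
    have sI: "?s \<in> Stab_inf" "?s $$ (0, 0) = 1" using s(2) P_eq by auto
    have ks: "k \<otimes>\<^bsub>G\<^esub> ?s \<in> Stab_inf" by (rule subgroup.m_closed[OF Stab_inf_subgroup k(1) sI(1)])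
    have "conj_by G k ?s $$ (0, 0) = k $$ (0, 0) * 1 * (inv\<^bsub>G\<^esub> k) $$ (0, 0)"
      unfolding conj_by_def by (simp only: chi_mult[OF ks i] chi_mult[OF k(1) sI(1)] sI(2))
    also have "\<dots> = 1" using chi_mult[OF k(1) i] chi_one kG by simp
    finally have "conj_by G k ?s \<in> P" using subgroup.m_closed[OF Stab_inf_subgroup ks i] by (simp add: P_eq conj_by_def)
    then obtain x y where xy: "x \<in> F" "y \<in> F" "conj_by G k ?s = suz_S n x y" using P_elem by blast
    have "act (conj_by G k ?s) (act k (line (pt 0 0))) = act k (act ?s (line (pt 0 0)))"
      by (rule act_conj_by[OF kG(1) s(1)]) (simp add: Ovoid_mem)
    hence "line (pt x y) = line (pt (l * a) (l ^ (1 + t) * b))"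
      unfolding k(2) xy(3) act_S_pt[OF xy(1)] act_S_pt[OF ab(1)] act_k by simp
    thus "conj_by G k ?s = suz_S n (l * a) (l ^ (1 + t) * b)" unfolding xy(3) line_pt_eq by simp
  qed
qed

lemma prime_order_dvd:
  fixes l :: "bit alg_closure"
  assumes "l \<in> F" "l \<noteq> 0" "l \<noteq> 1" "prime r" "l ^ r = 1"
  shows "r dvd q - 1"
proof (rule ccontr)
  assume "\<not> r dvd q - 1"
  hence "coprime r (q - 1)" using assms(4) by (rule prime_imp_coprime[rotated])
  thus False using field_pow_coprime_one[OF assms(5) F_unit_power[OF assms(1,2)]] assms(3) by simp
qed

lemma card_invariant_P_subgroups:
  assumes E: "(4 * n + 8)\<^sup>2 \<le> 20 * E" "(2 * n + 5)\<^sup>2 \<le> 12 * E'"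
  shows "card invariant_P_subgroups \<le> q * ((4 * n + 3) * 2 ^ E + ((2 * n + 2) * 2 ^ E')\<^sup>2)"
    and "finite invariant_P_subgroups"
proof -
  let ?N = "(4 * n + 3) * 2 ^ E + ((2 * n + 2) * 2 ^ E')\<^sup>2"
  define L where "L = {l \<in> F. l \<noteq> 0 \<and> l \<noteq> 1 \<and> (\<exists>r. prime (r :: nat) \<and> l ^ r = 1)}"
  have finL: "finite L" "card L \<le> q" using fin_F card_F card_mono[of F L] by (auto simp: L_def)
  have inj: "inj_on coords invariant_P_subgroups"
    by (rule inj_on_inverseI[of _ pairs_subgroup]) (simp add: pairs_subgroup_coords invariant_P_subgroups_def)
  have sub: "coords ` invariant_P_subgroups \<subseteq> (\<Union>l\<in>L. stable_pairs l (l ^ (1 + t)))"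
  proof (rule image_subsetI)
    fix Q assume "Q \<in> invariant_P_subgroups"
    then obtain k r where Q: "subgroup Q G" "Q \<subseteq> P" and k: "k \<in> Stab_inf" "act k (line (pt 0 0)) = line (pt 0 0)"
      "k \<noteq> \<one>\<^bsub>G\<^esub>" "prime r" "k [^]\<^bsub>G\<^esub> (r :: nat) = \<one>\<^bsub>G\<^esub>" "conj_by G k ` Q \<subseteq> Q"
      unfolding invariant_P_subgroups_def by blast
    obtain l where l: "l \<in> F" "l \<noteq> 0" "l = 1 \<Longrightarrow> k = \<one>\<^bsub>G\<^esub>"
      "\<And>r. k [^]\<^bsub>G\<^esub> (r :: nat) = \<one>\<^bsub>G\<^esub> \<Longrightarrow> l ^ r = 1"
      "\<And>a b. a \<in> F \<Longrightarrow> b \<in> F \<Longrightarrow> conj_by G k (suz_S n a b) = suz_S n (l * a) (l ^ (1 + t) * b)"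
      using stabilizer_conjugation[OF k(1,2)] by metis
    have "stable l (l ^ (1 + t)) (coords Q)"
      unfolding stable_def
    proof (intro allI impI)
      fix a b assume "(a, b) \<in> coords Q"
      hence ab: "a \<in> F" "b \<in> F" "suz_S n a b \<in> Q" by (auto simp: coords_def)
      have "suz_S n (l * a) (l ^ (1 + t) * b) \<in> Q" using k(6) ab(3) unfolding l(5)[OF ab(1,2), symmetric] by blast
      moreover have "l * a \<in> F" "l ^ (1 + t) * b \<in> F"
        using l(1) ab by (simp_all only: F_closed)
      ultimately show "(l * a, l ^ (1 + t) * b) \<in> coords Q" by (simp add: coords_def)
    qed
    hence "coords Q \<in> stable_pairs l (l ^ (1 + t))" using closed_pairs_coords[OF Q(1)] by (simp add: stable_pairs_def)
    moreover have "l \<in> L" using l(1,2,3) l(4)[OF k(5)] k(3,4) by (auto simp: L_def)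
    ultimately show "coords Q \<in> (\<Union>l\<in>L. stable_pairs l (l ^ (1 + t)))" by blast
  qed
  have fin: "finite (stable_pairs l m)" for l m
    by (rule finite_subset[of _ "Pow (F \<times> F)"]) (use fin_F in \<open>auto simp: stable_pairs_def closed_pairs_def\<close>)
  have N: "card (stable_pairs l (l ^ (1 + t))) \<le> ?N" if lL: "l \<in> L" for l
  proof -
    obtain r where l: "l \<in> F" "l \<noteq> 0" "l \<noteq> 1" "prime (r :: nat)" "l ^ r = 1" using lL by (auto simp: L_def)
    have rq: "r dvd q - 1" by (rule prime_order_dvd[OF l])
    show ?thesis
    proof (cases "r = 7")
      case True
      have "card (stable_pairs l (l ^ (1 + t))) \<le> ((2 * n + 2) * 2 ^ E')\<^sup>2"
        using l rq True by (intro card_stable_pairs_7 E) auto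
      thus ?thesis by simp
    next
      case False
      have "(l ^ (1 + t)) ^ r = (l ^ r) ^ (1 + t)" by (simp only: power_mult[symmetric] mult.commute)
      hence "(l ^ (1 + t)) ^ r = 1" using l(5) by simp
      moreover have "l ^ (1 + t) \<noteq> 1" using pow_1t_one[OF l(1)] l(3) by blast
      ultimately have "card (stable_pairs l (l ^ (1 + t))) \<le> (4 * n + 3) * 2 ^ E"
        using card_stable_pairs[OF l(4,5) _ l(3) _ rq False E(1)] by blast
      thus ?thesis by simp
    qed
  qed
  have finU: "finite (\<Union>l\<in>L. stable_pairs l (l ^ (1 + t)))" using finL fin by auto
  show "finite invariant_P_subgroups" using inj sub finU by (metis inj_on_finite)
  have "card invariant_P_subgroups \<le> card (\<Union>l\<in>L. stable_pairs l (l ^ (1 + t)))"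
    by (rule card_inj_on_le[OF inj sub finU])
  also have "\<dots> \<le> (\<Sum>l\<in>L. card (stable_pairs l (l ^ (1 + t))))" by (rule card_UN_le[OF finL(1)])
  also have "\<dots> \<le> (\<Sum>l\<in>L. ?N)" by (intro sum_mono N)
  also have "\<dots> \<le> q * ?N" using finL(2) by simp
  finally show "card invariant_P_subgroups \<le> q * ?N" .
qed

section \<open>Counting subgroups\<close>

definition two_subgroups where
  "two_subgroups = {H \<in> all_subgroups G. finite_p_group 2 (G\<lparr>carrier := H\<rparr>)}"

definition other_subgroups where
  "other_subgroups = {H \<in> all_subgroups G. \<not> finite_p_group 2 (G\<lparr>carrier := H\<rparr>)}"

lemma finite_p_group_iff:
  assumes "subgroup H G"
  shows "finite_p_group 2 (G\<lparr>carrier := H\<rparr>) \<longleftrightarrow> (\<exists>k. card H = 2 ^ k)"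
  using group.subgroup_imp_group[OF group_G assms] by (simp add: finite_p_group_def Coset.order_def)

lemma finite_all_subgroups: "finite (all_subgroups G)"
  by (rule finite_subset[of _ "Pow (carrier G)"]) (use fin_G in \<open>auto simp: all_subgroups_def dest: subgroup.subset\<close>)

text \<open>
  The factor in front bounds the number of possible Sylow 2-subgroups, the power the number of ways
  to choose one generator for each odd prime.
\<close>

lemma card_other_subgroups:
  assumes w: "w = card (prime_factors (card (carrier G)))"
    and inv: "card invariant_P_subgroups \<le> N" "finite invariant_P_subgroups"
  shows "card other_subgroups \<le> card (carrier G) * (N + 1) * card (carrier G) ^ w"
proof -
  interpret group G by (rule group_G)
  define \<Q>1 where "\<Q>1 = (\<lambda>x. generate G {x}) ` carrier G"
  define \<Q>2 where "\<Q>2 = (\<lambda>(g, Q). conj_by G g ` Q) ` (carrier G \<times> invariant_P_subgroups)"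
  have fin: "finite \<Q>1" "finite \<Q>2" using fin_G inv by (auto simp: \<Q>1_def \<Q>2_def)
  have "card other_subgroups \<le> card (\<Q>1 \<union> \<Q>2) * card (carrier G) ^ w"
  proof (rule card_generated_le[OF fin_G])
    show "finite (\<Q>1 \<union> \<Q>2)" using fin by simp
    fix H assume "H \<in> other_subgroups"
    hence H: "subgroup H G" "\<nexists>k. card H = 2 ^ k"
      using finite_p_group_iff by (auto simp: other_subgroups_def all_subgroups_def)
    obtain Q where Q: "subgroup Q G" and QH: "Q \<subseteq> H" and cQ: "card Q = 2 ^ multiplicity 2 (card H)"
      using exists_sylow_subgroup_of_subgroup[OF group_G fin_G H(1) two_is_prime_nat] .
    have QG: "Q \<subseteq> carrier G" using subgroup.subset[OF Q] .
    have "H \<noteq> Q" using H(2) cQ by auto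
    from restricted_sylow[OF H(1) Q QH cQ this] have "Q \<in> \<Q>1 \<union> \<Q>2"
    proof
      assume "\<exists>s\<in>carrier G. conj_by G s ` Q \<in> invariant_P_subgroups"
      then obtain s where s: "s \<in> carrier G" "conj_by G s ` Q \<in> invariant_P_subgroups" by blast
      have "Q = conj_by G (inv\<^bsub>G\<^esub> s) ` conj_by G s ` Q" using conj_by_image_inv(1)[OF s(1) QG] by simp
      hence "Q = (\<lambda>(g, Q). conj_by G g ` Q) (inv\<^bsub>G\<^esub> s, conj_by G s ` Q)" by simp
      hence "Q \<in> \<Q>2" unfolding \<Q>2_def by (rule image_eqI) (use s in auto)
      thus ?thesis by simp
    qed (auto simp: \<Q>1_def)
    moreover obtain xs where "set xs \<subseteq> carrier G" "length xs = w" "generate G (Q \<union> set xs) = H"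
      using exists_short_generating_list[OF group_G fin_G H(1) Q QH cQ odd_prime_sylow_cyclic[OF H(1)], of w] w by auto
    ultimately show "\<exists>Q\<in>\<Q>1 \<union> \<Q>2. \<exists>xs. set xs \<subseteq> carrier G \<and> length xs = w \<and> generate G (Q \<union> set xs) = H"
      by blast
  qed
  also have "card (\<Q>1 \<union> \<Q>2) \<le> card \<Q>1 + card \<Q>2" by (rule card_Un_le)
  also have "card \<Q>1 \<le> card (carrier G)" unfolding \<Q>1_def by (rule card_image_le[OF fin_G])
  also have "card \<Q>2 \<le> card (carrier G \<times> invariant_P_subgroups)"
    unfolding \<Q>2_def by (rule card_image_le) (use fin_G inv in auto)
  also have "\<dots> \<le> card (carrier G) * N" using inv by (simp add: card_cartesian_product)
  finally show ?thesis by (simp add: algebra_simps)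
qed

text \<open>
  In characteristic 2 the sums of sublists form an additive subgroup.
\<close>

primrec list_span :: "bit alg_closure list \<Rightarrow> bit alg_closure set" where
  "list_span [] = {0}"
| "list_span (x # xs) = list_span xs \<union> (+) x ` list_span xs"

lemma list_span_0: "0 \<in> list_span xs"
  by (induction xs) auto

lemma list_span_set: "set xs \<subseteq> list_span xs"
  by (induction xs) (use list_span_0 in force)+

lemma list_span_F: "set xs \<subseteq> F \<Longrightarrow> list_span xs \<subseteq> F"
  by (induction xs) auto

lemma card_list_span: "card (list_span xs) \<le> 2 ^ length xs" "finite (list_span xs)"
proof (induction xs)
  case (Cons x xs)
  show "finite (list_span (x # xs))" using Cons by simp
  have "card (list_span (x # xs)) \<le> card (list_span xs) + card ((+) x ` list_span xs)"
    using card_Un_le by auto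
  also have "card ((+) x ` list_span xs) \<le> card (list_span xs)" using Cons by (intro card_image_le)
  finally show "card (list_span (x # xs)) \<le> 2 ^ length (x # xs)" using Cons by simp
qed auto

lemma list_span_add: "y \<in> list_span xs \<Longrightarrow> z \<in> list_span xs \<Longrightarrow> y + z \<in> list_span xs"
proof (induction xs arbitrary: y z)
  case (Cons x xs)
  obtain u where u: "u \<in> list_span xs" "y = u \<or> y = x + u" using Cons.prems(1) by auto
  obtain v where v: "v \<in> list_span xs" "z = v \<or> z = x + v" using Cons.prems(2) by auto
  have "x + u + (x + v) = u + v" by (simp add: add_ac char2)
  hence "y + z = u + v \<or> y + z = x + (u + v)" using u(2) v(2) by (auto simp: add_ac)
  thus ?case using Cons.IH[OF u(1) v(1)] by auto
qed simp

text \<open>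
  Each of the \<open>q^n\<close> lists of \<open>n\<close> elements of \<open>F\<close> lies in its span, an additive subgroup with at most
  \<open>2^n\<close> elements, which accommodates at most \<open>2^(n n)\<close> such lists. So there are at least
  \<open>2^(n^2 + n)\<close> spans, and each corresponds to a subgroup of the centre of \<open>P\<close>.
\<close>

lemma card_two_subgroups: "2 ^ (n * n + n) \<le> card two_subgroups"
proof -
  let ?Lists = "{xs. set xs \<subseteq> F \<and> length xs = n}"
  define \<A> where "\<A> = list_span ` ?Lists"
  have finL: "finite ?Lists" by (rule finite_lists_length_eq[OF fin_F])
  have finA: "finite \<A>" unfolding \<A>_def using finL by simp
  have A: "A \<subseteq> F" "closed_pairs ({0} \<times> A)" "card A \<le> 2 ^ n" "finite A" if "A \<in> \<A>" for A
  proof -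
    obtain xs where xs: "set xs \<subseteq> F" "length xs = n" "A = list_span xs" using \<open>A \<in> \<A>\<close> by (auto simp: \<A>_def)
    show AF: "A \<subseteq> F" using list_span_F xs by simp
    show "card A \<le> 2 ^ n" "finite A" using card_list_span[of xs] xs by auto
    show "closed_pairs ({0} \<times> A)" unfolding closed_pairs_def
      using AF list_span_0 list_span_add xs(3) by auto
  qed
  have "?Lists \<subseteq> (\<Union>A\<in>\<A>. {xs. set xs \<subseteq> A \<and> length xs = n})"
    using list_span_set by (auto simp: \<A>_def)
  hence "card ?Lists \<le> card (\<Union>A\<in>\<A>. {xs. set xs \<subseteq> A \<and> length xs = n})"
    using finA A by (intro card_mono) (auto intro: finite_lists_length_eq)
  also have "\<dots> \<le> (\<Sum>A\<in>\<A>. card {xs. set xs \<subseteq> A \<and> length xs = n})" by (rule card_UN_le[OF finA])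
  also have "\<dots> \<le> (\<Sum>A\<in>\<A>. (2 ^ n) ^ n)"
    using A by (intro sum_mono) (auto simp: card_lists_length_eq intro: power_mono)
  also have "\<dots> = card \<A> * 2 ^ (n * n)" by (simp add: power_mult)
  also have "card ?Lists = q ^ n" by (simp add: card_lists_length_eq[OF fin_F] card_F)
  also have "q ^ n = 2 ^ ((2 * n + 1) * n)" by (simp only: q_eq power_mult)
  also have "(2 * n + 1) * n = (n * n + n) + n * n" by (simp add: algebra_simps)
  finally have "2 ^ (n * n + n) \<le> card \<A>" by (simp add: power_add)
  also have "card \<A> \<le> card two_subgroups"
  proof (rule card_inj_on_le)
    show "finite two_subgroups" using finite_all_subgroups by (simp add: two_subgroups_def)
    show "(\<lambda>A. pairs_subgroup ({0} \<times> A)) ` \<A> \<subseteq> two_subgroups"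
      using pairs_subgroup A(2) finite_p_group_iff unfolding two_subgroups_def all_subgroups_def by force
    show "inj_on (\<lambda>A. pairs_subgroup ({0} \<times> A)) \<A>"
    proof (rule inj_on_inverseI[of _ "\<lambda>Q. {b \<in> F. suz_S n 0 b \<in> Q}"])
      fix A assume "A \<in> \<A>"
      hence AF: "A \<subseteq> F" by (rule A)
      thus "{b \<in> F. suz_S n 0 b \<in> pairs_subgroup ({0} \<times> A)} = A"
        by (auto simp: pairs_subgroup_def S_inject)
    qed
  qed
  finally show ?thesis .
qed

end

section \<open>The limit\<close>

text \<open>
  The left-hand side is \<open>(4/5 + 4/100) n^2 + O(n)\<close>: the choice of \<open>w\<close> elements from a group of order at
  most \<open>2^(16 m)\<close>, where \<open>m = 2 n + 1\<close>, contributes about \<open>256 m^2 / L\<close> to the exponent, and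
  \<open>25600 = 100 * 256\<close>.
\<close>

lemma exponent_estimate:
  fixes C L :: nat
  assumes L: "25600 \<le> L"
  shows "\<exists>n0. \<forall>n\<ge>n0. \<forall>w. L * w \<le> L * C + 16 * (2 * n + 1) \<longrightarrow>
    2 + 16 * (2 * n + 1) * (w + 1) + (2 * n + 1) + (4 * n\<^sup>2 + 30 * n + 50) div 5 \<le> n\<^sup>2"
proof (intro exI allI impI)
  fix n w :: nat
  assume n: "48 * (8 * C) + 2000 \<le> n" and w: "L * w \<le> L * C + 16 * (2 * n + 1)"
  define x where "x = real n"
  have x: "x \<ge> 384 * real C + 2000" using n unfolding x_def by simp
  have w': "real w \<le> real C + (2 * x + 1) / 1600"
  proof -
    have "real (L * w) \<le> real (L * C + 16 * (2 * n + 1))" using w by (rule of_nat_mono)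
    hence "real L * (real w - real C) \<le> 16 * (2 * x + 1)" by (simp add: x_def algebra_simps)
    also have "\<dots> = 25600 * ((2 * x + 1) / 1600)" by simp
    also have "\<dots> \<le> real L * ((2 * x + 1) / 1600)" using L x by (intro mult_right_mono) auto
    finally have "real w - real C \<le> (2 * x + 1) / 1600" using L by (simp only: mult_le_cancel_left_pos of_nat_0_less_iff)
    thus ?thesis by linarith
  qed
  have div: "real ((4 * n\<^sup>2 + 30 * n + 50) div 5) \<le> (4 * x\<^sup>2 + 30 * x + 50) / 5"
    using of_nat_div_le_of_nat[of "4 * n\<^sup>2 + 30 * n + 50" 5] by (simp add: x_def)
  have "16 * (2 * x + 1) * (real w + 1) \<le> 16 * (2 * x + 1) * (real C + (2 * x + 1) / 1600 + 1)"
    using w' x by (intro mult_left_mono) auto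
  also have "\<dots> = (2 * x + 1)\<^sup>2 / 100 + 16 * (2 * x + 1) * (real C + 1)"
    by (simp add: field_simps power2_eq_square)
  also have "\<dots> \<le> (2 * x + 1)\<^sup>2 / 100 + 48 * x * (real C + 1)"
    using x by (intro add_left_mono mult_right_mono) auto
  finally have A: "16 * (2 * x + 1) * (real w + 1) \<le> (2 * x + 1)\<^sup>2 / 100 + 48 * x * (real C + 1)" .
  define y z where "y = x * x" and "z = real C * x"
  have "384 * real C * x \<le> x * x" using x by (intro mult_right_mono) auto
  hence z: "384 * z \<le> y" by (simp add: y_def z_def mult.assoc)
  have y: "2000 * x \<le> y" unfolding y_def using x by (intro mult_right_mono) auto
  have e: "(2 * x + 1)\<^sup>2 = 4 * y + 4 * x + 1" "x\<^sup>2 = y" "48 * x * (real C + 1) = 48 * z + 48 * x"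
    by (simp_all add: power2_eq_square algebra_simps y_def z_def)
  have "2 + ((2 * x + 1)\<^sup>2 / 100 + 48 * x * (real C + 1)) + (2 * x + 1) + (4 * x\<^sup>2 + 30 * x + 50) / 5 \<le> x\<^sup>2"
    unfolding e using x y z by (simp add: field_simps)
  with A div have "2 + 16 * (2 * x + 1) * (real w + 1) + (2 * x + 1) + real ((4 * n\<^sup>2 + 30 * n + 50) div 5) \<le> x\<^sup>2"
    by linarith
  also have "2 + 16 * (2 * x + 1) * (real w + 1) + (2 * x + 1) + real ((4 * n\<^sup>2 + 30 * n + 50) div 5) =
    real (2 + 16 * (2 * n + 1) * (w + 1) + (2 * n + 1) + (4 * n\<^sup>2 + 30 * n + 50) div 5)"
    by (simp add: x_def algebra_simps del: of_nat_div)
  also have "x\<^sup>2 = real (n\<^sup>2)" by (simp add: x_def)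
  finally show "2 + 16 * (2 * n + 1) * (w + 1) + (2 * n + 1) + (4 * n\<^sup>2 + 30 * n + 50) div 5 \<le> n\<^sup>2"
    by (simp only: of_nat_le_iff)
qed

context suzuki
begin

lemma card_other_subgroups_le:
  fixes L :: nat
  obtains w where "L * w \<le> L * 2 ^ L + 16 * (2 * n + 1)"
    "card other_subgroups \<le> 2 ^ (2 + 16 * (2 * n + 1) * (w + 1) + (2 * n + 1) + (4 * n\<^sup>2 + 30 * n + 50) div 5)"
proof -
  define g where "g = card (carrier G)"
  define w where "w = card (prime_factors g)"
  define m where "m = 2 * n + 1"
  \<comment> \<open>large enough for \<open>E + n + 2 \<le> Y\<close> and \<open>2 * E' + 2 * n + 2 \<le> Y\<close>\<close>
  define Y where "Y = (4 * n\<^sup>2 + 30 * n + 50) div 5"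
  define E where "E = (4 * n + 8)\<^sup>2 div 20 + 1"
  define E' where "E' = (2 * n + 5)\<^sup>2 div 12 + 1"
  have q: "q = 2 ^ m" by (simp add: q_eq m_def)
  have g0: "g > 0" unfolding g_def using fin_G group.subgroup_self[OF group_G]
    by (meson subgroup.finite_imp_card_positive)
  have "g \<le> q ^ 16" using card_G by (simp add: g_def)
  also have "q ^ 16 = 2 ^ (16 * m)" unfolding q by (simp only: power_mult[symmetric] mult.commute)
  finally have g_le: "g \<le> 2 ^ (16 * m)" .
  have w_le: "L * w \<le> L * 2 ^ L + 16 * m"
    unfolding w_def by (rule card_prime_factors_bound[OF g0 g_le])
  have E: "(4 * n + 8)\<^sup>2 \<le> 20 * E" "(2 * n + 5)\<^sup>2 \<le> 12 * E'"
  proof -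
    have "x \<le> 20 * (x div 20 + 1)" for x :: nat by presburger
    moreover have "x \<le> 12 * (x div 12 + 1)" for x :: nat by presburger
    ultimately show "(4 * n + 8)\<^sup>2 \<le> 20 * E" "(2 * n + 5)\<^sup>2 \<le> 12 * E'" unfolding E_def E'_def by auto
  qed
  have n1: "n + 1 \<le> 2 ^ n" using less_exp[of n] by linarith
  have b1: "(4 * n + 3) * 2 ^ E \<le> 2 ^ Y"
  proof -
    have "4 * n + 3 \<le> 4 * 2 ^ n" using n1 by linarith
    hence "(4 * n + 3) * 2 ^ E \<le> 4 * 2 ^ n * 2 ^ E" by (intro mult_right_mono) auto
    also have "\<dots> = 2 ^ (2 + n + E)" by (simp add: power_add)
    also have "\<dots> \<le> 2 ^ Y"
      unfolding E_def Y_def by (intro power_increasing) (auto simp: power2_eq_square algebra_simps)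
    finally show ?thesis .
  qed
  have b2: "((2 * n + 2) * 2 ^ E')\<^sup>2 \<le> 2 ^ Y"
  proof -
    have "2 * n + 2 \<le> 2 * 2 ^ n" using n1 by linarith
    hence "((2 * n + 2) * 2 ^ E')\<^sup>2 \<le> (2 * 2 ^ n * 2 ^ E')\<^sup>2" by (intro power_mono mult_right_mono) auto
    also have "2 * 2 ^ n * 2 ^ E' = (2::nat) ^ (1 + n + E')" by (simp add: power_add)
    also have "(2 ^ (1 + n + E'))\<^sup>2 = (2::nat) ^ ((1 + n + E') * 2)" by (rule power_mult[symmetric])
    also have "\<dots> \<le> 2 ^ Y"
      unfolding E'_def Y_def by (intro power_increasing) (auto simp: power2_eq_square algebra_simps)
    finally show ?thesis .
  qed
  define N where "N = q * ((4 * n + 3) * 2 ^ E + ((2 * n + 2) * 2 ^ E')\<^sup>2)"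
  have "N \<le> 2 ^ m * (2 ^ Y + 2 ^ Y)" unfolding N_def q using b1 b2 by (intro mult_left_mono add_mono) auto
  also have "\<dots> = 2 ^ (m + Y + 1)" by (simp add: power_add)
  finally have "N + 1 \<le> 2 ^ (m + Y + 1) + 2 ^ (m + Y + 1)" by (intro add_mono) auto
  hence N: "N + 1 \<le> 2 ^ (m + Y + 2)" by simp
  have "card other_subgroups \<le> g * (N + 1) * g ^ w"
    unfolding g_def N_def
    using card_invariant_P_subgroups[OF E] by (intro card_other_subgroups) (auto simp: w_def g_def)
  also have "\<dots> = (N + 1) * g ^ (w + 1)" by (simp add: algebra_simps)
  also have "\<dots> \<le> 2 ^ (m + Y + 2) * (2 ^ (16 * m)) ^ (w + 1)"
    using N g_le by (intro mult_mono power_mono) auto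
  also have "\<dots> = 2 ^ (m + Y + 2 + 16 * m * (w + 1))" by (simp only: power_add power_mult)
  also have "m + Y + 2 + 16 * m * (w + 1) = 2 + 16 * m * (w + 1) + m + Y" by simp
  finally have "card other_subgroups \<le> 2 ^ (2 + 16 * m * (w + 1) + m + Y)" .
  thus thesis using that[of w] w_le unfolding m_def Y_def by blast
qed

lemma all_subgroups_split:
  "card (all_subgroups G) = card two_subgroups + card other_subgroups"
proof -
  have "all_subgroups G = two_subgroups \<union> other_subgroups" by (auto simp: two_subgroups_def other_subgroups_def)
  moreover have "two_subgroups \<inter> other_subgroups = {}" by (auto simp: two_subgroups_def other_subgroups_def)
  ultimately show ?thesis using finite_all_subgroups by (metis card_Un_disjoint finite_Un)
qed

end

lemma proportion_bound:
  "\<exists>n0. \<forall>n\<ge>n0. 1 - (1 / 2) ^ n \<le> real (card {H \<in> all_subgroups (Sz n). finite_p_group 2 ((Sz n)\<lparr>carrier := H\<rparr>)})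
              / real (card (all_subgroups (Sz n)))"
proof -
  obtain L :: nat where L: "25600 \<le> L" by blast
  obtain n0 where n0: "\<And>n w. n \<ge> n0 \<Longrightarrow> L * w \<le> L * 2 ^ L + 16 * (2 * n + 1) \<Longrightarrow>
    2 + 16 * (2 * n + 1) * (w + 1) + (2 * n + 1) + (4 * n\<^sup>2 + 30 * n + 50) div 5 \<le> n\<^sup>2"
    using exponent_estimate[of L "2 ^ L"] L by metis
  show ?thesis
  proof (intro exI allI impI)
    fix n assume n: "n \<ge> max 1 n0"
    interpret suzuki n using n by unfold_locales simp
    obtain w where w: "L * w \<le> L * 2 ^ L + 16 * (2 * n + 1)"
      "card other_subgroups \<le> 2 ^ (2 + 16 * (2 * n + 1) * (w + 1) + (2 * n + 1) + (4 * n\<^sup>2 + 30 * n + 50) div 5)"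
      by (rule card_other_subgroups_le)
    have "card other_subgroups \<le> 2 ^ n\<^sup>2"
      using w(2) power_increasing[OF n0[OF _ w(1)], of 2] n by (meson max.boundedE one_le_numeral order_trans)
    hence other: "real (card other_subgroups) \<le> 2 ^ n\<^sup>2"
      by (metis of_nat_le_iff of_nat_numeral of_nat_power)
    have "2 ^ (n\<^sup>2 + n) \<le> card two_subgroups" using card_two_subgroups by (simp add: power2_eq_square)
    hence two: "2 ^ (n\<^sup>2 + n) \<le> real (card two_subgroups)"
      by (metis of_nat_le_iff of_nat_numeral of_nat_power)
    define T W where "T = real (card two_subgroups)" and "W = real (card other_subgroups)"
    have T: "2 ^ n\<^sup>2 * 2 ^ n \<le> T" using two by (simp add: T_def power_add)
    have W: "W \<le> 2 ^ n\<^sup>2" "0 \<le> W" using other by (simp_all add: W_def)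
    have T0: "T > 0" by (rule less_le_trans[OF _ T]) simp
    have "(1 - (1 / 2) ^ n) * (T + W) \<le> T"
    proof -
      have "W \<le> (1 / 2) ^ n * T"
      proof -
        have "W * 2 ^ n \<le> 2 ^ n\<^sup>2 * 2 ^ n" using W(1) by (rule mult_right_mono) simp
        hence "W * 2 ^ n \<le> T" using T by (rule order_trans)
        thus ?thesis by (simp add: power_one_over field_simps)
      qed
      also have "\<dots> \<le> (1 / 2) ^ n * (T + W)" using W by (intro mult_left_mono) auto
      finally show ?thesis by (simp add: algebra_simps)
    qed
    hence "1 - (1 / 2) ^ n \<le> T / (T + W)" using T0 W by (simp add: pos_le_divide_eq)
    thus "1 - (1 / 2) ^ n \<le> real (card {H \<in> all_subgroups (Sz n). finite_p_group 2 ((Sz n)\<lparr>carrier := H\<rparr>)})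
              / real (card (all_subgroups (Sz n)))"
      unfolding T_def W_def all_subgroups_split two_subgroups_def[symmetric] by simp
  qed
qed

theorem mainTheorem2:
  shows "(\<lambda>n. real (card {H \<in> all_subgroups (Sz n). finite_p_group 2 ((Sz n)\<lparr>carrier := H\<rparr>)})
              / real (card (all_subgroups (Sz n)))) \<longlonglongrightarrow> 1"
proof (rule tendsto_sandwich)
  show "eventually (\<lambda>n. 1 - (1 / 2) ^ n \<le> real (card {H \<in> all_subgroups (Sz n). finite_p_group 2 ((Sz n)\<lparr>carrier := H\<rparr>)})
              / real (card (all_subgroups (Sz n)))) sequentially"
    using proportion_bound by (simp add: eventually_sequentially)
  show "eventually (\<lambda>n. real (card {H \<in> all_subgroups (Sz n). finite_p_group 2 ((Sz n)\<lparr>carrier := H\<rparr>)})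
              / real (card (all_subgroups (Sz n))) \<le> 1) sequentially"
    using eventually_gt_at_top[of 0]
  proof eventually_elim
    case (elim n)
    then interpret suzuki n by unfold_locales
    show ?case using all_subgroups_split unfolding two_subgroups_def[symmetric]
      by (simp add: divide_le_eq_1) linarith
  qed
  show "(\<lambda>n. 1 - (1 / 2) ^ n) \<longlonglongrightarrow> (1::real)"
    using tendsto_diff[OF tendsto_const LIMSEQ_power_zero[of "1 / 2 :: real"], of 1] by simp
qed simp

end
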